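(* Let $M$ be a compact Kähler manifold with positive first Chern class and let $g(t)$, $t\in[0,\infty)$, be the solution of the (normalized) Kähler Ricci flow $\frac{\partial}{\partial t}g_{i\bar j}=g_{i\bar j}-R_{i\bar j}$ starting from a Kähler metric $g(0)$ in the canonical Kähler class. Suppose that $g(t)$ has positive orthogonal bisectional curvature for every $t\ge 0$. Then: 1. If $g(0)$ has positive Ricci curvature, then $g(t)$ has positive Ricci curvature for all $t\ge0$. 2. If the Ricci curvature of $g(0)$ is not positive, and $-\mu_0\le 0$ denotes its optimal lower bound (the largest real number with $Ric(g(0))\ge-\mu_0\,g(0)$), then the lower bound of the Ricci curvature increases, and increases at least to $0$ as $t\to\infty$: there is a non-increasing function $\mu:[0,\infty)\to[0,\infty)$, strictly decreasing wherever it is positive, with $\mu(0)=\mu_0$ and $\lim_{t\to\infty}\mu(t)=0$, such that $Ric(g(t))\ge-\mu(t)\,g(t)$ for all $t\ge0$.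
   Context: A Kähler metric $g$ has positive orthogonal bisectional curvature if its curvature tensor satisfies $R(X,\bar X,Y,\bar Y)=R_{i\bar jk\bar l}X^i\bar X^{j}Y^k\bar Y^{l}>0$ for all points and all nonzero $(1,0)$-tangent vectors $X,Y$ at that point with $g(X,\bar Y)=g_{i\bar j}X^i\bar Y^j=0$. The sign convention is that the Fubini–Study metric has positive curvature, and $R_{i\bar j}=g^{k\bar l}R_{i\bar jk\bar l}$. The canonical Kähler class is the class in which the Kähler form $\omega=\sqrt{-1}\,g_{i\bar j}dz^i\wedge d\bar z^j$ and the Ricci form $\sqrt{-1}\,R_{i\bar j}dz^i\wedge d\bar z^j$ are cohomologous, i.e. $[\omega]=2\pi c_1(M)$; for initial metrics in this class the normalized flow exists for all $t\ge0$. *)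

theory Defs
  imports "HOL-Analysis.Analysis"
begin

section \<open>Smooth functions\<close>

text \<open>The set may have boundary, as for \<open>U \<times> {0..}\<close> with \<open>U\<close> open: all derivatives are taken within the
  set (on such sets they are unique) and have to be continuous up to the boundary.\<close>

primrec Ck_on :: "nat \<Rightarrow> 'a::real_normed_vector set \<Rightarrow> ('a \<Rightarrow> 'b::real_normed_vector) \<Rightarrow> bool" where
  "Ck_on 0 S f \<longleftrightarrow> continuous_on S f"
| "Ck_on (Suc k) S f \<longleftrightarrow>
     (\<exists>f'. (\<forall>x\<in>S. (f has_derivative f' x) (at x within S)) \<and> (\<forall>v. Ck_on k S (\<lambda>x. f' x v)))"

definition smooth_on :: "'a::real_normed_vector set \<Rightarrow> ('a \<Rightarrow> 'b::real_normed_vector) \<Rightarrow> bool" where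
  "smooth_on S f \<longleftrightarrow> (\<forall>k. Ck_on k S f)"


section \<open>Complex manifolds\<close>

text \<open>A chart is a pair of its domain and its coordinate map; the values of the map outside of the
  domain are irrelevant.\<close>

type_synonym ('m, 'n) chart = "'m set \<times> ('m \<Rightarrow> complex^'n)"

definition chart_image :: "('m, 'n::finite) chart \<Rightarrow> (complex^'n) set" where
  "chart_image c = snd c ` fst c"

definition overlap :: "('m, 'n::finite) chart \<Rightarrow> ('m, 'n) chart \<Rightarrow> (complex^'n) set" where
  "overlap c d = snd c ` (fst c \<inter> fst d)"

definition transition :: "('m, 'n::finite) chart \<Rightarrow> ('m, 'n) chart \<Rightarrow> complex^'n \<Rightarrow> complex^'n" where
  "transition c d z = snd d (inv_into (fst c) (snd c) z)"

abbreviation transition_deriv ::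
    "('m, 'n::finite) chart \<Rightarrow> ('m, 'n) chart \<Rightarrow> complex^'n \<Rightarrow> complex^'n \<Rightarrow> complex^'n" where
  "transition_deriv c d z \<equiv> frechet_derivative (transition c d) (at z)"

text \<open>Holomorphic in several variables: real differentiable with complex linear derivative.\<close>

definition holomorphic_map_on ::
    "(complex^'n::finite) set \<Rightarrow> (complex^'n \<Rightarrow> complex^'k::finite) \<Rightarrow> bool" where
  "holomorphic_map_on S f \<longleftrightarrow>
     (\<forall>z\<in>S. \<exists>f'. (f has_derivative f') (at z) \<and> (\<forall>a v. f' (a *s v) = a *s f' v))"

definition complex_manifold :: "'m topology \<Rightarrow> ('m, 'n::finite) chart set \<Rightarrow> bool" where
  "complex_manifold X A \<longleftrightarrow>
     Hausdorff_space X \<and> second_countable X \<and>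
     topspace X = (\<Union>c\<in>A. fst c) \<and>
     (\<forall>c\<in>A. openin X (fst c) \<and> open (chart_image c) \<and>
        homeomorphic_map (subtopology X (fst c)) (top_of_set (chart_image c)) (snd c)) \<and>
     (\<forall>c\<in>A. \<forall>d\<in>A. holomorphic_map_on (overlap c d) (transition c d))"


section \<open>Kaehler metrics\<close>

text \<open>A (1,1)-tensor \<open>h\<^sub>i\<^sub>j dz\<^sup>i \<otimes> d cnj(z\<^sup>j)\<close> is given by its matrices of components in the charts, as
  functions of the coordinates. Real and (1,0)-tangent vectors are both identified with
  vectors in \<open>complex^'n\<close>.\<close>

type_synonym ('m, 'n) tensor11 = "('m, 'n) chart \<Rightarrow> complex^'n \<Rightarrow> complex^'n^'n"

definition hform :: "complex^'n^'n \<Rightarrow> complex^'n \<Rightarrow> complex^'n \<Rightarrow> complex" where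
  "hform H u v = (\<Sum>i\<in>UNIV. \<Sum>j\<in>UNIV. H $ i $ j * u $ i * cnj (v $ j))"

definition hermitian_metric :: "('m, 'n::finite) chart set \<Rightarrow> ('m, 'n) tensor11 \<Rightarrow> bool" where
  "hermitian_metric A g \<longleftrightarrow>
     (\<forall>c\<in>A. smooth_on (chart_image c) (g c)) \<and>
     (\<forall>c\<in>A. \<forall>z\<in>chart_image c. \<forall>i j. g c z $ j $ i = cnj (g c z $ i $ j)) \<and>
     (\<forall>c\<in>A. \<forall>z\<in>chart_image c. \<forall>u. u \<noteq> 0 \<longrightarrow> Re (hform (g c z) u u) > 0) \<and>
     (\<forall>c\<in>A. \<forall>d\<in>A. \<forall>z\<in>overlap c d. \<forall>u v.
        hform (g c z) u v =
        hform (g d (transition c d z)) (transition_deriv c d z u) (transition_deriv c d z v))"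

type_synonym ('m, 'n) form1 = "('m, 'n) chart \<Rightarrow> complex^'n \<Rightarrow> complex^'n \<Rightarrow> real"
type_synonym ('m, 'n) form2 = "('m, 'n) chart \<Rightarrow> complex^'n \<Rightarrow> complex^'n \<Rightarrow> complex^'n \<Rightarrow> real"

text \<open>The 2-form \<open>\<i> h\<^sub>i\<^sub>j dz\<^sup>i \<and> d cnj(z\<^sup>j)\<close>, evaluated on real tangent vectors;
  the number is real when \<open>h\<close> is Hermitian.\<close>

definition assoc_form :: "('m, 'n::finite) tensor11 \<Rightarrow> ('m, 'n) form2" where
  "assoc_form h c z u v =
     Re (\<i> * (\<Sum>i\<in>UNIV. \<Sum>j\<in>UNIV. h c z $ i $ j * (u $ i * cnj (v $ j) - v $ i * cnj (u $ j))))"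

text \<open>Exterior derivatives, in a chart, evaluated on constant vector fields.\<close>

definition ext_deriv1 :: "('m, 'n::finite) form1 \<Rightarrow> ('m, 'n) form2" where
  "ext_deriv1 \<eta> c z u v =
     frechet_derivative (\<lambda>y. \<eta> c y v) (at z) u - frechet_derivative (\<lambda>y. \<eta> c y u) (at z) v"

definition closed_form2 :: "('m, 'n::finite) chart set \<Rightarrow> ('m, 'n) form2 \<Rightarrow> bool" where
  "closed_form2 A \<alpha> \<longleftrightarrow>
     (\<forall>c\<in>A. \<forall>z\<in>chart_image c. \<forall>u v w.
        frechet_derivative (\<lambda>y. \<alpha> c y v w) (at z) u +
        frechet_derivative (\<lambda>y. \<alpha> c y w u) (at z) v +
        frechet_derivative (\<lambda>y. \<alpha> c y u v) (at z) w = 0)"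

definition kaehler_metric :: "('m, 'n::finite) chart set \<Rightarrow> ('m, 'n) tensor11 \<Rightarrow> bool" where
  "kaehler_metric A g \<longleftrightarrow> hermitian_metric A g \<and> closed_form2 A (assoc_form g)"

definition compact_kaehler_manifold :: "'m topology \<Rightarrow> ('m, 'n::finite) chart set \<Rightarrow> bool" where
  "compact_kaehler_manifold X A \<longleftrightarrow>
     complex_manifold X A \<and> compact_space X \<and> (\<exists>g. kaehler_metric A g)"


section \<open>Curvature\<close>

text \<open>The Wirtinger operators \<open>\<partial>/\<partial>z\<^sup>k\<close> and \<open>\<partial>/\<partial> cnj(z\<^sup>k)\<close>.\<close>

definition dz :: "'n::finite \<Rightarrow> (complex^'n \<Rightarrow> complex) \<Rightarrow> complex^'n \<Rightarrow> complex" where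
  "dz k f z = (frechet_derivative f (at z) (axis k 1) -
               \<i> * frechet_derivative f (at z) (axis k \<i>)) / 2"

definition dzbar :: "'n::finite \<Rightarrow> (complex^'n \<Rightarrow> complex) \<Rightarrow> complex^'n \<Rightarrow> complex" where
  "dzbar k f z = (frechet_derivative f (at z) (axis k 1) +
                  \<i> * frechet_derivative f (at z) (axis k \<i>)) / 2"

text \<open>The components \<open>g\<^sup>p\<^sup>q\<close> (\<open>q\<close> barred) are determined by \<open>\<Sum>q. g\<^sub>i\<^sub>q g\<^sup>p\<^sup>q = \<delta>\<^sub>i\<^sub>p\<close>, hence the transposition.\<close>

definition ginv :: "('m, 'n::finite) tensor11 \<Rightarrow> ('m, 'n) chart \<Rightarrow> complex^'n \<Rightarrow> 'n \<Rightarrow> 'n \<Rightarrow> complex" where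
  "ginv g c z p q = matrix_inv (g c z) $ q $ p"

text \<open>The curvature tensor of a Kaehler metric in holomorphic coordinates (bars on \<open>j, l, q\<close>):
  \<open>R\<^sub>i\<^sub>j\<^sub>k\<^sub>l = - \<partial>\<^sub>k \<partial>\<^sub>l g\<^sub>i\<^sub>j + g\<^sup>p\<^sup>q (\<partial>\<^sub>k g\<^sub>i\<^sub>q) (\<partial>\<^sub>l g\<^sub>p\<^sub>j)\<close>.
  With this sign the Fubini-Study metric has positive curvature.\<close>

definition curv :: "('m, 'n::finite) tensor11 \<Rightarrow> ('m, 'n) chart \<Rightarrow> complex^'n
    \<Rightarrow> 'n \<Rightarrow> 'n \<Rightarrow> 'n \<Rightarrow> 'n \<Rightarrow> complex" where
  "curv g c z i j k l =
     - dz k (dzbar l (\<lambda>y. g c y $ i $ j)) z +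
     (\<Sum>p\<in>UNIV. \<Sum>q\<in>UNIV. ginv g c z p q *
        dz k (\<lambda>y. g c y $ i $ q) z * dzbar l (\<lambda>y. g c y $ p $ j) z)"

definition ric :: "('m, 'n::finite) tensor11 \<Rightarrow> ('m, 'n) tensor11" where
  "ric g c z = (\<chi> i j. \<Sum>k\<in>UNIV. \<Sum>l\<in>UNIV. ginv g c z k l * curv g c z i j k l)"

definition bisectional :: "('m, 'n::finite) tensor11 \<Rightarrow> ('m, 'n) chart \<Rightarrow> complex^'n
    \<Rightarrow> complex^'n \<Rightarrow> complex^'n \<Rightarrow> complex" where
  "bisectional g c z u v =
     (\<Sum>i\<in>UNIV. \<Sum>j\<in>UNIV. \<Sum>k\<in>UNIV. \<Sum>l\<in>UNIV.
        curv g c z i j k l * u $ i * cnj (u $ j) * v $ k * cnj (v $ l))"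

text \<open>For Kaehler metrics the numbers below, of which the real parts are taken, are real.\<close>

definition positive_orthogonal_bisectional ::
    "('m, 'n::finite) chart set \<Rightarrow> ('m, 'n) tensor11 \<Rightarrow> bool" where
  "positive_orthogonal_bisectional A g \<longleftrightarrow>
     (\<forall>c\<in>A. \<forall>z\<in>chart_image c. \<forall>u v. u \<noteq> 0 \<longrightarrow> v \<noteq> 0 \<longrightarrow> hform (g c z) u v = 0 \<longrightarrow>
        Re (bisectional g c z u v) > 0)"

definition positive_ricci :: "('m, 'n::finite) chart set \<Rightarrow> ('m, 'n) tensor11 \<Rightarrow> bool" where
  "positive_ricci A g \<longleftrightarrow>
     (\<forall>c\<in>A. \<forall>z\<in>chart_image c. \<forall>u. u \<noteq> 0 \<longrightarrow> Re (hform (ric g c z) u u) > 0)"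

definition ricci_ge :: "('m, 'n::finite) chart set \<Rightarrow> ('m, 'n) tensor11 \<Rightarrow> real \<Rightarrow> bool" where
  "ricci_ge A g a \<longleftrightarrow>
     (\<forall>c\<in>A. \<forall>z\<in>chart_image c. \<forall>u. Re (hform (ric g c z) u u) \<ge> a * Re (hform (g c z) u u))"

definition optimal_ricci_bound :: "('m, 'n::finite) chart set \<Rightarrow> ('m, 'n) tensor11 \<Rightarrow> real \<Rightarrow> bool" where
  "optimal_ricci_bound A g a \<longleftrightarrow> ricci_ge A g a \<and> (\<forall>b. ricci_ge A g b \<longrightarrow> b \<le> a)"


section \<open>The first Chern class and the canonical Kaehler class\<close>

definition smooth_form1 :: "('m, 'n::finite) chart set \<Rightarrow> ('m, 'n) form1 \<Rightarrow> bool" where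
  "smooth_form1 A \<eta> \<longleftrightarrow>
     (\<forall>c\<in>A. \<forall>z\<in>chart_image c. linear (\<eta> c z)) \<and>
     (\<forall>c\<in>A. \<forall>u. smooth_on (chart_image c) (\<lambda>z. \<eta> c z u)) \<and>
     (\<forall>c\<in>A. \<forall>d\<in>A. \<forall>z\<in>overlap c d. \<forall>u.
        \<eta> c z u = \<eta> d (transition c d z) (transition_deriv c d z u))"

definition cohomologous :: "('m, 'n::finite) chart set \<Rightarrow> ('m, 'n) form2 \<Rightarrow> ('m, 'n) form2 \<Rightarrow> bool" where
  "cohomologous A \<alpha> \<beta> \<longleftrightarrow>
     (\<exists>\<eta>. smooth_form1 A \<eta> \<and>
        (\<forall>c\<in>A. \<forall>z\<in>chart_image c. \<forall>u v. \<alpha> c z u v - \<beta> c z u v = ext_deriv1 \<eta> c z u v))"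

text \<open>The Ricci form of any Kaehler metric represents \<open>2 * pi\<close> times the first Chern class.\<close>

definition represents_c1 :: "('m, 'n::finite) chart set \<Rightarrow> ('m, 'n) form2 \<Rightarrow> bool" where
  "represents_c1 A \<alpha> \<longleftrightarrow>
     (\<exists>k. kaehler_metric A k \<and>
        cohomologous A (\<lambda>c z u v. 2 * pi * \<alpha> c z u v) (assoc_form (ric k)))"

definition positive_c1 :: "('m, 'n::finite) chart set \<Rightarrow> bool" where
  "positive_c1 A \<longleftrightarrow> (\<exists>h. kaehler_metric A h \<and> represents_c1 A (assoc_form h))"

definition canonical_class :: "('m, 'n::finite) chart set \<Rightarrow> ('m, 'n) tensor11 \<Rightarrow> bool" where
  "canonical_class A g \<longleftrightarrow> cohomologous A (assoc_form g) (assoc_form (ric g))"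


section \<open>The normalized Kaehler Ricci flow\<close>

text \<open>A solution on \<open>[0, \<infinity>)\<close> is smooth in space and time together, up to the initial time.\<close>

definition kaehler_ricci_flow ::
    "('m, 'n::finite) chart set \<Rightarrow> (real \<Rightarrow> ('m, 'n) tensor11) \<Rightarrow> bool" where
  "kaehler_ricci_flow A g \<longleftrightarrow>
     (\<forall>t\<ge>0. kaehler_metric A (g t)) \<and>
     (\<forall>c\<in>A. smooth_on (chart_image c \<times> {0..}) (\<lambda>(z, t). g t c z)) \<and>
     (\<forall>c\<in>A. \<forall>z\<in>chart_image c. \<forall>t\<ge>0.
        ((\<lambda>s. g s c z) has_vector_derivative (g t c z - ric (g t) c z)) (at t within {0..}))"

end

theory Submission
  imports Defs
begin

text \<open>For every real \<open>b\<close>, a bound \<open>Ric(g(0)) \<ge> b g(0)\<close> implies \<open>Ric(g(t)) \<ge> b e\<^sup>-\<^sup>t g(t)\<close>, which gives both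
  parts, with \<open>\<mu>(t) = \<mu>\<^sub>0 e\<^sup>-\<^sup>t\<close>. To see this, let \<open>a(t) = b e\<^sup>-\<^sup>t - \<epsilon>\<close> and consider the first time at which
  \<open>S = Ric - a g\<close> has a null vector \<open>v\<close>. Extend \<open>v\<close> to a holomorphic vector field \<open>V\<close> that is parallel at
  the point. Then \<open>(\<partial>\<^sub>t - \<Delta>) S(V, V)\<close> is \<open>Rm(v, v) * S - (a' + a - a\<^sup>2) g(v, v)\<close> at this point. Since \<open>S\<close> is
  a sum of squares of covectors that vanish on \<open>v\<close>, the first term is a sum of orthogonal bisectional
  curvatures, hence nonnegative, and the second one is \<open>(\<epsilon> + a\<^sup>2) g(v, v) > 0\<close>. This contradicts
  the maximum principle.\<close>

section \<open>Calculus of smooth functions\<close>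

text \<open>Covariant derivatives and the evolution of the full curvature tensor never appear. The
  flow gives \<open>\<partial>\<^sub>t R\<^sub>i\<^sub>j = \<partial>\<^sub>i \<partial>\<^sub>j
  R\<close> (j barred), so only the complex Hessian of one scalar, a trace against the inverse
  metric, has to be computed. With \<open>a\<close> frozen at the contact time,
  \<open>Ric - a g\<close> is closed in space, so derivative indices may be exchanged with tensor
  indices; this turns the Hessian of the trace in direction \<open>v\<close> into the metric trace
  of the Hessian of \<open>S(V, V)\<close>, plus curvature. The origin of the exponential: at a
  vector with \<open>Ric(v, v) = a g(v, v)\<close> the flow gives \<open>a g(v, v)\<close> the time
  derivative \<open>(a' + a - a\<^sup>2) g(v, v)\<close>. The factor in the bound solves a' + a = 0,
  and the remaining \<open>- a\<^sup>2\<close> has the right sign for \<open>b\<close> of either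
  sign, so one estimate serves both parts of the theorem. The \<epsilon> makes the bound strict at
  the start, which moves the first contact to a positive time. There space-time is open and all
  derivatives are two-sided; at time 0 continuity suffices.\<close>

lemma Ck_on_Suc_imp: "Ck_on (Suc k) S f \<Longrightarrow> Ck_on k S f"
proof (induction k arbitrary: f)
  case 0
  then show ?case
    by (auto simp: continuous_on_eq_continuous_within intro: has_derivative_continuous)
next
  case (Suc k)
  then obtain f' where "\<forall>x\<in>S. (f has_derivative f' x) (at x within S)"
    and "\<forall>v. Ck_on (Suc k) S (\<lambda>x. f' x v)"
    by (auto simp only: Ck_on.simps(2))
  with Suc.IH show ?case
    by (auto intro!: exI[of _ f'])
qed

lemma Ck_on_subset: "Ck_on k S f \<Longrightarrow> T \<subseteq> S \<Longrightarrow> Ck_on k T f"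
proof (induction k arbitrary: f)
  case 0
  then show ?case by (auto intro: continuous_on_subset)
next
  case (Suc k)
  then obtain f' where "\<forall>x\<in>S. (f has_derivative f' x) (at x within S)"
    and "\<forall>v. Ck_on k S (\<lambda>x. f' x v)"
    by auto
  with Suc show ?case
    by (auto intro!: exI[of _ f'] intro: has_derivative_subset)
qed

lemma Ck_on_cong:
  assumes "\<And>x. x \<in> S \<Longrightarrow> f x = g x"
  shows "Ck_on k S f \<longleftrightarrow> Ck_on k S g"
proof (cases k)
  case 0
  then show ?thesis using assms by (simp cong: continuous_on_cong)
next
  case (Suc l)
  have "(f has_derivative D) (at x within S) \<longleftrightarrow> (g has_derivative D) (at x within S)"
    if "x \<in> S" for x D
    using that assms by (metis has_derivative_transform)
  then show ?thesis unfolding Suc Ck_on.simps by meson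
qed

lemma Ck_on_const: "Ck_on k S (\<lambda>x. c)"
  by (induction k arbitrary: c) (auto intro!: exI[of _ "\<lambda>_ _. 0"] continuous_intros derivative_intros)

lemma Ck_on_bounded_linear:
  assumes "bounded_linear L" "Ck_on k S f"
  shows "Ck_on k S (\<lambda>x. L (f x))"
  using assms(2)
proof (induction k arbitrary: f)
  case 0
  then show ?case
    using assms(1) by (auto intro: bounded_linear.continuous_on)
next
  case (Suc k)
  then obtain f' where "\<forall>x\<in>S. (f has_derivative f' x) (at x within S)"
    and "\<forall>v. Ck_on k S (\<lambda>x. f' x v)"
    by auto
  with Suc show ?case
    by (auto intro!: exI[of _ "\<lambda>x v. L (f' x v)"] bounded_linear.has_derivative[OF assms(1)])
qed

lemma Ck_on_add:
  assumes "Ck_on k S f" "Ck_on k S g"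
  shows "Ck_on k S (\<lambda>x. f x + g x)"
  using assms
proof (induction k arbitrary: f g)
  case 0
  then show ?case by (auto intro: continuous_intros)
next
  case (Suc k)
  from Suc.prems(1) obtain f' where f': "\<forall>x\<in>S. (f has_derivative f' x) (at x within S)"
    "\<forall>v. Ck_on k S (\<lambda>x. f' x v)" by auto
  from Suc.prems(2) obtain g' where g': "\<forall>x\<in>S. (g has_derivative g' x) (at x within S)"
    "\<forall>v. Ck_on k S (\<lambda>x. g' x v)" by auto
  show ?case
    using f' g' Suc.IH by (auto intro!: exI[of _ "\<lambda>x v. f' x v + g' x v"] derivative_eq_intros)
qed

lemma Ck_on_mult:
  fixes f g :: "'a::real_normed_vector \<Rightarrow> 'b::real_normed_algebra"
  assumes "Ck_on k S f" "Ck_on k S g"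
  shows "Ck_on k S (\<lambda>x. f x * g x)"
  using assms
proof (induction k arbitrary: f g)
  case 0
  then show ?case by (auto intro: continuous_intros)
next
  case (Suc k)
  from Suc.prems(1) obtain f' where f': "\<forall>x\<in>S. (f has_derivative f' x) (at x within S)"
    "\<forall>v. Ck_on k S (\<lambda>x. f' x v)" by auto
  from Suc.prems(2) obtain g' where g': "\<forall>x\<in>S. (g has_derivative g' x) (at x within S)"
    "\<forall>v. Ck_on k S (\<lambda>x. g' x v)" by auto
  have "Ck_on k S f" "Ck_on k S g"
    using Suc.prems Ck_on_Suc_imp by auto
  then show ?case
    using f' g' Suc.IH
    by (auto intro!: exI[of _ "\<lambda>x v. f x * g' x v + f' x v * g x"] has_derivative_mult Ck_on_add)
qed

text \<open>The derivative \<open>- (inverse f * f' * inverse f)\<close> contains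
  \<open>inverse f\<close> only to order \<open>k\<close>, so the induction hypothesis covers
  it.\<close>

lemma Ck_on_inverse:
  fixes f :: "'a::real_normed_vector \<Rightarrow> 'b::real_normed_div_algebra"
  assumes "Ck_on k S f" "\<And>x. x \<in> S \<Longrightarrow> f x \<noteq> 0"
  shows "Ck_on k S (\<lambda>x. inverse (f x))"
  using assms(1)
proof (induction k)
  case 0
  then show ?case using assms(2) by (auto intro: continuous_intros)
next
  case (Suc k)
  from Suc.prems obtain f' where f': "\<forall>x\<in>S. (f has_derivative f' x) (at x within S)"
    "\<forall>v. Ck_on k S (\<lambda>x. f' x v)" by auto
  have i: "Ck_on k S (\<lambda>x. inverse (f x))"
    using Suc Ck_on_Suc_imp by auto
  have "Ck_on k S (\<lambda>x. - (inverse (f x) * f' x v * inverse (f x)))" for v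
    using i f'(2) bounded_linear_minus[OF bounded_linear_ident]
    by (intro Ck_on_bounded_linear[of uminus] Ck_on_mult) auto
  then show ?case
    using f' assms(2)
    by (auto intro!: exI[of _ "\<lambda>x v. - (inverse (f x) * f' x v * inverse (f x))"] has_derivative_inverse)
qed

lemma smooth_on_subset: "smooth_on S f \<Longrightarrow> T \<subseteq> S \<Longrightarrow> smooth_on T f"
  by (auto simp: smooth_on_def intro: Ck_on_subset)

lemma smooth_on_cong: "(\<And>x. x \<in> S \<Longrightarrow> f x = g x) \<Longrightarrow> smooth_on S f \<longleftrightarrow> smooth_on S g"
  unfolding smooth_on_def using Ck_on_cong by blast

lemma smooth_on_const: "smooth_on S (\<lambda>x. c)"
  by (simp add: smooth_on_def Ck_on_const)

lemma smooth_on_compose_linear: "bounded_linear L \<Longrightarrow> smooth_on S f \<Longrightarrow> smooth_on S (\<lambda>x. L (f x))"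
  by (simp add: smooth_on_def Ck_on_bounded_linear)

lemma smooth_on_linear: "bounded_linear L \<Longrightarrow> smooth_on S L"
  unfolding smooth_on_def
proof
  fix k
  assume L: "bounded_linear L"
  show "Ck_on k S L"
  proof (cases k)
    case 0
    then show ?thesis using L by (simp add: linear_continuous_on)
  next
    case (Suc l)
    then show ?thesis using L
      by (auto intro!: exI[of _ "\<lambda>_. L"] bounded_linear_imp_has_derivative Ck_on_const)
  qed
qed

lemma smooth_on_add: "smooth_on S f \<Longrightarrow> smooth_on S g \<Longrightarrow> smooth_on S (\<lambda>x. f x + g x)"
  by (simp add: smooth_on_def Ck_on_add)

lemma smooth_on_minus: "smooth_on S f \<Longrightarrow> smooth_on S (\<lambda>x. - f x)"
  using smooth_on_compose_linear[OF bounded_linear_minus[OF bounded_linear_ident]] .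

lemma smooth_on_diff: "smooth_on S f \<Longrightarrow> smooth_on S g \<Longrightarrow> smooth_on S (\<lambda>x. f x - g x)"
  using smooth_on_add[OF _ smooth_on_minus] by fastforce

lemma smooth_on_mult:
  fixes f g :: "'a::real_normed_vector \<Rightarrow> 'b::real_normed_algebra"
  shows "smooth_on S f \<Longrightarrow> smooth_on S g \<Longrightarrow> smooth_on S (\<lambda>x. f x * g x)"
  by (simp add: smooth_on_def Ck_on_mult)

lemma smooth_on_inverse:
  fixes f :: "'a::real_normed_vector \<Rightarrow> 'b::real_normed_div_algebra"
  shows "smooth_on S f \<Longrightarrow> (\<And>x. x \<in> S \<Longrightarrow> f x \<noteq> 0) \<Longrightarrow> smooth_on S (\<lambda>x. inverse (f x))"
  by (simp add: smooth_on_def Ck_on_inverse)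

lemma smooth_on_sum:
  "(\<And>i. i \<in> I \<Longrightarrow> smooth_on S (f i)) \<Longrightarrow> smooth_on S (\<lambda>x. \<Sum>i\<in>I. f i x)"
  by (induction I rule: infinite_finite_induct) (auto intro: smooth_on_const smooth_on_add)

lemma smooth_on_prod:
  fixes f :: "'i \<Rightarrow> 'a::real_normed_vector \<Rightarrow> 'b::{real_normed_algebra,comm_ring_1}"
  shows "(\<And>i. i \<in> I \<Longrightarrow> smooth_on S (f i)) \<Longrightarrow> smooth_on S (\<lambda>x. \<Prod>i\<in>I. f i x)"
  by (induction I rule: infinite_finite_induct) (auto intro: smooth_on_const smooth_on_mult)

lemma smooth_on_cnj: "smooth_on S f \<Longrightarrow> smooth_on S (\<lambda>x. cnj (f x))"
  by (rule smooth_on_compose_linear[OF bounded_linear_cnj])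

lemma smooth_on_imp_continuous_on: "smooth_on S f \<Longrightarrow> continuous_on S f"
  unfolding smooth_on_def by (metis Ck_on.simps(1))

lemma smooth_on_differentiable:
  assumes "open S" "smooth_on S f" "x \<in> S"
  shows "f differentiable (at x)"
proof -
  have "Ck_on (Suc 0) S f" using assms(2) unfolding smooth_on_def by blast
  then obtain f' where "(f has_derivative f' x) (at x within S)"
    using assms(3) unfolding Ck_on.simps by blast
  then show ?thesis
    using at_within_open[OF assms(3,1)] unfolding differentiable_def by auto
qed

text \<open>The witness \<open>f'\<close> in \<open>Ck_on\<close> may change with the order. On an
  open set derivatives are unique, so every witness is the Frechet derivative and the orders fit
  together.\<close>

lemma smooth_on_frechet_derivative:
  assumes "open S" "smooth_on S f"
  shows "smooth_on S (\<lambda>x. frechet_derivative f (at x) e)"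
  unfolding smooth_on_def
proof
  fix k
  have "Ck_on (Suc k) S f" using assms(2) unfolding smooth_on_def by blast
  then obtain f' where f': "\<forall>x\<in>S. (f has_derivative f' x) (at x within S)"
    "\<forall>v. Ck_on k S (\<lambda>x. f' x v)" by auto
  have "frechet_derivative f (at x) e = f' x e" if "x \<in> S" for x
    using f'(1) that assms(1) by (metis at_within_open frechet_derivative_at)
  then have "Ck_on k S (\<lambda>x. frechet_derivative f (at x) e) \<longleftrightarrow> Ck_on k S (\<lambda>x. f' x e)"
    by (rule Ck_on_cong)
  then show "Ck_on k S (\<lambda>x. frechet_derivative f (at x) e)"
    using f'(2) by blast
qed

section \<open>Determinants and inverses of matrix-valued functions\<close>

lemma smooth_on_det:
  fixes G :: "'a::real_normed_vector \<Rightarrow> complex^'n^'n"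
  assumes "\<And>i j. smooth_on S (\<lambda>x. G x $ i $ j)"
  shows "smooth_on S (\<lambda>x. det (G x))"
  unfolding det_def by (intro smooth_on_sum smooth_on_mult smooth_on_const smooth_on_prod assms)

lemma matrix_inv_both:
  fixes G :: "complex^'n^'n"
  assumes "invertible G"
  shows "G ** matrix_inv G = mat 1" "matrix_inv G ** G = mat 1"
proof -
  have "G ** matrix_inv G = mat 1 \<and> matrix_inv G ** G = mat 1"
    unfolding matrix_inv_def using assms unfolding invertible_def by (rule someI_ex)
  then show "G ** matrix_inv G = mat 1" "matrix_inv G ** G = mat 1" by auto
qed

text \<open>By Cramer's rule.\<close>

lemma smooth_on_matrix_inv:
  fixes G :: "'a::real_normed_vector \<Rightarrow> complex^'n^'n"
  assumes "\<And>i j. smooth_on S (\<lambda>x. G x $ i $ j)" and "\<And>x. x \<in> S \<Longrightarrow> invertible (G x)"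
  shows "smooth_on S (\<lambda>x. matrix_inv (G x) $ p $ q)"
proof -
  have d: "det (G x) \<noteq> 0" if "x \<in> S" for x
    using assms(2)[OF that] by (simp add: invertible_det_nz)
  define N where "N x = (\<chi> i j. if j = p then axis q 1 $ i else G x $ i $ j)" for x
  have "matrix_inv (G x) $ p $ q = det (N x) * inverse (det (G x))" if "x \<in> S" for x
  proof -
    have "G x *v (matrix_inv (G x) *v axis q 1) = axis q 1"
      using matrix_inv_both(1)[OF assms(2)[OF that]] by (simp add: matrix_vector_mul_assoc)
    then have *: "matrix_inv (G x) *v axis q 1 =
        (\<chi> k. det (\<chi> i j. if j = k then axis q 1 $ i else G x $ i $ j) / det (G x))"
      using cramer[OF d[OF that]] by blast
    have "matrix_inv (G x) $ p $ q = (matrix_inv (G x) *v axis q 1) $ p"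
      by (simp add: matrix_vector_mult_def axis_def if_distrib cong: if_cong)
    also have "\<dots> = det (N x) / det (G x)" unfolding * N_def by simp
    finally show ?thesis by (simp add: divide_inverse)
  qed
  moreover have "smooth_on S (\<lambda>x. det (N x) * inverse (det (G x)))"
  proof (intro smooth_on_mult smooth_on_det smooth_on_inverse)
    show "smooth_on S (\<lambda>x. N x $ i $ j)" for i j
      using assms(1)[of i j] by (cases "j = p") (simp_all add: N_def smooth_on_const)
  qed (use d assms in auto)
  ultimately show ?thesis by (simp cong: smooth_on_cong)
qed

text \<open>The mean value theorem is applied twice, along \<open>a\<close> and then along
  \<open>b\<close>. The second difference on the left is symmetric in \<open>a\<close> and
  \<open>b\<close>, which is what makes mixed derivatives commute.\<close>

lemma second_difference_mvt:
  fixes f :: "'a::real_normed_vector \<Rightarrow> real"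
  assumes "open S" "smooth_on S f" "h > 0"
    and in_S: "\<And>s t. 0 \<le> s \<Longrightarrow> s \<le> h \<Longrightarrow> 0 \<le> t \<Longrightarrow> t \<le> h \<Longrightarrow> x + s *\<^sub>R a + t *\<^sub>R b \<in> S"
  shows "\<exists>s t. 0 < s \<and> s < h \<and> 0 < t \<and> t < h \<and>
    f (x + h *\<^sub>R a + h *\<^sub>R b) - f (x + h *\<^sub>R a) - f (x + h *\<^sub>R b) + f x =
    h * h * frechet_derivative (\<lambda>y. frechet_derivative f (at y) a) (at (x + s *\<^sub>R a + t *\<^sub>R b)) b"
proof -
  let ?Df = "\<lambda>y. frechet_derivative f (at y)"
  have df: "(f has_derivative ?Df y) (at y)" if "y \<in> S" for y
    using smooth_on_differentiable[OF assms(1,2) that] frechet_derivative_works by blast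
  have dg: "((\<lambda>y. ?Df y a) has_derivative frechet_derivative (\<lambda>y. ?Df y a) (at y)) (at y)"
    if "y \<in> S" for y
    using smooth_on_differentiable[OF assms(1) smooth_on_frechet_derivative[OF assms(1,2)] that]
      frechet_derivative_works by blast
  \<comment> \<open>The vacuous \<open>0 *\<^sub>R b\<close> gives both terms the shape to which
    \<open>lin\<close> applies.\<close>
  define q where "q s = f (x + s *\<^sub>R a + h *\<^sub>R b) - f (x + s *\<^sub>R a + 0 *\<^sub>R b)" for s
  have lin: "((\<lambda>s. f (x + s *\<^sub>R a + t *\<^sub>R b)) has_real_derivative ?Df (x + s *\<^sub>R a + t *\<^sub>R b) a) (at s)"
    if "0 \<le> s" "s \<le> h" "0 \<le> t" "t \<le> h" for s t
  proof -
    have D: "(f has_derivative ?Df (x + s *\<^sub>R a + t *\<^sub>R b)) (at (x + s *\<^sub>R a + t *\<^sub>R b))"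
      using df in_S that by blast
    have "((\<lambda>s. x + s *\<^sub>R a + t *\<^sub>R b) has_derivative (\<lambda>u. u *\<^sub>R a)) (at s)"
      by (auto intro!: derivative_eq_intros)
    from has_derivative_compose[OF this D]
    have "((\<lambda>s. f (x + s *\<^sub>R a + t *\<^sub>R b)) has_derivative (\<lambda>u. ?Df (x + s *\<^sub>R a + t *\<^sub>R b) (u *\<^sub>R a))) (at s)" .
    moreover have "(\<lambda>u. ?Df (x + s *\<^sub>R a + t *\<^sub>R b) (u *\<^sub>R a)) = (*) (?Df (x + s *\<^sub>R a + t *\<^sub>R b) a)"
      using linear_cmul[OF has_derivative_linear[OF D]] by (auto simp: mult.commute)
    ultimately show ?thesis by (simp add: has_field_derivative_def)
  qed
  have "\<exists>s. 0 < s \<and> s < h \<and> q h - q 0 = (h - 0) * (?Df (x + s *\<^sub>R a + h *\<^sub>R b) a - ?Df (x + s *\<^sub>R a + 0 *\<^sub>R b) a)"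
    unfolding q_def using assms(3) by (intro MVT2 DERIV_diff lin) auto
  then obtain s where s: "0 < s" "s < h"
    and q: "q h - q 0 = h * (?Df (x + s *\<^sub>R a + h *\<^sub>R b) a - ?Df (x + s *\<^sub>R a + 0 *\<^sub>R b) a)"
    by auto
  have lin2: "((\<lambda>t. ?Df (x + s *\<^sub>R a + t *\<^sub>R b) a) has_real_derivative
      frechet_derivative (\<lambda>y. ?Df y a) (at (x + s *\<^sub>R a + t *\<^sub>R b)) b) (at t)"
    if "0 \<le> t" "t \<le> h" for t
  proof -
    let ?y = "x + s *\<^sub>R a + t *\<^sub>R b"
    have D: "((\<lambda>y. ?Df y a) has_derivative frechet_derivative (\<lambda>y. ?Df y a) (at ?y)) (at ?y)"
      using dg in_S that s by auto
    have "((\<lambda>t. x + s *\<^sub>R a + t *\<^sub>R b) has_derivative (\<lambda>u. u *\<^sub>R b)) (at t)"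
      by (auto intro!: derivative_eq_intros)
    from has_derivative_compose[OF this D]
    have "((\<lambda>t. ?Df (x + s *\<^sub>R a + t *\<^sub>R b) a) has_derivative
      (\<lambda>u. frechet_derivative (\<lambda>y. ?Df y a) (at ?y) (u *\<^sub>R b))) (at t)" .
    moreover have "(\<lambda>u. frechet_derivative (\<lambda>y. ?Df y a) (at ?y) (u *\<^sub>R b)) =
        (*) (frechet_derivative (\<lambda>y. ?Df y a) (at ?y) b)"
      using linear_cmul[OF has_derivative_linear[OF D]] by (auto simp: mult.commute)
    ultimately show ?thesis by (simp add: has_field_derivative_def)
  qed
  have "\<exists>t. 0 < t \<and> t < h \<and> ?Df (x + s *\<^sub>R a + h *\<^sub>R b) a - ?Df (x + s *\<^sub>R a + 0 *\<^sub>R b) a =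
      (h - 0) * frechet_derivative (\<lambda>y. ?Df y a) (at (x + s *\<^sub>R a + t *\<^sub>R b)) b"
    using assms(3) by (intro MVT2 lin2) auto
  then obtain t where t: "0 < t" "t < h" "?Df (x + s *\<^sub>R a + h *\<^sub>R b) a - ?Df (x + s *\<^sub>R a + 0 *\<^sub>R b) a =
      h * frechet_derivative (\<lambda>y. ?Df y a) (at (x + s *\<^sub>R a + t *\<^sub>R b)) b"
    by auto
  have "f (x + h *\<^sub>R a + h *\<^sub>R b) - f (x + h *\<^sub>R a) - f (x + h *\<^sub>R b) + f x = q h - q 0"
    by (simp add: q_def)
  also have "\<dots> = h * h * frechet_derivative (\<lambda>y. ?Df y a) (at (x + s *\<^sub>R a + t *\<^sub>R b)) b"
    unfolding q t(3) by simp
  finally show ?thesis using s t(1,2) by blast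
qed

lemma frechet_derivative_commute_real:
  fixes f :: "'a::real_normed_vector \<Rightarrow> real"
  assumes "open S" "smooth_on S f" "x \<in> S"
  shows "frechet_derivative (\<lambda>y. frechet_derivative f (at y) a) (at x) b =
    frechet_derivative (\<lambda>y. frechet_derivative f (at y) b) (at x) a"
proof -
  define D where "D a b = (\<lambda>x. frechet_derivative (\<lambda>y. frechet_derivative f (at y) a) (at x) b)" for a b
  have cont: "isCont (D a b) x" for a b
  proof -
    have "continuous_on S (D a b)" unfolding D_def
      by (intro smooth_on_imp_continuous_on smooth_on_frechet_derivative assms(1,2))
    then show ?thesis using assms(1,3) by (simp add: continuous_on_eq_continuous_at)
  qed
  obtain r where r: "r > 0" "ball x r \<subseteq> S"
    using assms(1,3) open_contains_ball by blast
  \<comment> \<open>The added 1 keeps the denominator positive when both vectors vanish and makes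
    the estimate strict.\<close>
  have close: "\<exists>h0>0. \<forall>s t. \<bar>s\<bar> < h0 \<and> \<bar>t\<bar> < h0 \<longrightarrow> dist (x + s *\<^sub>R a + t *\<^sub>R b) x < d" if "d > 0" for d a b
  proof (intro exI[of _ "d / (norm a + norm b + 1)"] conjI allI impI)
    have p: "norm a + norm b + 1 > 0" by (simp add: add_nonneg_pos)
    then show "0 < d / (norm a + norm b + 1)" using that by simp
    fix s t
    assume st: "\<bar>s\<bar> < d / (norm a + norm b + 1) \<and> \<bar>t\<bar> < d / (norm a + norm b + 1)"
    let ?h = "d / (norm a + norm b + 1)"
    have "dist (x + s *\<^sub>R a + t *\<^sub>R b) x = norm (s *\<^sub>R a + t *\<^sub>R b)" by (simp add: dist_norm)
    also have "\<dots> \<le> \<bar>s\<bar> * norm a + \<bar>t\<bar> * norm b" using norm_triangle_ineq[of "s *\<^sub>R a" "t *\<^sub>R b"] by simp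
    also have "\<dots> \<le> ?h * norm a + ?h * norm b" using st by (intro add_mono mult_right_mono) auto
    also have "\<dots> < ?h * norm a + ?h * norm b + ?h" using that p by simp
    also have "\<dots> = ?h * (norm a + norm b + 1)" by (simp only: distrib_left mult_1_right)
    also have "\<dots> = d" using p by simp
    finally show "dist (x + s *\<^sub>R a + t *\<^sub>R b) x < d" .
  qed
  \<comment> \<open>Both orders of differentiation represent the same second difference at points
    near \<open>x\<close>, and each is \<open>e\<close>-close there to its value at
    \<open>x\<close>.\<close>
  have le: "\<bar>D a b x - D b a x\<bar> \<le> 2 * e" if "e > 0" for e
  proof -
    obtain d1 where d1: "d1 > 0" "\<And>y. dist y x < d1 \<Longrightarrow> dist (D a b y) (D a b x) < e"
      using cont[of a b] \<open>e > 0\<close> unfolding continuous_at_eps_delta by blast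
    obtain d2 where d2: "d2 > 0" "\<And>y. dist y x < d2 \<Longrightarrow> dist (D b a y) (D b a x) < e"
      using cont[of b a] \<open>e > 0\<close> unfolding continuous_at_eps_delta by blast
    define d where "d = min r (min d1 d2)"
    have "d > 0" using r d1 d2 by (simp add: d_def)
    obtain h1 where h1: "h1 > 0" "\<And>s t. \<bar>s\<bar> < h1 \<Longrightarrow> \<bar>t\<bar> < h1 \<Longrightarrow> dist (x + s *\<^sub>R a + t *\<^sub>R b) x < d"
      using close[OF \<open>d > 0\<close>] by meson
    define h where "h = h1 / 2"
    have h: "h > 0" "h < h1" using h1 by (auto simp: h_def)
    have inb: "dist (x + s *\<^sub>R a + t *\<^sub>R b) x < d" "dist (x + t *\<^sub>R b + s *\<^sub>R a) x < d"
      if "0 \<le> s" "s \<le> h" "0 \<le> t" "t \<le> h" for s t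
      using h1(2)[of s t] that h by (auto simp: add_ac)
    have inS: "x + s *\<^sub>R a + t *\<^sub>R b \<in> S" "x + t *\<^sub>R b + s *\<^sub>R a \<in> S"
      if "0 \<le> s" "s \<le> h" "0 \<le> t" "t \<le> h" for s t
      using inb[OF that] r(2) by (auto simp: d_def dist_commute subset_eq)
    obtain s t where st: "0 < s" "s < h" "0 < t" "t < h"
      "f (x + h *\<^sub>R a + h *\<^sub>R b) - f (x + h *\<^sub>R a) - f (x + h *\<^sub>R b) + f x = h * h * D a b (x + s *\<^sub>R a + t *\<^sub>R b)"
      using second_difference_mvt[OF assms(1,2) h(1) inS(1)] unfolding D_def by blast
    obtain s' t' where st': "0 < s'" "s' < h" "0 < t'" "t' < h"
      "f (x + h *\<^sub>R b + h *\<^sub>R a) - f (x + h *\<^sub>R b) - f (x + h *\<^sub>R a) + f x = h * h * D b a (x + s' *\<^sub>R b + t' *\<^sub>R a)"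
      using second_difference_mvt[OF assms(1,2) h(1) inS(2)] unfolding D_def by blast
    have "h * h * D a b (x + s *\<^sub>R a + t *\<^sub>R b) = h * h * D b a (x + s' *\<^sub>R b + t' *\<^sub>R a)"
    proof -
      have "x + h *\<^sub>R b + h *\<^sub>R a = x + h *\<^sub>R a + h *\<^sub>R b" by (simp only: add_ac)
      then have "f (x + h *\<^sub>R b + h *\<^sub>R a) = f (x + h *\<^sub>R a + h *\<^sub>R b)" by (rule arg_cong)
      then show ?thesis using st(5) st'(5) by linarith
    qed
    then have "D a b (x + s *\<^sub>R a + t *\<^sub>R b) = D b a (x + s' *\<^sub>R b + t' *\<^sub>R a)" using h by simp
    moreover have "dist (D a b (x + s *\<^sub>R a + t *\<^sub>R b)) (D a b x) < e"
      using d1(2) inb(1)[of s t] st by (auto simp: d_def)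
    moreover have "dist (D b a (x + s' *\<^sub>R b + t' *\<^sub>R a)) (D b a x) < e"
      using d2(2) inb(2)[of t' s'] st' by (auto simp: d_def)
    ultimately show ?thesis by (simp add: dist_real_def)
  qed
  have "\<bar>D a b x - D b a x\<bar> \<le> 0"
  proof (rule field_le_epsilon)
    fix e :: real
    assume "e > 0"
    then show "\<bar>D a b x - D b a x\<bar> \<le> 0 + e" using le[of "e / 2"] by simp
  qed
  then show ?thesis by (simp add: D_def)
qed

lemma frechet_derivative_bounded_linear:
  assumes "bounded_linear L" "f differentiable (at x)"
  shows "frechet_derivative (\<lambda>y. L (f y)) (at x) a = L (frechet_derivative f (at x) a)"
proof -
  have "((\<lambda>y. L (f y)) has_derivative (\<lambda>v. L (frechet_derivative f (at x) v))) (at x)"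
    using assms by (intro bounded_linear.has_derivative[OF assms(1)]) (simp add: frechet_derivative_works)
  then show ?thesis by (metis frechet_derivative_at)
qed

lemma frechet_derivative_cong_open:
  assumes "open S" "x \<in> S" "\<And>y. y \<in> S \<Longrightarrow> f y = g y"
  shows "frechet_derivative f (at x) = frechet_derivative g (at x)"
proof -
  have "(f has_derivative D) (at x) \<longleftrightarrow> (g has_derivative D) (at x)" for D
    using assms has_derivative_transform_within_open by metis
  then show ?thesis unfolding frechet_derivative_def by simp
qed

text \<open>The mean value theorem is a statement about real functions, so real and imaginary parts
  are treated separately.\<close>

lemma frechet_derivative_commute:
  fixes f :: "'a::real_normed_vector \<Rightarrow> complex"
  assumes "open S" "smooth_on S f" "x \<in> S"
  shows "frechet_derivative (\<lambda>y. frechet_derivative f (at y) a) (at x) b =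
    frechet_derivative (\<lambda>y. frechet_derivative f (at y) b) (at x) a"
proof -
  have *: "L (frechet_derivative (\<lambda>y. frechet_derivative f (at y) a) (at x) b) =
    frechet_derivative (\<lambda>y. frechet_derivative (\<lambda>y. L (f y)) (at y) a) (at x) b"
    if L: "bounded_linear L" for a b and L :: "complex \<Rightarrow> real"
  proof -
    have "frechet_derivative (\<lambda>y. frechet_derivative (\<lambda>y. L (f y)) (at y) a) (at x) =
       frechet_derivative (\<lambda>y. L (frechet_derivative f (at y) a)) (at x)"
      by (rule frechet_derivative_cong_open[OF assms(1,3)])
        (simp add: frechet_derivative_bounded_linear[OF L] smooth_on_differentiable[OF assms(1,2)])
    then show ?thesis
      using frechet_derivative_bounded_linear[OF L smooth_on_differentiable[OF assms(1)
            smooth_on_frechet_derivative[OF assms(1,2)] assms(3)]] by metis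
  qed
  show ?thesis
  proof (rule complex_eqI)
    show "Re (frechet_derivative (\<lambda>y. frechet_derivative f (at y) a) (at x) b) =
      Re (frechet_derivative (\<lambda>y. frechet_derivative f (at y) b) (at x) a)"
      unfolding *[OF bounded_linear_Re]
      by (intro frechet_derivative_commute_real[OF assms(1) _ assms(3)]
          smooth_on_compose_linear[OF bounded_linear_Re assms(2)])
    show "Im (frechet_derivative (\<lambda>y. frechet_derivative f (at y) a) (at x) b) =
      Im (frechet_derivative (\<lambda>y. frechet_derivative f (at y) b) (at x) a)"
      unfolding *[OF bounded_linear_Im]
      by (intro frechet_derivative_commute_real[OF assms(1) _ assms(3)]
          smooth_on_compose_linear[OF bounded_linear_Im assms(2)])
  qed
qed

section \<open>Complex directional derivatives\<close>

text \<open>The derivative in the direction \<open>a + \<i> b\<close> of the complexified tangent space, for \<open>e = (a, b)\<close>.\<close>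

definition cderiv :: "'a::real_normed_vector \<times> 'a \<Rightarrow> ('a \<Rightarrow> complex) \<Rightarrow> 'a \<Rightarrow> complex" where
  "cderiv e f x = frechet_derivative f (at x) (fst e) + \<i> * frechet_derivative f (at x) (snd e)"

lemma cderiv_cong:
  assumes "open S" "x \<in> S" "\<And>y. y \<in> S \<Longrightarrow> f y = g y"
  shows "cderiv e f x = cderiv e g x"
  by (simp add: cderiv_def frechet_derivative_cong_open[OF assms])

lemma smooth_on_cderiv:
  assumes "open S" "smooth_on S f"
  shows "smooth_on S (cderiv e f)"
  unfolding cderiv_def[abs_def]
  by (intro smooth_on_add smooth_on_mult smooth_on_const smooth_on_frechet_derivative assms)

lemma cderiv_eqI:
  assumes "(f has_derivative D) (at x)"
  shows "cderiv e f x = D (fst e) + \<i> * D (snd e)"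
  unfolding cderiv_def frechet_derivative_at[OF assms, symmetric] ..

lemma cderiv_const [simp]: "cderiv e (\<lambda>x. c) x = 0"
  by (subst cderiv_eqI[OF has_derivative_const]) simp

lemma cderiv_add:
  assumes "f differentiable (at x)" "g differentiable (at x)"
  shows "cderiv e (\<lambda>y. f y + g y) x = cderiv e f x + cderiv e g x"
  unfolding cderiv_eqI[OF has_derivative_add[OF assms[unfolded frechet_derivative_works]]]
  by (simp add: cderiv_def algebra_simps)

lemma cderiv_diff:
  assumes "f differentiable (at x)" "g differentiable (at x)"
  shows "cderiv e (\<lambda>y. f y - g y) x = cderiv e f x - cderiv e g x"
  unfolding cderiv_eqI[OF has_derivative_diff[OF assms[unfolded frechet_derivative_works]]]
  by (simp add: cderiv_def algebra_simps)

lemma cderiv_minus: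
  assumes "f differentiable (at x)"
  shows "cderiv e (\<lambda>y. - f y) x = - cderiv e f x"
  unfolding cderiv_eqI[OF has_derivative_minus[OF assms[unfolded frechet_derivative_works]]]
  by (simp add: cderiv_def algebra_simps)

lemma cderiv_mult:
  assumes "f differentiable (at x)" "g differentiable (at x)"
  shows "cderiv e (\<lambda>y. f y * g y) x = cderiv e f x * g x + f x * cderiv e g x"
  unfolding cderiv_eqI[OF has_derivative_mult[OF assms[unfolded frechet_derivative_works]]]
  by (simp add: cderiv_def algebra_simps)

lemma cderiv_cmult:
  assumes "f differentiable (at x)"
  shows "cderiv e (\<lambda>y. c * f y) x = c * cderiv e f x"
  using cderiv_mult[OF differentiable_const assms] by simp

lemma cderiv_sum:
  assumes "\<And>i. i \<in> I \<Longrightarrow> f i differentiable (at x)"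
  shows "cderiv e (\<lambda>y. \<Sum>i\<in>I. f i y) x = (\<Sum>i\<in>I. cderiv e (f i) x)"
proof -
  have "((\<lambda>y. \<Sum>i\<in>I. f i y) has_derivative (\<lambda>h. \<Sum>i\<in>I. frechet_derivative (f i) (at x) h)) (at x)"
    using assms by (intro has_derivative_sum) (simp add: frechet_derivative_works)
  from cderiv_eqI[OF this] show ?thesis
    by (simp add: cderiv_def sum.distrib sum_distrib_left)
qed

lemma cderiv_linear:
  assumes "bounded_linear L"
  shows "cderiv e L x = L (fst e) + \<i> * L (snd e)"
  by (rule cderiv_eqI) (rule bounded_linear_imp_has_derivative[OF assms])

text \<open>Conjugating the function conjugates the complex direction \<open>a + \<i> b\<close>;
  this exchanges directions of type (1,0) and (0,1).\<close>

lemma cderiv_cnj: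
  assumes "f differentiable (at x)"
  shows "cderiv e (\<lambda>y. cnj (f y)) x = cnj (cderiv (fst e, - snd e) f x)"
  using linear_neg[OF linear_frechet_derivative[OF assms]]
  by (simp add: cderiv_def frechet_derivative_bounded_linear[OF bounded_linear_cnj assms])

lemma cderiv_commute:
  assumes "open S" "smooth_on S f" "x \<in> S"
  shows "cderiv d (cderiv e f) x = cderiv e (cderiv d f) x"
proof -
  let ?D = "\<lambda>a y. frechet_derivative f (at y) a"
  have D: "?D a differentiable (at x)" for a
    by (rule smooth_on_differentiable[OF assms(1) smooth_on_frechet_derivative[OF assms(1,2)] assms(3)])
  have *: "cderiv d (cderiv e f) x = cderiv d (?D (fst e)) x + \<i> * cderiv d (?D (snd e)) x" for d e
    unfolding cderiv_def[of e f, abs_def]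
    using D by (simp add: cderiv_add cderiv_cmult)
  show ?thesis
    unfolding * unfolding cderiv_def
    using frechet_derivative_commute[OF assms] by (simp add: algebra_simps)
qed


section \<open>Matrix-valued functions\<close>

lemma matrix_diff_ldistrib: "A ** (B - C) = A ** B - A ** (C :: complex^'n^'n)"
  and matrix_diff_rdistrib: "(B - C) ** A = B ** A - C ** (A :: complex^'n^'n)"
  and matrix_minus_left: "(- B) ** A = - (B ** (A :: complex^'n^'n))"
  and matrix_minus_right: "B ** (- A) = - (B ** (A :: complex^'n^'n))"
  by (simp_all add: matrix_matrix_mult_def vec_eq_iff algebra_simps sum_subtractf sum_negf)

lemma trace_minus: "trace (- A) = - trace (A :: complex^'n^'n)"
  by (simp add: trace_def sum_negf)

definition msmooth_on :: "'a::real_normed_vector set \<Rightarrow> ('a \<Rightarrow> complex^'n^'m) \<Rightarrow> bool" where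
  "msmooth_on S F \<longleftrightarrow> (\<forall>i j. smooth_on S (\<lambda>x. F x $ i $ j))"

definition mderiv :: "'a::real_normed_vector \<times> 'a \<Rightarrow> ('a \<Rightarrow> complex^'n^'m) \<Rightarrow> 'a \<Rightarrow> complex^'n^'m" where
  "mderiv e F x = (\<chi> i j. cderiv e (\<lambda>y. F y $ i $ j) x)"

lemma mderiv_cong:
  assumes "open S" "x \<in> S" "\<And>y. y \<in> S \<Longrightarrow> F y = G y"
  shows "mderiv e F x = mderiv e G x"
  unfolding mderiv_def vec_eq_iff using assms by (auto intro!: cderiv_cong[OF assms(1,2)])

lemma mderiv_const [simp]: "mderiv e (\<lambda>x. C) x = 0"
  by (simp add: mderiv_def vec_eq_iff)

context
  fixes S :: "'a::real_normed_vector set"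
  assumes S: "open S"
begin

lemma msmooth_on_mderiv: "msmooth_on S F \<Longrightarrow> msmooth_on S (mderiv e F)"
  using smooth_on_cderiv[OF S] unfolding msmooth_on_def mderiv_def by simp

lemma msmooth_on_mult: "msmooth_on S F \<Longrightarrow> msmooth_on S G \<Longrightarrow> msmooth_on S (\<lambda>x. F x ** G x)"
  unfolding msmooth_on_def matrix_matrix_mult_def by (simp add: smooth_on_sum smooth_on_mult)

lemma msmooth_on_add: "msmooth_on S F \<Longrightarrow> msmooth_on S G \<Longrightarrow> msmooth_on S (\<lambda>x. F x + G x)"
  unfolding msmooth_on_def by (simp add: smooth_on_add)

lemma msmooth_on_diff: "msmooth_on S F \<Longrightarrow> msmooth_on S G \<Longrightarrow> msmooth_on S (\<lambda>x. F x - G x)"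
  unfolding msmooth_on_def by (simp add: smooth_on_diff)

lemma msmooth_on_minus: "msmooth_on S F \<Longrightarrow> msmooth_on S (\<lambda>x. - F x)"
  unfolding msmooth_on_def by (simp add: smooth_on_minus)

lemma smooth_on_trace: "msmooth_on S F \<Longrightarrow> smooth_on S (\<lambda>x. trace (F x))"
  unfolding msmooth_on_def trace_def by (simp add: smooth_on_sum)

lemma smooth_on_nth: "msmooth_on S F \<Longrightarrow> smooth_on S (\<lambda>x. F x $ i $ j)"
  by (simp add: msmooth_on_def)

lemma msmooth_on_differentiable: "msmooth_on S F \<Longrightarrow> x \<in> S \<Longrightarrow> (\<lambda>x. F x $ i $ j) differentiable (at x)"
  unfolding msmooth_on_def using smooth_on_differentiable[OF S] by blast

lemma mderiv_mult:
  assumes "msmooth_on S F" "msmooth_on S G" "x \<in> S"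
  shows "mderiv e (\<lambda>x. F x ** G x) x = mderiv e F x ** G x + F x ** mderiv e G x"
  using assms
  by (simp add: mderiv_def matrix_matrix_mult_def vec_eq_iff cderiv_sum cderiv_mult
      msmooth_on_differentiable sum.distrib)

lemma mderiv_add:
  assumes "msmooth_on S F" "msmooth_on S G" "x \<in> S"
  shows "mderiv e (\<lambda>x. F x + G x) x = mderiv e F x + mderiv e G x"
  using assms by (simp add: mderiv_def vec_eq_iff cderiv_add msmooth_on_differentiable)

lemma mderiv_diff:
  assumes "msmooth_on S F" "msmooth_on S G" "x \<in> S"
  shows "mderiv e (\<lambda>x. F x - G x) x = mderiv e F x - mderiv e G x"
  using assms by (simp add: mderiv_def vec_eq_iff cderiv_diff msmooth_on_differentiable)

lemma mderiv_minus:
  assumes "msmooth_on S F" "x \<in> S"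
  shows "mderiv e (\<lambda>x. - F x) x = - mderiv e F x"
  using assms by (simp add: mderiv_def vec_eq_iff cderiv_minus msmooth_on_differentiable)

lemma cderiv_trace:
  assumes "msmooth_on S F" "x \<in> S"
  shows "cderiv e (\<lambda>x. trace (F x)) x = trace (mderiv e F x)"
  using assms by (simp add: mderiv_def trace_def cderiv_sum msmooth_on_differentiable)

lemma mderiv_commute:
  assumes "msmooth_on S F" "x \<in> S"
  shows "mderiv d (mderiv e F) x = mderiv e (mderiv d F) x"
  using assms cderiv_commute[OF S _ assms(2)]
  by (simp add: mderiv_def vec_eq_iff msmooth_on_def cong: if_cong)

text \<open>Differentiate \<open>G M = 1\<close> and multiply by \<open>M\<close> from the
  left.\<close>

lemma mderiv_inverse:
  fixes G M :: "'a \<Rightarrow> complex^'n^'n"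
  assumes G: "msmooth_on S G" and M: "msmooth_on S M" and x: "x \<in> S"
    and GM: "\<And>x. x \<in> S \<Longrightarrow> G x ** M x = mat 1" "\<And>x. x \<in> S \<Longrightarrow> M x ** G x = mat 1"
  shows "mderiv e M x = - (M x ** mderiv e G x ** M x)"
proof -
  have "mderiv e (\<lambda>x. G x ** M x) x = mderiv e (\<lambda>x. mat 1) x"
    by (rule mderiv_cong[OF S x GM(1)])
  then have "mderiv e G x ** M x + G x ** mderiv e M x = 0"
    by (simp add: mderiv_mult[OF G M x])
  then have "G x ** mderiv e M x = - (mderiv e G x ** M x)"
    by (simp add: eq_neg_iff_add_eq_0 add.commute)
  then have "M x ** (G x ** mderiv e M x) = - (M x ** (mderiv e G x ** M x))"
    by (simp add: matrix_minus_right)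
  then show ?thesis
    by (simp add: matrix_mul_assoc GM(2)[OF x])
qed

end


section \<open>Wirtinger derivatives on space-time\<close>

text \<open>The (1,0)-vector \<open>(w - \<i> J w) / 2\<close> with \<open>J w = \<i> w\<close>,
  that is, the sum of \<open>w\<^sub>k \<partial>/\<partial>z\<^sub>k\<close>; \<open>ant w\<close>
  is its conjugate and \<open>tim\<close> the time direction. Treating space and time together lets
  one commutation lemma serve all mixed derivatives.\<close>

definition hol :: "complex^'n::finite \<Rightarrow> ((complex^'n) \<times> real) \<times> ((complex^'n) \<times> real)" where
  "hol w = (((1/2) *\<^sub>R w, 0), (- (1/2) *\<^sub>R (\<i> *s w), 0))"

definition ant :: "complex^'n::finite \<Rightarrow> ((complex^'n) \<times> real) \<times> ((complex^'n) \<times> real)" where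
  "ant w = (((1/2) *\<^sub>R w, 0), ((1/2) *\<^sub>R (\<i> *s w), 0))"

definition tim :: "((complex^'n::finite) \<times> real) \<times> ((complex^'n) \<times> real)" where
  "tim = ((0, 1), 0)"

lemma axis_ii: "axis k \<i> = \<i> *s axis k (1::complex)"
  by (simp add: axis_def vec_eq_iff)

lemma linear_expand:
  fixes L :: "(complex^'n::finite) \<times> real \<Rightarrow> complex"
  assumes "linear L"
  shows "L (w, 0) = (\<Sum>k\<in>UNIV. of_real (Re (w $ k)) * L (axis k 1, 0) + of_real (Im (w $ k)) * L (\<i> *s axis k 1, 0))"
proof -
  have "(w, 0) = (\<Sum>k\<in>UNIV. Re (w $ k) *\<^sub>R (axis k 1, 0) + Im (w $ k) *\<^sub>R (\<i> *s axis k (1::complex), 0::real))"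
  proof (rule prod_eqI)
    have "w $ i = (\<Sum>k\<in>UNIV. Re (w $ k) *\<^sub>R axis k 1 $ i + Im (w $ k) *\<^sub>R (\<i> * axis k 1 $ i))" for i
    proof -
      have "(\<Sum>k\<in>UNIV. Re (w $ k) *\<^sub>R axis k 1 $ i + Im (w $ k) *\<^sub>R (\<i> * axis k 1 $ i)) =
        (\<Sum>k\<in>UNIV. if k = i then w $ i else 0)"
        by (intro sum.cong refl) (auto simp: axis_def complex_eq_iff)
      also have "\<dots> = w $ i" by simp
      finally show ?thesis by (rule sym)
    qed
    note * = this
    show "fst (w, 0::real) = fst (\<Sum>k\<in>UNIV. Re (w $ k) *\<^sub>R (axis k 1, 0) + Im (w $ k) *\<^sub>R (\<i> *s axis k (1::complex), 0::real))"
      unfolding vec_eq_iff fst_sum fst_conv fst_add fst_scaleR sum_component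
        vector_add_component vector_scaleR_component vector_smult_component
      using * by blast
  qed (simp add: snd_sum)
  then have "L (w, 0) = L (\<Sum>k\<in>UNIV. Re (w $ k) *\<^sub>R (axis k 1, 0) + Im (w $ k) *\<^sub>R (\<i> *s axis k (1::complex), 0::real))"
    by (rule arg_cong)
  then show ?thesis
    by (simp only: linear_sum[OF assms] linear_add[OF assms] linear_cmul[OF assms] scaleR_conv_of_real)
qed

lemma cderiv_hol_eq:
  fixes f :: "(complex^'n::finite) \<times> real \<Rightarrow> complex"
  assumes "f differentiable (at x)"
  shows "cderiv (hol w) f x = (frechet_derivative f (at x) (w, 0) - \<i> * frechet_derivative f (at x) (\<i> *s w, 0)) / 2"
    and "cderiv (ant w) f x = (frechet_derivative f (at x) (w, 0) + \<i> * frechet_derivative f (at x) (\<i> *s w, 0)) / 2"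
proof -
  have l: "frechet_derivative f (at x) (c *\<^sub>R w, 0) = c *\<^sub>R frechet_derivative f (at x) (w, 0)" for c w
    using linear_cmul[OF linear_frechet_derivative[OF assms], of c "(w, 0)"] by simp
  show "cderiv (hol w) f x = (frechet_derivative f (at x) (w, 0) - \<i> * frechet_derivative f (at x) (\<i> *s w, 0)) / 2"
    by (simp only: cderiv_def hol_def fst_conv snd_conv l) (simp add: scaleR_conv_of_real field_simps)
  show "cderiv (ant w) f x = (frechet_derivative f (at x) (w, 0) + \<i> * frechet_derivative f (at x) (\<i> *s w, 0)) / 2"
    by (simp only: cderiv_def ant_def fst_conv snd_conv l) (simp add: scaleR_conv_of_real field_simps)
qed

text \<open>The Wirtinger combination turns a real linear derivative into one that is complex linear
  in \<open>w\<close> for \<open>hol\<close> and conjugate linear for \<open>ant\<close>.\<close>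

lemma cderiv_hol_expand:
  fixes f :: "(complex^'n::finite) \<times> real \<Rightarrow> complex"
  assumes "f differentiable (at x)"
  shows "cderiv (hol w) f x = (\<Sum>k\<in>UNIV. w $ k * cderiv (hol (axis k 1)) f x)"
    and "cderiv (ant w) f x = (\<Sum>k\<in>UNIV. cnj (w $ k) * cderiv (ant (axis k 1)) f x)"
proof -
  note l = linear_expand[OF linear_frechet_derivative[OF assms]]
  show "cderiv (hol w) f x = (\<Sum>k\<in>UNIV. w $ k * cderiv (hol (axis k 1)) f x)"
    unfolding cderiv_hol_eq[OF assms] l[of w] l[of "\<i> *s w"]
    unfolding sum_distrib_left sum_subtractf[symmetric] sum_divide_distrib
    by (intro sum.cong refl) (simp add: complex_eq_iff field_simps)
  show "cderiv (ant w) f x = (\<Sum>k\<in>UNIV. cnj (w $ k) * cderiv (ant (axis k 1)) f x)"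
    unfolding cderiv_hol_eq[OF assms] l[of w] l[of "\<i> *s w"]
    unfolding sum_distrib_left sum.distrib[symmetric] sum_divide_distrib
    by (intro sum.cong refl) (simp add: complex_eq_iff field_simps)
qed

lemma frechet_derivative_slice:
  fixes f :: "'a::real_normed_vector \<times> real \<Rightarrow> 'b::real_normed_vector"
  assumes "f differentiable (at (z, t))"
  shows "frechet_derivative (\<lambda>y. f (y, t)) (at z) u = frechet_derivative f (at (z, t)) (u, 0)"
proof -
  have D: "(f has_derivative frechet_derivative f (at (z, t))) (at (z, t))"
    using assms frechet_derivative_works by blast
  have "((\<lambda>y. (y, t)) has_derivative (\<lambda>u. (u, 0))) (at z)"
    by (auto intro!: derivative_eq_intros)
  from has_derivative_compose[OF this D] show ?thesis
    by (metis frechet_derivative_at)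
qed

text \<open>The link between the operators of the curvature formula, which act at a fixed time, and
  the calculus on space-time.\<close>

lemma dz_slice:
  fixes f :: "(complex^'n::finite) \<times> real \<Rightarrow> complex"
  assumes "f differentiable (at (z, t))"
  shows "dz k (\<lambda>y. f (y, t)) z = cderiv (hol (axis k 1)) f (z, t)"
    and "dzbar k (\<lambda>y. f (y, t)) z = cderiv (ant (axis k 1)) f (z, t)"
  by (simp_all add: dz_def dzbar_def cderiv_hol_eq[OF assms] frechet_derivative_slice[OF assms] axis_ii)

lemma has_vector_derivative_tim:
  fixes f :: "(complex^'n::finite) \<times> real \<Rightarrow> complex"
  assumes "f differentiable (at (z, t))"
  shows "((\<lambda>s. f (z, s)) has_vector_derivative cderiv tim f (z, t)) (at t)"
proof -
  have D: "(f has_derivative frechet_derivative f (at (z, t))) (at (z, t))"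
    using assms frechet_derivative_works by blast
  have "((\<lambda>s. (z, s)) has_derivative (\<lambda>u. (0, u))) (at t)"
    by (auto intro!: derivative_eq_intros)
  from has_derivative_compose[OF this D]
  have "((\<lambda>s. f (z, s)) has_derivative (\<lambda>u. frechet_derivative f (at (z, t)) (0, u))) (at t)" .
  moreover have "frechet_derivative f (at (z, t)) (0, u) = u *\<^sub>R cderiv tim f (z, t)" for u
    using linear_cmul[OF linear_frechet_derivative[OF assms], of u "(0, 1)"]
      linear_0[OF linear_frechet_derivative[OF assms]]
    by (simp add: tim_def cderiv_def)
  ultimately show ?thesis
    by (simp add: has_vector_derivative_def)
qed

section \<open>Hermitian forms\<close>

definition hermitian :: "complex^'n^'n \<Rightarrow> bool" where
  "hermitian H \<longleftrightarrow> (\<forall>i j. H $ j $ i = cnj (H $ i $ j))"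

text \<open>Since \<open>hform\<close> is conjugate linear in its second argument, \<open>v\<close>
  is a null vector when \<open>H *v cnjv v\<close> vanishes.\<close>

definition cnjv :: "complex^'n \<Rightarrow> complex^'n" where
  "cnjv v = (\<chi> i. cnj (v $ i))"

definition ctrans :: "complex^'n^'n \<Rightarrow> complex^'n^'n" where
  "ctrans H = (\<chi> i j. cnj (H $ j $ i))"

lemma hermitian_iff: "hermitian H \<longleftrightarrow> ctrans H = H"
  unfolding hermitian_def ctrans_def vec_eq_iff vec_lambda_beta by metis

lemma ctrans_mult: "ctrans (A ** B) = ctrans B ** ctrans A"
  by (simp add: ctrans_def matrix_matrix_mult_def vec_eq_iff mult.commute)

text \<open>\<open>ctrans M\<close> is a left inverse of \<open>G\<close>, hence equal to
  \<open>M\<close>.\<close>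

lemma hermitian_inverse:
  assumes "hermitian G" "G ** M = mat 1" "M ** G = mat 1"
  shows "hermitian M"
proof -
  have "ctrans M ** G = ctrans (G ** M)"
    using assms(1) by (simp add: ctrans_mult hermitian_iff)
  also have "\<dots> = mat 1" by (simp add: assms(2)) (auto simp: ctrans_def mat_def vec_eq_iff)
  finally have "ctrans M ** G ** M = M" by simp
  then show ?thesis by (simp add: hermitian_iff matrix_mul_assoc[symmetric] assms(2))
qed

lemma hermitian_cnj: "hermitian H \<Longrightarrow> cnj (H $ i $ j) = H $ j $ i"
  unfolding hermitian_def by metis

lemma hermitian_diag: "hermitian H \<Longrightarrow> H $ i $ i = of_real (Re (H $ i $ i))"
  by (metis hermitian_cnj Reals_cnj_iff of_real_Re)

lemma hform_scale: "hform H (a *s u) v = a * hform H u v" "hform H u (a *s v) = cnj a * hform H u v"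
  by (simp_all add: hform_def sum_distrib_left mult_ac)

lemma hform_diff_left: "hform H (u - w) v = hform H u v - hform H w v"
  by (simp add: hform_def sum_subtractf algebra_simps)

lemma hform_diff_right: "hform H u (v - w) = hform H u v - hform H u w"
  by (simp add: hform_def sum_subtractf algebra_simps)

lemma hform_diff_matrix: "hform (H - K) u v = hform H u v - hform K u v"
  by (simp add: hform_def sum_subtractf algebra_simps)

lemma hform_smult_matrix: "hform (r *\<^sub>R H) u v = r *\<^sub>R hform H u v"
  by (simp add: hform_def scaleR_sum_right)

lemma hform_mult_vec: "hform H u v = (\<Sum>i\<in>UNIV. u $ i * (H *v cnjv v) $ i)"
  by (simp add: hform_def matrix_vector_mult_def cnjv_def sum_distrib_left mult_ac)

lemma hform_commute:
  assumes "hermitian H"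
  shows "hform H v u = cnj (hform H u v)"
  unfolding hform_def
  by (subst sum.swap) (simp add: mult_ac hermitian_cnj[OF assms])

lemma sum_axis:
  fixes f :: "'n::finite \<Rightarrow> complex"
  shows "(\<Sum>i\<in>UNIV. f i * axis k 1 $ i) = f k" "(\<Sum>i\<in>UNIV. axis k 1 $ i * f i) = f k"
proof -
  have "(\<Sum>i\<in>UNIV. f i * axis k 1 $ i) = (\<Sum>i\<in>UNIV. if i = k then f k else 0)"
    by (intro sum.cong refl) (simp add: axis_def)
  then show "(\<Sum>i\<in>UNIV. f i * axis k 1 $ i) = f k" by simp
  then show "(\<Sum>i\<in>UNIV. axis k 1 $ i * f i) = f k" by (simp add: mult.commute)
qed

lemma cnj_axis: "cnj (axis k 1 $ i) = axis k 1 $ i"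
  by (simp add: axis_def)

lemma hform_axis: "hform H u (axis k 1) = (\<Sum>i\<in>UNIV. H $ i $ k * u $ i)"
  unfolding hform_def cnj_axis sum_axis ..

lemma hform_axis_axis: "hform H (axis j 1) (axis k 1) = H $ j $ k"
  unfolding hform_axis sum_axis ..

lemma hform_perturb:
  assumes "hermitian H"
  shows "Re (hform H (x - b *s y) (x - b *s y)) =
    Re (hform H x x) - 2 * Re (cnj b * hform H x y) + (cmod b)\<^sup>2 * Re (hform H y y)"
proof -
  have "Im (hform H y y) = 0"
    using hform_commute[OF assms, of y y] by (simp add: complex_eq_iff)
  moreover have "hform H y x = cnj (hform H x y)" by (rule hform_commute[OF assms])
  ultimately show ?thesis
    unfolding hform_diff_left hform_diff_right hform_scale
    unfolding cmod_power2 by (simp add: algebra_simps power2_eq_square)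
qed

text \<open>The degenerate case of Cauchy-Schwarz: with \<open>s\<close> the mixed term, the form at
  \<open>x - r s y\<close> is affine in the real number \<open>r\<close>, because it vanishes at
  \<open>y\<close>, and its slope is negative unless \<open>s = 0\<close>.\<close>

lemma hform_null:
  assumes "hermitian H" and pos: "\<And>x. Re (hform H x x) \<ge> 0" and "Re (hform H y y) = 0"
  shows "hform H x y = 0"
proof (rule ccontr)
  define s where "s = hform H x y"
  define q where "q = Re (hform H x x)"
  assume "hform H x y \<noteq> 0"
  then have s: "(cmod s)\<^sup>2 > 0" by (simp add: s_def)
  \<comment> \<open>Chosen so that the value of the form is
    \<open>q - (q + 1) = - 1\<close>.\<close>
  define r where "r = (q + 1) / (2 * (cmod s)\<^sup>2)"
  have "0 \<le> q - 2 * Re (cnj (of_real r * s) * s)"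
    using pos[of "x - (of_real r * s) *s y"] unfolding hform_perturb[OF assms(1)] assms(3)
    by (simp add: q_def s_def)
  also have "Re (cnj (of_real r * s) * s) = r * (cmod s)\<^sup>2"
    unfolding cmod_power2 by (simp add: algebra_simps power2_eq_square)
  also have "q - 2 * (r * (cmod s)\<^sup>2) = - 1"
  proof -
    have "r * (cmod s)\<^sup>2 = (q + 1) / 2" using s unfolding r_def by simp
    then show ?thesis by (simp add: field_simps)
  qed
  finally show False by simp
qed

lemma hform_null_vec:
  assumes "hermitian H" "\<And>x. Re (hform H x x) \<ge> 0" "Re (hform H y y) = 0"
  shows "H *v cnjv y = 0"
proof -
  have "(H *v cnjv y) $ i = hform H (axis i 1) y" for i
    unfolding hform_mult_vec sum_axis ..
  then show ?thesis using hform_null[OF assms] by (simp add: vec_eq_iff)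
qed

lemma hform_matrix_mult_left: "hform (A ** B) u v = hform B (u v* A) v"
proof -
  have "hform (A ** B) u v = (\<Sum>i\<in>UNIV. \<Sum>j\<in>UNIV. \<Sum>k\<in>UNIV. A $ i $ k * B $ k $ j * u $ i * cnj (v $ j))"
    by (simp add: hform_def matrix_matrix_mult_def sum_distrib_right)
  also have "\<dots> = (\<Sum>k\<in>UNIV. \<Sum>j\<in>UNIV. \<Sum>i\<in>UNIV. A $ i $ k * B $ k $ j * u $ i * cnj (v $ j))"
    by (subst sum.swap, subst (2) sum.swap, subst sum.swap) simp
  also have "\<dots> = hform B (u v* A) v"
    by (simp add: hform_def vector_matrix_mult_def sum_distrib_left sum_distrib_right mult_ac)
  finally show ?thesis .
qed

lemma hform_matrix_mult_right:
  assumes "hermitian B"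
  shows "hform (A ** B) u v = hform A u (v v* B)"
proof -
  have "cnjv (v v* B) = B *v cnjv v"
    by (simp add: vec_eq_iff cnjv_def vector_matrix_mult_def matrix_vector_mult_def mult.commute
        hermitian_cnj[OF assms])
  then show ?thesis by (simp add: hform_mult_vec matrix_vector_mul_assoc)
qed

text \<open>For the inverse metric \<open>M\<close>, the matrix \<open>M ** S ** M\<close> is
  \<open>S\<close> with both indices raised. Its values are values of \<open>S\<close>, so
  semidefiniteness carries over.\<close>

lemma hform_congruence:
  assumes "hermitian M"
  shows "hform (M ** S ** M) x x = hform S (x v* M) (x v* M)"
  by (rule trans[OF hform_matrix_mult_right[OF assms] hform_matrix_mult_left])

lemma hermitian_congruence: "hermitian M \<Longrightarrow> hermitian S \<Longrightarrow> hermitian (M ** S ** M)"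
  by (simp add: hermitian_iff ctrans_mult matrix_mul_assoc)

text \<open>A nonzero kernel vector \<open>w\<close> would make \<open>cnjv w\<close> a nonzero null
  vector of the form.\<close>

lemma hform_pos_invertible:
  assumes "\<And>u. u \<noteq> 0 \<Longrightarrow> Re (hform G u u) > 0"
  shows "invertible G"
proof -
  have "w = 0" if "G *v w = 0" for w
  proof -
    have "cnjv (cnjv w) = w" by (simp add: cnjv_def vec_eq_iff)
    then have "hform G (cnjv w) (cnjv w) = 0" using that by (simp add: hform_mult_vec)
    then have "cnjv w = 0" using assms[of "cnjv w"] by fastforce
    then show "w = 0" by (simp add: cnjv_def vec_eq_iff)
  qed
  then have "\<exists>B. B ** G = mat 1" using matrix_left_invertible_ker by blast
  then show ?thesis unfolding invertible_def by (metis matrix_left_right_inverse)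
qed

text \<open>A positive semidefinite \<open>T\<close> is a sum of matrices \<open>cnj(w\<^sub>q) w\<^sub>p\<close> of rank one (clear one row
  and column after the other, as in the Cholesky decomposition), where every \<open>w\<close> is orthogonal
  to the kernel of \<open>T\<close>.\<close>

lemma trace_mult_nonneg:
  fixes C T :: "complex^'n::finite^'n"
  assumes "hermitian T" and "\<And>x. Re (hform T x x) \<ge> 0" and "T *v y = 0"
    and C: "\<And>w. (\<Sum>p\<in>UNIV. w $ p * y $ p) = 0 \<Longrightarrow> Re (hform C w w) \<ge> 0"
  shows "Re (trace (C ** T)) \<ge> 0"
proof -
  \<comment> \<open>Generalized for the induction: \<open>I\<close> contains the indices of the rows
    that are not yet cleared.\<close>
  have "Re (trace (C ** T)) \<ge> 0" if "finite I" "hermitian T" "\<And>x. Re (hform T x x) \<ge> 0" "T *v y = 0"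
    "\<And>q p. q \<notin> I \<Longrightarrow> T $ q $ p = 0" for I and T :: "complex^'n^'n"
    using that
  proof (induction I arbitrary: T rule: finite_induct)
    case empty
    then have "T = 0" by (simp add: vec_eq_iff)
    then show ?case by (simp add: trace_def matrix_matrix_mult_def)
  next
    case (insert k I)
    define \<alpha> where "\<alpha> = Re (T $ k $ k)"
    have kk: "T $ k $ k = of_real \<alpha>"
      unfolding \<alpha>_def by (rule hermitian_diag[OF insert.prems(1)])
    have herm: "cnj (T $ i $ j) = T $ j $ i" for i j
      by (rule hermitian_cnj[OF insert.prems(1)])
    have "\<alpha> \<ge> 0"
      using insert.prems(2)[of "axis k 1"] by (simp add: \<alpha>_def hform_axis_axis)
    show ?case
    proof (cases "\<alpha> = 0")
      \<comment> \<open>A zero diagonal entry of a semidefinite matrix makes \<open>axis k 1\<close>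
        a null vector, so row and column \<open>k\<close> vanish already.\<close>
      case True
      then have "Re (hform T (axis k 1) (axis k 1)) = 0" by (simp add: \<alpha>_def hform_axis_axis)
      then have "hform T (axis j 1) (axis k 1) = 0" for j
        by (rule hform_null[OF insert.prems(1,2)])
      then have "T $ j $ k = 0" for j by (simp add: hform_axis_axis)
      then have "T $ k $ j = 0" for j using herm[of j k] by simp
      then show ?thesis
        using insert.prems by (intro insert.IH) (metis insert_iff)+
    next
      case False
      with \<open>\<alpha> \<ge> 0\<close> have "\<alpha> > 0" by simp
      define w where "w = (\<chi> p. T $ k $ p)"
      \<comment> \<open>The rank-one matrix that agrees with \<open>T\<close> in row and column
        \<open>k\<close>; \<open>T - R\<close> is the Schur complement.\<close>
      define R where "R = (\<chi> q p. T $ q $ k * T $ k $ p / of_real \<alpha>)"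
      have Tyk: "(\<Sum>p\<in>UNIV. T $ q $ p * y $ p) = 0" for q
        using insert.prems(3) by (simp add: vec_eq_iff matrix_vector_mult_def)
      have hR: "hform R x x = hform T x (axis k 1) * cnj (hform T x (axis k 1)) / of_real \<alpha>" for x
        unfolding hform_axis by (simp add: hform_def R_def herm sum_product sum_divide_distrib mult_ac)
      have "Re (trace (C ** (T - R))) \<ge> 0"
      proof (rule insert.IH)
        show "hermitian (T - R)"
          by (simp add: hermitian_def R_def herm)
        show "(T - R) *v y = 0"
        proof -
          have "(R *v y) $ q = 0" for q
          proof -
            have "(R *v y) $ q = T $ q $ k / of_real \<alpha> * (\<Sum>p\<in>UNIV. T $ k $ p * y $ p)"
              by (simp add: matrix_vector_mult_def R_def sum_distrib_left mult_ac)
            then show ?thesis by (simp add: Tyk)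
          qed
          then show ?thesis
            using insert.prems(3) by (simp add: vec_eq_iff matrix_vector_mult_diff_rdistrib)
        qed
        show "(T - R) $ q $ p = 0" if "q \<notin> I" for q p
          using that insert.prems(4)[of q] \<open>\<alpha> > 0\<close> by (cases "q = k") (simp_all add: R_def kk)
        \<comment> \<open>The Schur complement at \<open>x\<close> is the value of \<open>T\<close>
          at \<open>x - (s / \<alpha>) *s axis k 1\<close>, obtained by completing the
          square.\<close>
        show "Re (hform (T - R) x x) \<ge> 0" for x
        proof -
          define s where "s = hform T x (axis k 1)"
          have "0 \<le> Re (hform T x x) - 2 * Re (cnj (s / of_real \<alpha>) * s) + (cmod (s / of_real \<alpha>))\<^sup>2 * \<alpha>"
            using insert.prems(2)[of "x - (s / of_real \<alpha>) *s axis k 1"]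
            unfolding hform_perturb[OF insert.prems(1)] by (simp add: s_def hform_axis_axis \<alpha>_def)
          also have "Re (cnj (s / of_real \<alpha>) * s) = (cmod s)\<^sup>2 / \<alpha>"
            unfolding cmod_power2 by (simp add: power2_eq_square add_divide_distrib)
          also have "(cmod (s / of_real \<alpha>))\<^sup>2 * \<alpha> = (cmod s)\<^sup>2 / \<alpha>"
            using \<open>\<alpha> > 0\<close> by (simp add: norm_divide power2_eq_square)
          also have "Re (hform T x x) - 2 * ((cmod s)\<^sup>2 / \<alpha>) + (cmod s)\<^sup>2 / \<alpha> = Re (hform (T - R) x x)"
            unfolding hform_diff_matrix hR s_def[symmetric] complex_norm_square[symmetric]
            by simp
          finally show ?thesis .
        qed
      qed
      moreover have "trace (C ** R) = hform C w w / of_real \<alpha>"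
        by (simp add: trace_def matrix_matrix_mult_def hform_def R_def w_def herm sum_divide_distrib mult_ac)
      moreover have "Re (hform C w w) \<ge> 0"
        by (rule C) (simp add: w_def Tyk)
      then have "Re (hform C w w) / \<alpha> \<ge> 0"
        using \<open>\<alpha> > 0\<close> by simp
      ultimately show ?thesis
        by (simp add: matrix_diff_ldistrib trace_sub Re_divide_of_real)
    qed
  qed
  from this[OF finite_class.finite_UNIV assms(1-3)] show ?thesis by simp
qed

lemma matrix_add_rdistrib: "(B + C) ** A = B ** A + C ** (A :: complex^'n^'n)"
  by (simp add: matrix_matrix_mult_def vec_eq_iff algebra_simps sum.distrib)

text \<open>The algebra behind the evolution equation, for the inverse \<open>M\<close> of the metric \<open>G\<close>, a
  tensor \<open>S\<close>, and its derivatives in the directions \<open>D = v\<^sup>i \<partial>\<^sub>i\<close> and its conjugate \<open>E\<close>.\<close>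

lemma trace_laplacian:
  fixes M DG EG DEG S DS ES DES :: "complex^'n^'n"
  defines "C \<equiv> DG ** M ** EG - DEG"
  defines "P \<equiv> - (DG ** M)" and "Q \<equiv> - (M ** EG)"
  shows "trace ((M ** DG ** M ** EG ** M + M ** EG ** M ** DG ** M - M ** DEG ** M) ** S
      - M ** DG ** M ** ES - M ** EG ** M ** DS + M ** DES) =
    trace ((DES + P ** ES + DS ** Q + P ** S ** Q) ** M) + trace (C ** (M ** S ** M))"
proof -
  have 1: "trace (M ** DG ** M ** EG ** M ** S) = trace (DG ** M ** EG ** M ** S ** M)"
    using trace_mul_sym[of M "DG ** M ** EG ** M ** S"] by (simp add: matrix_mul_assoc)
  have 2: "trace (M ** EG ** M ** DG ** M ** S) = trace (DG ** M ** S ** M ** EG ** M)"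
    using trace_mul_sym[of "M ** EG ** M" "DG ** M ** S"] by (simp add: matrix_mul_assoc)
  have 3: "trace (M ** DEG ** M ** S) = trace (DEG ** M ** S ** M)"
    using trace_mul_sym[of M "DEG ** M ** S"] by (simp add: matrix_mul_assoc)
  have 4: "trace (M ** DG ** M ** ES) = trace (DG ** M ** ES ** M)"
    using trace_mul_sym[of M "DG ** M ** ES"] by (simp add: matrix_mul_assoc)
  have 5: "trace (M ** EG ** M ** DS) = trace (DS ** M ** EG ** M)"
    using trace_mul_sym[of "M ** EG ** M" "DS"] by (simp add: matrix_mul_assoc)
  have 6: "trace (M ** DES) = trace (DES ** M)" by (rule trace_mul_sym)
  show ?thesis
    unfolding C_def P_def Q_def
    by (simp add: matrix_add_ldistrib matrix_add_rdistrib matrix_diff_ldistrib matrix_diff_rdistrib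
        matrix_minus_left matrix_minus_right trace_add trace_sub trace_minus matrix_mul_assoc 1 2 3 4 5 6)
qed

text \<open>At the minimum the first derivative along \<open>a\<close> vanishes. Were the second
  negative, the first would be negative just to the right, and the mean value theorem would yield a
  smaller value.\<close>

lemma second_derivative_nonneg:
  fixes f :: "'a::real_normed_vector \<Rightarrow> real"
  assumes S: "open S" "smooth_on S f" "x \<in> S" and "r > 0"
    and min: "\<And>s. \<bar>s\<bar> < r \<Longrightarrow> f x \<le> f (x + s *\<^sub>R a)"
  shows "frechet_derivative (\<lambda>y. frechet_derivative f (at y) a) (at x) a \<ge> 0"
proof (rule ccontr)
  let ?D = "\<lambda>y. frechet_derivative f (at y) a"
  define c where "c = frechet_derivative ?D (at x) a"
  assume "\<not> 0 \<le> frechet_derivative ?D (at x) a"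
  then have c: "c < 0" by (simp add: c_def)
  have line: "((\<lambda>s. h (x + s *\<^sub>R a)) has_real_derivative frechet_derivative h (at (x + s *\<^sub>R a)) a) (at s)"
    if "smooth_on S h" "x + s *\<^sub>R a \<in> S" for s and h :: "'a \<Rightarrow> real"
  proof -
    have D: "(h has_derivative frechet_derivative h (at (x + s *\<^sub>R a))) (at (x + s *\<^sub>R a))"
      using smooth_on_differentiable[OF S(1) that] frechet_derivative_works by blast
    have "((\<lambda>s. x + s *\<^sub>R a) has_derivative (\<lambda>u. u *\<^sub>R a)) (at s)"
      by (auto intro!: derivative_eq_intros)
    from has_derivative_compose[OF this D]
    have "((\<lambda>s. h (x + s *\<^sub>R a)) has_derivative (\<lambda>u. frechet_derivative h (at (x + s *\<^sub>R a)) (u *\<^sub>R a))) (at s)" .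
    moreover have "(\<lambda>u. frechet_derivative h (at (x + s *\<^sub>R a)) (u *\<^sub>R a)) = (*) (frechet_derivative h (at (x + s *\<^sub>R a)) a)"
      using linear_cmul[OF has_derivative_linear[OF D]] by (auto simp: mult.commute)
    ultimately show ?thesis by (simp add: has_field_derivative_def)
  qed
  have "((\<lambda>s. x + s *\<^sub>R a) \<longlongrightarrow> x + 0 *\<^sub>R a) (at 0)" by (intro tendsto_intros)
  then have "\<forall>\<^sub>F s in at 0. x + s *\<^sub>R a \<in> S"
    using S(1,3) by (simp add: topological_tendstoD)
  then obtain d where "d > 0" and dS: "\<forall>s\<in>UNIV. s \<noteq> 0 \<and> dist s 0 < d \<longrightarrow> x + s *\<^sub>R a \<in> S"
    unfolding eventually_at by blast
  have dS: "x + s *\<^sub>R a \<in> S" if "\<bar>s\<bar> < d" for s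
    using dS S(3) that by (cases "s = 0") (auto simp: dist_real_def)
  have d1: "((\<lambda>s. f (x + s *\<^sub>R a)) has_real_derivative ?D (x + s *\<^sub>R a)) (at s)" if "\<bar>s\<bar> < d" for s
    using line[OF S(2) dS[OF that]] .
  have d2: "((\<lambda>s. ?D (x + s *\<^sub>R a)) has_real_derivative c) (at 0)"
    using line[OF smooth_on_frechet_derivative[OF S(1,2)], of 0 a] S(3) by (simp add: c_def)
  have "?D x = 0"
  proof (rule DERIV_local_min)
    show "((\<lambda>s. f (x + s *\<^sub>R a)) has_real_derivative ?D x) (at 0)" using d1[of 0] \<open>d > 0\<close> by simp
    show "0 < r" by fact
    show "\<forall>s. \<bar>0 - s\<bar> < r \<longrightarrow> f (x + 0 *\<^sub>R a) \<le> f (x + s *\<^sub>R a)" using min by simp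
  qed
  moreover obtain e where e: "e > 0" "\<And>h. 0 < h \<Longrightarrow> h < e \<Longrightarrow> ?D (x + (0 + h) *\<^sub>R a) < ?D (x + 0 *\<^sub>R a)"
    using DERIV_neg_dec_right[OF d2 c] by blast
  ultimately have neg: "?D (x + h *\<^sub>R a) < 0" if "0 < h" "h < e" for h
    using that by force
  define h where "h = min r (min d e) / 2"
  have h: "0 < h" "h < r" "h < d" "h < e"
    using \<open>r > 0\<close> \<open>d > 0\<close> e(1) by (auto simp: h_def)
  have "\<exists>s. 0 < s \<and> s < h \<and> f (x + h *\<^sub>R a) - f (x + 0 *\<^sub>R a) = (h - 0) * ?D (x + s *\<^sub>R a)"
    using h by (intro MVT2 d1) auto
  then obtain s where s: "0 < s" "s < h" "f (x + h *\<^sub>R a) - f x = h * ?D (x + s *\<^sub>R a)" by auto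
  then have "f (x + h *\<^sub>R a) - f x < 0"
    using neg[of s] h by (simp add: mult_pos_neg)
  then show False using min[of h] h by simp
qed

text \<open>The mixed derivative is the sesquilinear form in \<open>w\<close> and \<open>u\<close>
  given by the complex Hessian of \<open>f\<close>.\<close>

lemma cderiv_hol_ant_expand:
  fixes f :: "(complex^'n::finite) \<times> real \<Rightarrow> complex"
  assumes S: "open S" "smooth_on S f" "x \<in> S"
  shows "cderiv (hol w) (cderiv (ant u) f) x =
    (\<Sum>k\<in>UNIV. \<Sum>l\<in>UNIV. w $ k * cnj (u $ l) * cderiv (hol (axis k 1)) (cderiv (ant (axis l 1)) f) x)"
proof -
  have d: "cderiv e f differentiable (at x)" for e
    by (rule smooth_on_differentiable[OF S(1) smooth_on_cderiv[OF S(1,2)] S(3)])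
  have "cderiv (hol w) (cderiv (ant u) f) x =
      (\<Sum>k\<in>UNIV. w $ k * cderiv (hol (axis k 1)) (cderiv (ant u) f) x)"
    by (rule cderiv_hol_expand(1)[OF d])
  moreover have "cderiv (hol (axis k 1)) (cderiv (ant u) f) x =
      cderiv (hol (axis k 1)) (\<lambda>y. \<Sum>l\<in>UNIV. cnj (u $ l) * cderiv (ant (axis l 1)) f y) x" for k
    by (rule cderiv_cong[OF S(1,3)]) (rule cderiv_hol_expand(2)[OF smooth_on_differentiable[OF S(1,2)]])
  moreover have "cderiv (hol (axis k 1)) (\<lambda>y. \<Sum>l\<in>UNIV. cnj (u $ l) * cderiv (ant (axis l 1)) f y) x =
      (\<Sum>l\<in>UNIV. cnj (u $ l) * cderiv (hol (axis k 1)) (cderiv (ant (axis l 1)) f) x)" for k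
    using d by (simp add: cderiv_sum cderiv_cmult)
  ultimately show ?thesis by (simp add: sum_distrib_left mult_ac)
qed

text \<open>Four times this derivative is the sum of the second derivatives along \<open>w\<close>
  and \<open>\<i> *s w\<close>; the cross terms cancel by symmetry. The minimum is one in space
  only, at the fixed time \<open>t\<close>.\<close>

lemma laplacian_nonneg:
  fixes f :: "(complex^'n::finite) \<times> real \<Rightarrow> complex"
  assumes S: "open S" "smooth_on S f" "(z, t) \<in> S" and "r > 0"
    and min: "\<And>y. dist y z < r \<Longrightarrow> Re (f (z, t)) \<le> Re (f (y, t))"
  shows "Re (cderiv (hol w) (cderiv (ant w) f) (z, t)) \<ge> 0"
proof -
  define D where "D a b = frechet_derivative (\<lambda>y. frechet_derivative f (at y) a) (at (z, t)) b" for a b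
  let ?a = "(w, 0) :: (complex^'n) \<times> real" and ?b = "(\<i> *s w, 0) :: (complex^'n) \<times> real"
  have df: "(\<lambda>y. frechet_derivative f (at y) a) differentiable (at (z, t))" for a
    by (rule smooth_on_differentiable[OF S(1) smooth_on_frechet_derivative[OF S(1,2)] S(3)])
  have "cderiv (hol w) (cderiv (ant w) f) (z, t) =
      cderiv (hol w) (\<lambda>y. (1/2) * (frechet_derivative f (at y) ?a + \<i> * frechet_derivative f (at y) ?b)) (z, t)"
    by (rule cderiv_cong[OF S(1,3)]) (simp add: cderiv_hol_eq(2)[OF smooth_on_differentiable[OF S(1,2)]])
  also have "\<dots> = (1/2) * (cderiv (hol w) (\<lambda>y. frechet_derivative f (at y) ?a) (z, t) +
      \<i> * cderiv (hol w) (\<lambda>y. frechet_derivative f (at y) ?b) (z, t))"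
    unfolding cderiv_cmult[OF differentiable_add[OF df differentiable_mult[OF differentiable_const df]]]
      cderiv_add[OF df differentiable_mult[OF differentiable_const df]] cderiv_cmult[OF df] ..
  also have "\<dots> = (1/2) * ((D ?a ?a - \<i> * D ?a ?b) / 2 + \<i> * ((D ?b ?a - \<i> * D ?b ?b) / 2))"
    unfolding cderiv_hol_eq(1)[OF df] D_def ..
  also have "D ?b ?a = D ?a ?b"
    unfolding D_def by (rule frechet_derivative_commute[OF S])
  finally have "cderiv (hol w) (cderiv (ant w) f) (z, t) = (D ?a ?a + D ?b ?b) / 4"
    by (simp add: field_simps)
  then have "Re (cderiv (hol w) (cderiv (ant w) f) (z, t)) = (Re (D ?a ?a) + Re (D ?b ?b)) / 4"
    by (simp only: Re_divide_numeral plus_complex.sel)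
  moreover have "Re (D (u, 0) (u, 0)) \<ge> 0" for u
  proof -
    have "Re (D (u, 0) (u, 0)) = frechet_derivative (\<lambda>y. Re (frechet_derivative f (at y) (u, 0))) (at (z, t)) (u, 0)"
      unfolding D_def by (rule frechet_derivative_bounded_linear[OF bounded_linear_Re df, symmetric])
    also have "frechet_derivative (\<lambda>y. Re (frechet_derivative f (at y) (u, 0))) (at (z, t)) =
        frechet_derivative (\<lambda>y. frechet_derivative (\<lambda>y. Re (f y)) (at y) (u, 0)) (at (z, t))"
      by (rule frechet_derivative_cong_open[OF S(1,3)])
        (rule frechet_derivative_bounded_linear[OF bounded_linear_Re smooth_on_differentiable[OF S(1,2)], symmetric])
    also have "\<dots> (u, 0) \<ge> 0"
    proof (rule second_derivative_nonneg[OF S(1) _ S(3)])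
      show "smooth_on S (\<lambda>y. Re (f y))"
        by (rule smooth_on_compose_linear[OF bounded_linear_Re S(2)])
      have p: "norm u + 1 > 0" by (simp add: add_nonneg_pos)
      then show "r / (norm u + 1) > 0" using \<open>r > 0\<close> by simp
      fix s :: real
      assume s: "\<bar>s\<bar> < r / (norm u + 1)"
      have "dist (z + s *\<^sub>R u) z = \<bar>s\<bar> * norm u" by (simp add: dist_norm)
      also have "\<dots> \<le> \<bar>s\<bar> * (norm u + 1)" by (rule mult_left_mono) auto
      also have "\<dots> < r" using s p by (simp add: pos_less_divide_eq)
      finally show "Re (f (z, t)) \<le> Re (f ((z, t) + s *\<^sub>R (u, 0)))" using min by simp
    qed
    finally show ?thesis .
  qed
  ultimately show ?thesis by (metis add_nonneg_nonneg divide_nonneg_pos zero_less_numeral)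
qed

section \<open>Derivatives of coordinate functions and of conjugates\<close>

lemma cderiv_coordinate:
  fixes w :: "complex^'n::finite"
  shows "cderiv (hol w) (\<lambda>y. fst y $ k) x = w $ k" "cderiv (ant w) (\<lambda>y. fst y $ k) x = 0"
proof -
  have L: "bounded_linear (\<lambda>y :: (complex^'n) \<times> real. fst y $ k)"
    by (rule bounded_linear_compose[OF bounded_linear_vec_nth bounded_linear_fst])
  show "cderiv (hol w) (\<lambda>y. fst y $ k) x = w $ k" "cderiv (ant w) (\<lambda>y. fst y $ k) x = 0"
    by (simp_all add: cderiv_linear[OF L] hol_def ant_def complex_eq_iff)
qed

lemma smooth_on_coordinate: "smooth_on S (\<lambda>y :: (complex^'n::finite) \<times> real. fst y $ k)"
  by (rule smooth_on_linear) (rule bounded_linear_compose[OF bounded_linear_vec_nth bounded_linear_fst])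

lemma cderiv_cnj_hol:
  assumes "f differentiable (at x)"
  shows "cderiv (hol w) (\<lambda>y. cnj (f y)) x = cnj (cderiv (ant w) f x)"
    "cderiv (ant w) (\<lambda>y. cnj (f y)) x = cnj (cderiv (hol w) f x)"
    "cderiv tim (\<lambda>y. cnj (f y)) x = cnj (cderiv tim f x)"
  by (simp_all add: cderiv_cnj[OF assms] hol_def ant_def tim_def)


section \<open>Closed Hermitian tensors\<close>

text \<open>For Hermitian \<open>F\<close> this symmetry, with its conjugate, is closedness of the
  associated (1,1)-form in the space variables; time derivatives are not constrained.\<close>

definition closed_tensor :: "((complex^'n::finite) \<times> real) set \<Rightarrow> ((complex^'n) \<times> real \<Rightarrow> complex^'n^'n) \<Rightarrow> bool" where
  "closed_tensor S F \<longleftrightarrow> msmooth_on S F \<and> (\<forall>x\<in>S. hermitian (F x)) \<and>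
    (\<forall>x\<in>S. \<forall>k i j. mderiv (hol (axis k 1)) F x $ i $ j = mderiv (hol (axis i 1)) F x $ k $ j)"

context
  fixes S :: "((complex^'n::finite) \<times> real) set" and F :: "(complex^'n) \<times> real \<Rightarrow> complex^'n^'n"
  assumes S: "open S" and F: "closed_tensor S F"
begin

lemma closed_smooth: "msmooth_on S F"
  using F by (simp add: closed_tensor_def)

lemma closed_hol: "x \<in> S \<Longrightarrow> mderiv (hol (axis k 1)) F x $ i $ j = mderiv (hol (axis i 1)) F x $ k $ j"
  using F by (simp add: closed_tensor_def)

lemma closed_cnj:
  assumes "x \<in> S"
  shows "mderiv (ant w) F x = ctrans (mderiv (hol w) F x)"
proof -
  have "cderiv (ant w) (\<lambda>y. F y $ i $ j) x = cderiv (ant w) (\<lambda>y. cnj (F y $ j $ i)) x" for i j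
    using F by (intro cderiv_cong[OF S assms]) (simp add: closed_tensor_def hermitian_cnj)
  then show ?thesis
    by (simp add: mderiv_def ctrans_def vec_eq_iff
        cderiv_cnj_hol[OF msmooth_on_differentiable[OF S closed_smooth assms]])
qed

lemma closed_ant:
  assumes "x \<in> S"
  shows "mderiv (ant (axis l 1)) F x $ i $ j = mderiv (ant (axis j 1)) F x $ i $ l"
  using closed_hol[OF assms] by (simp add: closed_cnj[OF assms] ctrans_def)

text \<open>Exchange the barred indices, commute the derivatives, then exchange the unbarred
  indices.\<close>

lemma closed_hol_ant:
  assumes x: "x \<in> S"
  shows "mderiv (hol (axis k 1)) (mderiv (ant (axis l 1)) F) x $ i $ j =
    mderiv (hol (axis i 1)) (mderiv (ant (axis j 1)) F) x $ k $ l"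
proof -
  have comm: "mderiv (hol v) (mderiv (ant w) F) x = mderiv (ant w) (mderiv (hol v) F) x" for v w
    by (rule mderiv_commute[OF S closed_smooth x])
  have "mderiv (hol (axis k 1)) (mderiv (ant (axis l 1)) F) x $ i $ j =
      mderiv (hol (axis k 1)) (mderiv (ant (axis j 1)) F) x $ i $ l"
    by (simp add: mderiv_def[of "hol (axis k 1)"]) (rule cderiv_cong[OF S x closed_ant])
  also have "\<dots> = mderiv (hol (axis i 1)) (mderiv (ant (axis j 1)) F) x $ k $ l"
    unfolding comm
    by (simp add: mderiv_def[of "ant (axis j 1)"]) (rule cderiv_cong[OF S x closed_hol])
  finally show ?thesis .
qed

text \<open>Closedness exchanges a derivative index with a tensor index of the same type, so a
  derivative along \<open>v\<close> becomes a contraction of the tensor with \<open>v\<close>. This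
  takes the place of commuting covariant derivatives.\<close>

lemma closed_expand:
  assumes x: "x \<in> S"
  shows "mderiv (hol v) F x $ k $ j = (\<Sum>i\<in>UNIV. v $ i * mderiv (hol (axis k 1)) F x $ i $ j)"
    and "mderiv (ant v) F x $ i $ l = (\<Sum>j\<in>UNIV. cnj (v $ j) * mderiv (ant (axis l 1)) F x $ i $ j)"
    and "mderiv (hol v) (mderiv (ant v) F) x $ k $ l =
      (\<Sum>i\<in>UNIV. \<Sum>j\<in>UNIV. v $ i * cnj (v $ j) * mderiv (hol (axis k 1)) (mderiv (ant (axis l 1)) F) x $ i $ j)"
proof -
  note d = msmooth_on_differentiable[OF S closed_smooth x]
  show "mderiv (hol v) F x $ k $ j = (\<Sum>i\<in>UNIV. v $ i * mderiv (hol (axis k 1)) F x $ i $ j)"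
  proof -
    have "mderiv (hol v) F x $ k $ j = (\<Sum>i\<in>UNIV. v $ i * mderiv (hol (axis i 1)) F x $ k $ j)"
      unfolding mderiv_def vec_lambda_beta by (rule cderiv_hol_expand(1)[OF d])
    also have "\<dots> = (\<Sum>i\<in>UNIV. v $ i * mderiv (hol (axis k 1)) F x $ i $ j)"
      by (intro sum.cong refl arg_cong[where f = "(*) _"] closed_hol[OF x])
    finally show ?thesis .
  qed
  show "mderiv (ant v) F x $ i $ l = (\<Sum>j\<in>UNIV. cnj (v $ j) * mderiv (ant (axis l 1)) F x $ i $ j)"
  proof -
    have "mderiv (ant v) F x $ i $ l = (\<Sum>j\<in>UNIV. cnj (v $ j) * mderiv (ant (axis j 1)) F x $ i $ l)"
      unfolding mderiv_def vec_lambda_beta by (rule cderiv_hol_expand(2)[OF d])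
    also have "\<dots> = (\<Sum>j\<in>UNIV. cnj (v $ j) * mderiv (ant (axis l 1)) F x $ i $ j)"
      by (intro sum.cong refl arg_cong[where f = "(*) _"] closed_ant[OF x])
    finally show ?thesis .
  qed
  show "mderiv (hol v) (mderiv (ant v) F) x $ k $ l =
      (\<Sum>i\<in>UNIV. \<Sum>j\<in>UNIV. v $ i * cnj (v $ j) * mderiv (hol (axis k 1)) (mderiv (ant (axis l 1)) F) x $ i $ j)"
  proof -
    have "mderiv (hol v) (mderiv (ant v) F) x $ k $ l =
        (\<Sum>i\<in>UNIV. \<Sum>j\<in>UNIV. v $ i * cnj (v $ j) * mderiv (hol (axis i 1)) (mderiv (ant (axis j 1)) F) x $ k $ l)"
      unfolding mderiv_def vec_lambda_beta
      by (rule cderiv_hol_ant_expand[OF S smooth_on_nth[OF S closed_smooth] x])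
    also have "\<dots> = (\<Sum>i\<in>UNIV. \<Sum>j\<in>UNIV. v $ i * cnj (v $ j) * mderiv (hol (axis k 1)) (mderiv (ant (axis l 1)) F) x $ i $ j)"
      by (intro sum.cong refl arg_cong[where f = "(*) _"] closed_hol_ant[OF x])
    finally show ?thesis .
  qed
qed

text \<open>\<open>V\<close> is the affine holomorphic field with value \<open>v\<close> at
  \<open>x\<close> and derivative \<open>\<partial>\<^sub>k V\<^sup>i = P $ k $ i\<close>. Its
  antiholomorphic derivatives vanish, so the product rule leaves four terms, and
  \<open>closed_expand\<close> rewrites each of them with derivatives along
  \<open>v\<close>.\<close>

lemma laplacian_affine_field:
  fixes P :: "complex^'n^'n" and v :: "complex^'n"
  assumes x: "x \<in> S"
  defines "V \<equiv> \<lambda>y. (\<chi> i. v $ i + (\<Sum>k\<in>UNIV. P $ k $ i * (fst y $ k - fst x $ k)))"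
  shows "smooth_on S (\<lambda>y. hform (F y) (V y) (V y))"
    and "cderiv (hol (axis k 1)) (cderiv (ant (axis l 1)) (\<lambda>y. hform (F y) (V y) (V y))) x =
      (mderiv (hol v) (mderiv (ant v) F) x + P ** mderiv (ant v) F x + mderiv (hol v) F x ** ctrans P +
       P ** F x ** ctrans P) $ k $ l"
proof -
  note sF = smooth_on_nth[OF S closed_smooth]
  have sV: "smooth_on T (\<lambda>y. V y $ i)" for T i
    unfolding V_def
    by (simp, intro smooth_on_add smooth_on_sum smooth_on_mult smooth_on_diff smooth_on_const smooth_on_coordinate)
  note scV = smooth_on_cnj[OF sV]
  show "smooth_on S (\<lambda>y. hform (F y) (V y) (V y))"
    unfolding hform_def by (intro smooth_on_sum smooth_on_mult sF sV scV)
  have dV: "(\<lambda>y. V y $ i) differentiable (at y)" for i y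
    using smooth_on_differentiable[OF open_UNIV sV] by simp
  have dcV: "(\<lambda>y. cnj (V y $ i)) differentiable (at y)" for i y
    using smooth_on_differentiable[OF open_UNIV scV] by simp
  have dc: "(\<lambda>y :: (complex^'n) \<times> real. fst y $ k) differentiable (at y)" for k y
    using smooth_on_differentiable[OF open_UNIV smooth_on_coordinate] by simp
  have cV: "cderiv e (\<lambda>y. V y $ i) y = (\<Sum>k\<in>UNIV. P $ k $ i * cderiv e (\<lambda>y. fst y $ k) y)" for e i y
    unfolding V_def
    by (simp add: cderiv_add cderiv_sum cderiv_cmult cderiv_diff dc differentiable_add differentiable_sum
        differentiable_diff differentiable_mult)
  have hV: "cderiv (hol (axis k 1)) (\<lambda>y. V y $ i) y = P $ k $ i"
    and aV: "cderiv (ant (axis k 1)) (\<lambda>y. V y $ i) y = 0" for k i y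
    unfolding cV cderiv_coordinate sum_axis by simp_all
  have hcV: "cderiv (hol (axis k 1)) (\<lambda>y. cnj (V y $ i)) y = 0"
    and acV: "cderiv (ant (axis k 1)) (\<lambda>y. cnj (V y $ i)) y = cnj (P $ k $ i)" for k i y
    by (simp_all add: cderiv_cnj_hol[OF dV] hV aV)
  have V0: "V x $ i = v $ i" for i
    by (simp add: V_def)
  have dF: "(\<lambda>y. F y $ i $ j) differentiable (at y)" if "y \<in> S" for i j y
    by (rule msmooth_on_differentiable[OF S closed_smooth that])
  have dDF: "cderiv e (\<lambda>y. F y $ i $ j) differentiable (at y)" if "y \<in> S" for e i j y
    by (rule smooth_on_differentiable[OF S smooth_on_cderiv[OF S sF] that])
  let ?L = "\<lambda>i j. cderiv (ant (axis l 1)) (\<lambda>y. F y $ i $ j)"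
  let ?K = "\<lambda>i j. cderiv (hol (axis k 1)) (\<lambda>y. F y $ i $ j)"
  have "cderiv (ant (axis l 1)) (\<lambda>y. hform (F y) (V y) (V y)) y =
      (\<Sum>i\<in>UNIV. \<Sum>j\<in>UNIV. ?L i j y * V y $ i * cnj (V y $ j) + F y $ i $ j * V y $ i * cnj (P $ l $ j))"
    if "y \<in> S" for y
    unfolding hform_def
    by (simp add: cderiv_sum cderiv_mult dF[OF that] dV dcV differentiable_sum differentiable_mult aV acV)
  then have "cderiv (hol (axis k 1)) (cderiv (ant (axis l 1)) (\<lambda>y. hform (F y) (V y) (V y))) x =
      cderiv (hol (axis k 1)) (\<lambda>y. \<Sum>i\<in>UNIV. \<Sum>j\<in>UNIV.
        ?L i j y * V y $ i * cnj (V y $ j) + F y $ i $ j * V y $ i * cnj (P $ l $ j)) x"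
    by (rule cderiv_cong[OF S x])
  also have "\<dots> = (\<Sum>i\<in>UNIV. \<Sum>j\<in>UNIV.
      cderiv (hol (axis k 1)) (?L i j) x * v $ i * cnj (v $ j) + ?L i j x * P $ k $ i * cnj (v $ j) +
      (?K i j x * v $ i * cnj (P $ l $ j) + F x $ i $ j * P $ k $ i * cnj (P $ l $ j)))"
    by (simp add: cderiv_sum cderiv_add cderiv_mult dF[OF x] dDF[OF x] dV dcV differentiable_add
        differentiable_sum differentiable_mult hV hcV V0 algebra_simps)
  \<comment> \<open>Regrouped so that the sums over the components of \<open>v\<close> are those of
    \<open>closed_expand\<close>.\<close>
  also have "\<dots> = (\<Sum>i\<in>UNIV. \<Sum>j\<in>UNIV. v $ i * cnj (v $ j) * cderiv (hol (axis k 1)) (?L i j) x) +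
      (\<Sum>i\<in>UNIV. P $ k $ i * (\<Sum>j\<in>UNIV. cnj (v $ j) * ?L i j x)) +
      (\<Sum>j\<in>UNIV. (\<Sum>i\<in>UNIV. v $ i * ?K i j x) * cnj (P $ l $ j)) +
      (\<Sum>j\<in>UNIV. (\<Sum>i\<in>UNIV. P $ k $ i * F x $ i $ j) * cnj (P $ l $ j))"
    unfolding sum_distrib_right
      sum.swap[of "\<lambda>j i. v $ i * ?K i j x * cnj (P $ l $ j)" UNIV UNIV]
      sum.swap[of "\<lambda>j i. P $ k $ i * F x $ i $ j * cnj (P $ l $ j)" UNIV UNIV]
    by (simp add: sum.distrib sum_distrib_left mult_ac)
  also have "\<dots> = (mderiv (hol v) (mderiv (ant v) F) x + P ** mderiv (ant v) F x +
      mderiv (hol v) F x ** ctrans P + P ** F x ** ctrans P) $ k $ l"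
    unfolding vector_add_component matrix_matrix_mult_def vec_lambda_beta closed_expand[OF x, where v = v]
    by (simp add: mderiv_def ctrans_def)
  finally show "cderiv (hol (axis k 1)) (cderiv (ant (axis l 1)) (\<lambda>y. hform (F y) (V y) (V y))) x =
      (mderiv (hol v) (mderiv (ant v) F) x + P ** mderiv (ant v) F x + mderiv (hol v) F x ** ctrans P +
       P ** F x ** ctrans P) $ k $ l" .
qed

end

lemma matrix_mult_expand_left:
  fixes N :: "complex^'n^'n"
  assumes "\<And>s. A $ p $ s = (\<Sum>i\<in>I. c i * A' i $ p $ s)"
  shows "(A ** N) $ p $ q = (\<Sum>i\<in>I. c i * (A' i ** N) $ p $ q)"
proof -
  have "(A ** N) $ p $ q = (\<Sum>s\<in>UNIV. \<Sum>i\<in>I. c i * A' i $ p $ s * N $ s $ q)"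
    by (simp add: matrix_matrix_mult_def assms sum_distrib_right)
  also have "\<dots> = (\<Sum>i\<in>I. \<Sum>s\<in>UNIV. c i * A' i $ p $ s * N $ s $ q)"
    by (rule sum.swap)
  finally show ?thesis by (simp add: matrix_matrix_mult_def sum_distrib_left mult_ac)
qed

lemma matrix_mult_expand_right:
  fixes N :: "complex^'n^'n"
  assumes "\<And>s. B $ s $ q = (\<Sum>j\<in>J. c j * B' j $ s $ q)"
  shows "(N ** B) $ p $ q = (\<Sum>j\<in>J. c j * (N ** B' j) $ p $ q)"
proof -
  have "(N ** B) $ p $ q = (\<Sum>s\<in>UNIV. \<Sum>j\<in>J. N $ p $ s * (c j * B' j $ s $ q))"
    by (simp add: matrix_matrix_mult_def assms sum_distrib_left)
  also have "\<dots> = (\<Sum>j\<in>J. \<Sum>s\<in>UNIV. N $ p $ s * (c j * B' j $ s $ q))"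
    by (rule sum.swap)
  finally show ?thesis by (simp add: matrix_matrix_mult_def sum_distrib_left mult_ac)
qed

section \<open>The evolution of the Ricci curvature in a chart\<close>

locale metric_chart =
  fixes S :: "((complex^'n::finite) \<times> real) set" and G :: "(complex^'n) \<times> real \<Rightarrow> complex^'n^'n"
  assumes S: "open S" and closed_G: "closed_tensor S G"
    and pos: "\<And>x u. x \<in> S \<Longrightarrow> u \<noteq> 0 \<Longrightarrow> Re (hform (G x) u u) > 0"
begin

text \<open>The components with upper indices are the transpose,
  \<open>g\<^sup>p\<^sup>q = M $ q $ p\<close>; matrix products need the plain inverse.\<close>

definition M :: "(complex^'n) \<times> real \<Rightarrow> complex^'n^'n" where
  "M x = matrix_inv (G x)"

text \<open>The matrix of the components \<open>R\<^sub>p\<^sub>q\<^sub>i\<^sub>j\<close> with fixed \<open>i, j\<close>.\<close>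

definition Rm :: "'n \<Rightarrow> 'n \<Rightarrow> (complex^'n) \<times> real \<Rightarrow> complex^'n^'n" where
  "Rm i j x = mderiv (hol (axis i 1)) G x ** M x ** mderiv (ant (axis j 1)) G x
    - mderiv (hol (axis i 1)) (mderiv (ant (axis j 1)) G) x"

definition Ric :: "(complex^'n) \<times> real \<Rightarrow> complex^'n^'n" where
  "Ric x = (\<chi> i j. \<Sum>k\<in>UNIV. \<Sum>l\<in>UNIV. M x $ l $ k * Rm k l x $ i $ j)"

lemmas smooth_G = closed_smooth[OF S closed_G]

lemma hermitian_G: "x \<in> S \<Longrightarrow> hermitian (G x)"
  using closed_G by (simp add: closed_tensor_def)

lemma GM: assumes "x \<in> S" shows "G x ** M x = mat 1" "M x ** G x = mat 1"
  unfolding M_def using matrix_inv_both[OF hform_pos_invertible[OF pos[OF assms]]] by auto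

lemma smooth_M: "msmooth_on S M"
  unfolding msmooth_on_def M_def
  using smooth_G hform_pos_invertible[OF pos] by (auto simp: msmooth_on_def intro!: smooth_on_matrix_inv)

lemma hermitian_M: "x \<in> S \<Longrightarrow> hermitian (M x)"
  using hermitian_inverse[OF hermitian_G GM] .

text \<open>\<open>M = M ** G ** M\<close> exhibits the inverse as congruent to the metric.\<close>

lemma M_nonneg:
  assumes "x \<in> S"
  shows "Re (hform (M x) u u) \<ge> 0"
proof -
  have "M x = M x ** G x ** M x" using GM[OF assms] by simp
  then have "hform (M x) u u = hform (G x) (u v* M x) (u v* M x)"
    using hform_congruence[OF hermitian_M[OF assms], of "G x" u] by simp
  then show ?thesis
    using pos[OF assms, of "u v* M x"] by (cases "u v* M x = 0") (auto simp: hform_def)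
qed

lemmas smooth_dG = msmooth_on_mderiv[OF S smooth_G]

lemma mderiv_M: "x \<in> S \<Longrightarrow> mderiv e M x = - (M x ** mderiv e G x ** M x)"
  by (rule mderiv_inverse[OF S smooth_G smooth_M _ GM])

text \<open>The pair symmetry of Kaehler curvature, a consequence of closedness. It moves the Ricci
  contraction from the outer indices into a matrix trace.\<close>

lemma Rm_swap:
  assumes x: "x \<in> S"
  shows "Rm k l x $ i $ j = Rm i j x $ k $ l"
  unfolding Rm_def vector_minus_component matrix_matrix_mult_def vec_lambda_beta
    closed_hol_ant[OF S closed_G x, of k l i j]
    closed_hol[OF S closed_G x, of k i] closed_ant[OF S closed_G x, of l _ j] ..

lemma Ric_eq_trace:
  assumes "x \<in> S"
  shows "Ric x $ i $ j = trace (M x ** Rm i j x)"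
proof -
  have "Ric x $ i $ j = (\<Sum>k\<in>UNIV. \<Sum>l\<in>UNIV. M x $ l $ k * Rm i j x $ k $ l)"
    unfolding Ric_def vec_lambda_beta Rm_swap[OF assms, of _ _ i j] ..
  also have "\<dots> = (\<Sum>l\<in>UNIV. \<Sum>k\<in>UNIV. M x $ l $ k * Rm i j x $ k $ l)"
    by (rule sum.swap)
  finally show ?thesis by (simp add: trace_def matrix_matrix_mult_def)
qed

text \<open>The derivative of \<open>log det G\<close>.\<close>

definition logdet' :: "((complex^'n) \<times> real) \<times> ((complex^'n) \<times> real) \<Rightarrow> (complex^'n) \<times> real \<Rightarrow> complex" where
  "logdet' e x = trace (M x ** mderiv e G x)"

lemma smooth_logdet': "smooth_on S (logdet' e)"
  unfolding logdet'_def[abs_def]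
  by (intro smooth_on_trace[OF S] msmooth_on_mult[OF S] smooth_M smooth_dG)

lemma cderiv_logdet':
  assumes x: "x \<in> S"
  shows "cderiv d (logdet' e) x = trace (M x ** mderiv d (mderiv e G) x - M x ** mderiv d G x ** M x ** mderiv e G x)"
proof -
  have "cderiv d (logdet' e) x = trace (mderiv d (\<lambda>x. M x ** mderiv e G x) x)"
    unfolding logdet'_def[abs_def]
    by (rule cderiv_trace[OF S _ x]) (intro msmooth_on_mult[OF S] smooth_M smooth_dG)
  also have "mderiv d (\<lambda>x. M x ** mderiv e G x) x = M x ** mderiv d (mderiv e G) x - M x ** mderiv d G x ** M x ** mderiv e G x"
    by (simp add: mderiv_mult[OF S smooth_M smooth_dG x] mderiv_M[OF x] matrix_minus_left)
  finally show ?thesis .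
qed

text \<open>Symmetry of the second derivatives of \<open>log det G\<close>. The logarithm itself is
  never formed; the terms quadratic in first derivatives agree by cyclicity of the trace.\<close>

lemma cderiv_logdet'_commute:
  assumes "x \<in> S"
  shows "cderiv d (logdet' e) x = cderiv e (logdet' d) x"
  unfolding cderiv_logdet'[OF assms] trace_sub mderiv_commute[OF S smooth_G assms, of d e]
  using trace_mul_sym[of "M x ** mderiv d G x" "M x ** mderiv e G x"] by (simp add: matrix_mul_assoc)

text \<open>The classical formula \<open>R\<^sub>i\<^sub>j = - \<partial>\<^sub>i \<partial>\<^sub>j
  log det G\<close> (j barred), the source of both smoothness and closedness of the Ricci
  tensor.\<close>

lemma Ric_eq_logdet:
  assumes "x \<in> S"
  shows "Ric x $ i $ j = - cderiv (hol (axis i 1)) (logdet' (ant (axis j 1))) x"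
  unfolding Ric_eq_trace[OF assms] cderiv_logdet'[OF assms] Rm_def
  by (simp add: matrix_diff_ldistrib trace_sub matrix_mul_assoc)

lemma cderiv_Ric:
  assumes x: "x \<in> S"
  shows "cderiv e (\<lambda>y. Ric y $ i $ j) x = - cderiv e (cderiv (hol (axis i 1)) (logdet' (ant (axis j 1)))) x"
proof -
  have "cderiv e (\<lambda>y. Ric y $ i $ j) x = cderiv e (\<lambda>y. - cderiv (hol (axis i 1)) (logdet' (ant (axis j 1))) y) x"
    by (rule cderiv_cong[OF S x Ric_eq_logdet])
  also have "\<dots> = - cderiv e (cderiv (hol (axis i 1)) (logdet' (ant (axis j 1)))) x"
    by (rule cderiv_minus) (rule smooth_on_differentiable[OF S smooth_on_cderiv[OF S smooth_logdet'] x])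
  finally show ?thesis .
qed

lemma smooth_Ric: "msmooth_on S Ric"
  unfolding msmooth_on_def
proof (intro allI)
  fix i j
  have "smooth_on S (\<lambda>x. - cderiv (hol (axis i 1)) (logdet' (ant (axis j 1))) x)"
    by (intro smooth_on_minus smooth_on_cderiv[OF S] smooth_logdet')
  then show "smooth_on S (\<lambda>x. Ric x $ i $ j)"
    by (simp add: smooth_on_cong[OF Ric_eq_logdet])
qed

end

locale flow_chart = metric_chart S G
  for S :: "((complex^'n::finite) \<times> real) set" and G :: "(complex^'n) \<times> real \<Rightarrow> complex^'n^'n" +
  assumes flow: "\<And>x. x \<in> S \<Longrightarrow> mderiv tim G x = G x - Ric x"
begin

text \<open>Read off from the flow: \<open>Ric\<close> is \<open>G\<close> minus its time
  derivative, and the time derivative of a Hermitian matrix is Hermitian.\<close>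

lemma hermitian_Ric:
  assumes x: "x \<in> S"
  shows "hermitian (Ric x)"
proof -
  have *: "cnj (mderiv tim G x $ i $ j) = mderiv tim G x $ j $ i" for i j
  proof -
    have "cderiv tim (\<lambda>y. G y $ j $ i) x = cderiv tim (\<lambda>y. cnj (G y $ i $ j)) x"
      by (rule cderiv_cong[OF S x]) (simp add: hermitian_cnj[OF hermitian_G])
    then show ?thesis
      by (simp add: mderiv_def cderiv_cnj_hol[OF msmooth_on_differentiable[OF S smooth_G x]])
  qed
  have "Ric x = G x - mderiv tim G x" using flow[OF x] by simp
  then show ?thesis
    by (simp add: hermitian_def * hermitian_cnj[OF hermitian_G[OF x]])
qed

text \<open>In the formula by \<open>log det G\<close>, the derivatives in the directions
  \<open>k\<close> and \<open>i\<close> commute.\<close>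

lemma closed_Ric: "closed_tensor S Ric"
  unfolding closed_tensor_def
proof (intro conjI ballI allI smooth_Ric hermitian_Ric)
  fix x k i j
  assume x: "x \<in> S"
  show "mderiv (hol (axis k 1)) Ric x $ i $ j = mderiv (hol (axis i 1)) Ric x $ k $ j"
    unfolding mderiv_def vec_lambda_beta cderiv_Ric[OF x]
    by (simp add: cderiv_commute[OF S smooth_logdet' x, of "hol (axis k 1)" "hol (axis i 1)"])
qed

text \<open>The evolution \<open>\<partial>\<^sub>t R\<^sub>i\<^sub>j = \<partial>\<^sub>i \<partial>\<^sub>j R\<close>, from \<open>\<partial>\<^sub>t log det G = n - R\<close>.\<close>

lemma tim_Ric:
  assumes x: "x \<in> S"
  shows "mderiv tim Ric x $ i $ j =
    cderiv (hol (axis i 1)) (cderiv (ant (axis j 1)) (\<lambda>y. trace (M y ** Ric y))) x"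
proof -
  have R: "smooth_on S (\<lambda>y. trace (M y ** Ric y))"
    by (intro smooth_on_trace[OF S] msmooth_on_mult[OF S] smooth_M smooth_Ric)
  have lt: "logdet' tim y = trace (mat 1 :: complex^'n^'n) - trace (M y ** Ric y)" if "y \<in> S" for y
    unfolding logdet'_def flow[OF that] matrix_diff_ldistrib trace_sub GM[OF that] ..
  have "mderiv tim Ric x $ i $ j = - cderiv (hol (axis i 1)) (cderiv tim (logdet' (ant (axis j 1)))) x"
    unfolding mderiv_def vec_lambda_beta cderiv_Ric[OF x] cderiv_commute[OF S smooth_logdet' x, of tim] ..
  also have "cderiv (hol (axis i 1)) (cderiv tim (logdet' (ant (axis j 1)))) x =
      cderiv (hol (axis i 1)) (\<lambda>y. - cderiv (ant (axis j 1)) (\<lambda>y. trace (M y ** Ric y)) y) x"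
  proof (rule cderiv_cong[OF S x])
    fix y assume y: "y \<in> S"
    have "cderiv tim (logdet' (ant (axis j 1))) y = cderiv (ant (axis j 1)) (logdet' tim) y"
      by (rule cderiv_logdet'_commute[OF y])
    also have "\<dots> = cderiv (ant (axis j 1)) (\<lambda>y. trace (mat 1 :: complex^'n^'n) - trace (M y ** Ric y)) y"
      by (rule cderiv_cong[OF S y lt])
    also have "\<dots> = - cderiv (ant (axis j 1)) (\<lambda>y. trace (M y ** Ric y)) y"
      using smooth_on_differentiable[OF S R y] by (simp add: cderiv_diff)
    finally show "cderiv tim (logdet' (ant (axis j 1))) y = - cderiv (ant (axis j 1)) (\<lambda>y. trace (M y ** Ric y)) y" .
  qed
  also have "\<dots> = - cderiv (hol (axis i 1)) (cderiv (ant (axis j 1)) (\<lambda>y. trace (M y ** Ric y))) x"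
    by (rule cderiv_minus) (rule smooth_on_differentiable[OF S smooth_on_cderiv[OF S R] x])
  finally show ?thesis by simp
qed

lemma hform_tim_Ric:
  assumes x: "x \<in> S"
  shows "hform (mderiv tim Ric x) v v = cderiv (hol v) (cderiv (ant v) (\<lambda>y. trace (M y ** Ric y))) x"
proof -
  have R: "smooth_on S (\<lambda>y. trace (M y ** Ric y))"
    by (intro smooth_on_trace[OF S] msmooth_on_mult[OF S] smooth_M smooth_Ric)
  show ?thesis
    unfolding cderiv_hol_ant_expand[OF S R x, of v v] hform_def tim_Ric[OF x] by (simp add: mult_ac)
qed

text \<open>By closedness \<open>P $ k $ i\<close> is
  \<open>- v\<^sup>p \<Gamma>\<^sup>i\<^sub>k\<^sub>p\<close>, so a holomorphic field with value
  \<open>v\<close> and derivative \<open>P\<close> is parallel at \<open>x\<close>. By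
  \<open>laplacian_affine_field\<close> the first trace is then the Laplacian of
  \<open>F(V, V)\<close>; the second contracts the curvature in direction \<open>v\<close> with
  \<open>F\<close>, indices raised.\<close>

lemma laplacian_trace:
  fixes v :: "complex^'n"
  assumes F: "closed_tensor S F" and x: "x \<in> S"
  defines "P \<equiv> - (mderiv (hol v) G x ** M x)"
  shows "cderiv (hol v) (cderiv (ant v) (\<lambda>y. trace (M y ** F y))) x =
    trace ((mderiv (hol v) (mderiv (ant v) F) x + P ** mderiv (ant v) F x + mderiv (hol v) F x ** ctrans P +
       P ** F x ** ctrans P) ** M x) +
    trace ((mderiv (hol v) G x ** M x ** mderiv (ant v) G x - mderiv (hol v) (mderiv (ant v) G) x) **
      (M x ** F x ** M x))"
proof -
  note sF = closed_smooth[OF S F]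
  note sm = msmooth_on_mult[OF S] msmooth_on_add[OF S] msmooth_on_minus[OF S] smooth_M sF smooth_dG
    msmooth_on_mderiv[OF S sF]
  have Q: "ctrans P = - (M x ** mderiv (ant v) G x)"
  proof -
    have "ctrans (- A) = - ctrans A" for A :: "complex^'n^'n"
      by (simp add: ctrans_def vec_eq_iff)
    then show ?thesis
      unfolding P_def ctrans_mult closed_cnj[OF S closed_G x]
      using hermitian_M[OF x] by (simp add: ctrans_mult hermitian_iff)
  qed
  let ?E = "\<lambda>y. - (M y ** mderiv (ant v) G y ** M y) ** F y + M y ** mderiv (ant v) F y"
  have sE: "msmooth_on S ?E" by (intro sm)
  have "cderiv (hol v) (cderiv (ant v) (\<lambda>y. trace (M y ** F y))) x = cderiv (hol v) (\<lambda>y. trace (?E y)) x"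
  proof (rule cderiv_cong[OF S x])
    fix y assume y: "y \<in> S"
    show "cderiv (ant v) (\<lambda>y. trace (M y ** F y)) y = trace (?E y)"
      by (simp add: cderiv_trace[OF S msmooth_on_mult[OF S smooth_M sF] y] mderiv_mult[OF S smooth_M sF y] mderiv_M[OF y])
  qed
  also have "\<dots> = trace (mderiv (hol v) ?E x)"
    by (rule cderiv_trace[OF S sE x])
  also have "mderiv (hol v) ?E x =
    (M x ** mderiv (hol v) G x ** M x ** mderiv (ant v) G x ** M x +
     M x ** mderiv (ant v) G x ** M x ** mderiv (hol v) G x ** M x -
     M x ** mderiv (hol v) (mderiv (ant v) G) x ** M x) ** F x -
    M x ** mderiv (hol v) G x ** M x ** mderiv (ant v) F x -
    M x ** mderiv (ant v) G x ** M x ** mderiv (hol v) F x +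
    M x ** mderiv (hol v) (mderiv (ant v) F) x"
  proof -
    have s1: "msmooth_on S (\<lambda>y. - (M y ** mderiv (ant v) G y ** M y) ** F y)"
      and s2: "msmooth_on S (\<lambda>y. M y ** mderiv (ant v) F y)"
      and s3: "msmooth_on S (\<lambda>y. - (M y ** mderiv (ant v) G y ** M y))"
      and s4: "msmooth_on S (\<lambda>y. M y ** mderiv (ant v) G y ** M y)"
      and s5: "msmooth_on S (\<lambda>y. M y ** mderiv (ant v) G y)"
      by (intro sm)+
    show ?thesis
      unfolding mderiv_add[OF S s1 s2 x] mderiv_mult[OF S s3 sF x] mderiv_minus[OF S s4 x]
        mderiv_mult[OF S s5 smooth_M x] mderiv_mult[OF S smooth_M smooth_dG x]
        mderiv_mult[OF S smooth_M msmooth_on_mderiv[OF S sF] x] mderiv_M[OF x]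
      by (simp add: matrix_add_ldistrib matrix_add_rdistrib matrix_diff_ldistrib matrix_diff_rdistrib
          matrix_minus_left matrix_minus_right matrix_mul_assoc)
  qed
  finally show ?thesis
    unfolding Q unfolding P_def trace_laplacian .
qed

text \<open>The tensor maximum principle at a null vector \<open>v\<close> of \<open>Ric - a G\<close>: \<open>v\<close> is extended to the
  holomorphic field \<open>V\<close> which is parallel at the point, and the curvature term is nonnegative
  since \<open>M (Ric - a G) M\<close> is a sum of squares of vectors orthogonal to \<open>v\<close>.\<close>

lemma tim_Ric_nonneg:
  fixes a :: real
  assumes x: "(z, t) \<in> S" and "r > 0"
    and nonneg: "\<And>y u. dist y z < r \<Longrightarrow> Re (hform (Ric (y, t) - a *\<^sub>R G (y, t)) u u) \<ge> 0"
    and null: "Re (hform (Ric (z, t) - a *\<^sub>R G (z, t)) v v) = 0"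
    and curv: "\<And>w. hform (G (z, t)) w v = 0 \<Longrightarrow>
      Re (\<Sum>p\<in>UNIV. \<Sum>q\<in>UNIV. \<Sum>i\<in>UNIV. \<Sum>j\<in>UNIV.
        Rm i j (z, t) $ p $ q * w $ p * cnj (w $ q) * v $ i * cnj (v $ j)) \<ge> 0"
  shows "Re (hform (mderiv tim Ric (z, t)) v v) \<ge> 0"
proof -
  let ?x = "(z, t)"
  define F where "F y = Ric y - a *\<^sub>R G y" for y
  have smG: "msmooth_on S (\<lambda>y. a *\<^sub>R G y)"
    using smooth_G unfolding msmooth_on_def by (auto simp: scaleR_conv_of_real intro!: smooth_on_mult smooth_on_const)
  have dG: "mderiv e (\<lambda>y. a *\<^sub>R G y) x = a *\<^sub>R mderiv e G x" if "x \<in> S" for e x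
    using msmooth_on_differentiable[OF S smooth_G that]
    by (simp add: mderiv_def vec_eq_iff scaleR_conv_of_real cderiv_cmult)
  have F: "closed_tensor S F"
    unfolding closed_tensor_def
  proof (intro conjI ballI allI)
    show "msmooth_on S F"
      unfolding F_def[abs_def] by (rule msmooth_on_diff[OF S smooth_Ric smG])
    fix x assume x: "x \<in> S"
    show "hermitian (F x)"
      by (simp add: F_def hermitian_def hermitian_cnj[OF hermitian_G[OF x]] hermitian_cnj[OF hermitian_Ric[OF x]])
    fix k i j
    show "mderiv (hol (axis k 1)) F x $ i $ j = mderiv (hol (axis i 1)) F x $ k $ j"
      unfolding F_def[abs_def] mderiv_diff[OF S smooth_Ric smG x] dG[OF x]
      using closed_hol[OF S closed_Ric x, of k i j] closed_hol[OF S closed_G x, of k i j] by simp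
  qed
  have hF: "hermitian (F ?x)" using F x by (simp add: closed_tensor_def)
  have Fnn: "Re (hform (F ?x) u u) \<ge> 0" for u
    using nonneg[of z u] \<open>r > 0\<close> by (simp add: F_def)
  have null_vec: "F ?x *v cnjv v = 0"
    using hform_null_vec[OF hF Fnn] null by (simp add: F_def)
  define P where "P = - (mderiv (hol v) G ?x ** M ?x)"
  define H where "H = mderiv (hol v) (mderiv (ant v) F) ?x + P ** mderiv (ant v) F ?x +
    mderiv (hol v) F ?x ** ctrans P + P ** F ?x ** ctrans P"
  define C where "C = mderiv (hol v) G ?x ** M ?x ** mderiv (ant v) G ?x - mderiv (hol v) (mderiv (ant v) G) ?x"
  have "hform (mderiv tim Ric ?x) v v = cderiv (hol v) (cderiv (ant v) (\<lambda>y. trace (M y ** Ric y))) ?x"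
    by (rule hform_tim_Ric[OF x])
  \<comment> \<open>Subtracting \<open>a *\<^sub>R G\<close> changes the trace only by the constant
    \<open>a\<close> times the dimension, so \<open>Ric\<close> may be replaced by
    \<open>F\<close>.\<close>
  also have "\<dots> = cderiv (hol v) (cderiv (ant v) (\<lambda>y. trace (M y ** F y))) ?x"
  proof (rule cderiv_cong[OF S x])
    fix y assume y: "y \<in> S"
    have sMF: "msmooth_on S (\<lambda>y. M y ** F y)"
      by (rule msmooth_on_mult[OF S smooth_M closed_smooth[OF S F]])
    have "cderiv (ant v) (\<lambda>y. trace (M y ** Ric y)) y =
        cderiv (ant v) (\<lambda>y. trace (M y ** F y) + a *\<^sub>R trace (mat 1 :: complex^'n^'n)) y"
    proof (rule cderiv_cong[OF S y])
      fix y assume y: "y \<in> S"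
      have "M y ** (a *\<^sub>R G y) = a *\<^sub>R (M y ** G y)"
        by (simp add: matrix_matrix_mult_def vec_eq_iff scaleR_sum_right)
      then have "trace (M y ** Ric y) = trace (M y ** F y + a *\<^sub>R mat 1)"
        by (simp add: F_def matrix_diff_ldistrib GM[OF y])
      then show "trace (M y ** Ric y) = trace (M y ** F y) + a *\<^sub>R trace (mat 1 :: complex^'n^'n)"
        by (simp add: trace_def sum.distrib scaleR_sum_right)
    qed
    also have "\<dots> = cderiv (ant v) (\<lambda>y. trace (M y ** F y)) y"
      using smooth_on_differentiable[OF S smooth_on_trace[OF S sMF] y] by (simp add: cderiv_add)
    finally show "cderiv (ant v) (\<lambda>y. trace (M y ** Ric y)) y = cderiv (ant v) (\<lambda>y. trace (M y ** F y)) y" .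
  qed
  also have "\<dots> = trace (H ** M ?x) + trace (C ** (M ?x ** F ?x ** M ?x))"
    unfolding H_def C_def P_def by (rule laplacian_trace[OF F x])
  finally have eq: "hform (mderiv tim Ric ?x) v v = trace (H ** M ?x) + trace (C ** (M ?x ** F ?x ** M ?x))" .
  \<comment> \<open>Here \<open>M\<close> is the semidefinite factor and \<open>y = 0\<close>
    imposes no condition on \<open>w\<close>. The form of \<open>H\<close> is nonnegative because
    \<open>H\<close> is the complex Hessian of \<open>F(V, V)\<close>, which has a spatial minimum
    with value 0.\<close>
  have "Re (trace (H ** M ?x)) \<ge> 0"
  proof (rule trace_mult_nonneg[OF hermitian_M[OF x] M_nonneg[OF x], where y = 0])
    show "M ?x *v 0 = 0" by simp
    fix w :: "complex^'n"
    define V where "V y = (\<chi> i. v $ i + (\<Sum>k\<in>UNIV. P $ k $ i * (fst y $ k - fst ?x $ k)))" for y :: "(complex^'n) \<times> real"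
    let ?f = "\<lambda>y. hform (F y) (V y) (V y)"
    note lap = laplacian_affine_field[OF S F x, where v = v and P = P, folded V_def H_def]
    have "hform H w w = (\<Sum>k\<in>UNIV. \<Sum>l\<in>UNIV. w $ k * cnj (w $ l) * H $ k $ l)"
      by (simp add: hform_def mult_ac)
    also have "\<dots> = cderiv (hol w) (cderiv (ant w) ?f) ?x"
      unfolding cderiv_hol_ant_expand[OF S lap(1) x, of w w] lap(2) ..
    also have "Re \<dots> \<ge> 0"
    proof (rule laplacian_nonneg[OF S lap(1) x \<open>r > 0\<close>])
      fix y assume "dist y z < r"
      have "V ?x = v" by (simp add: V_def vec_eq_iff)
      then show "Re (?f ?x) \<le> Re (?f (y, t))"
        using null nonneg[OF \<open>dist y z < r\<close>] by (simp add: F_def)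
    qed
    finally show "Re (hform H w w) \<ge> 0" .
  qed
  \<comment> \<open>\<open>M F M\<close> annihilates \<open>G *v cnjv v\<close> because
    \<open>F\<close> annihilates \<open>cnjv v\<close>. With this \<open>y\<close> the condition on
    \<open>w\<close> is exactly orthogonality to \<open>v\<close> for the metric.\<close>
  moreover have "Re (trace (C ** (M ?x ** F ?x ** M ?x))) \<ge> 0"
  proof (rule trace_mult_nonneg[where y = "G ?x *v cnjv v"])
    show "hermitian (M ?x ** F ?x ** M ?x)"
      by (rule hermitian_congruence[OF hermitian_M[OF x] hF])
    show "Re (hform (M ?x ** F ?x ** M ?x) u u) \<ge> 0" for u
      unfolding hform_congruence[OF hermitian_M[OF x]] by (rule Fnn)
    show "M ?x ** F ?x ** M ?x *v (G ?x *v cnjv v) = 0"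
      by (simp add: matrix_vector_mul_assoc matrix_mul_assoc[symmetric] GM[OF x])
        (simp add: matrix_vector_mul_assoc[symmetric] null_vec)
    fix w :: "complex^'n"
    assume w: "(\<Sum>p\<in>UNIV. w $ p * (G ?x *v cnjv v) $ p) = 0"
    \<comment> \<open>\<open>C\<close> is the curvature contracted with \<open>v\<close> and its
      conjugate, so its form at \<open>w\<close> is the bisectional curvature of \<open>w\<close>
      and \<open>v\<close>.\<close>
    have C: "C $ p $ q = (\<Sum>i\<in>UNIV. \<Sum>j\<in>UNIV. Rm i j ?x $ p $ q * v $ i * cnj (v $ j))" for p q
    proof -
      note d = msmooth_on_differentiable[OF S smooth_G x]
      have h: "mderiv (hol v) G ?x $ p $ s = (\<Sum>i\<in>UNIV. v $ i * mderiv (hol (axis i 1)) G ?x $ p $ s)" for s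
        unfolding mderiv_def vec_lambda_beta by (rule cderiv_hol_expand(1)[OF d])
      have a: "mderiv (ant v) G ?x $ s $ q = (\<Sum>j\<in>UNIV. cnj (v $ j) * mderiv (ant (axis j 1)) G ?x $ s $ q)" for s
        unfolding mderiv_def vec_lambda_beta by (rule cderiv_hol_expand(2)[OF d])
      have ha: "mderiv (hol v) (mderiv (ant v) G) ?x $ p $ q = (\<Sum>i\<in>UNIV. \<Sum>j\<in>UNIV. v $ i * cnj (v $ j) *
          mderiv (hol (axis i 1)) (mderiv (ant (axis j 1)) G) ?x $ p $ q)"
        unfolding mderiv_def vec_lambda_beta
        by (rule cderiv_hol_ant_expand[OF S smooth_on_nth[OF S smooth_G] x])
      have "(mderiv (hol v) G ?x ** (M ?x ** mderiv (ant v) G ?x)) $ p $ q =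
        (\<Sum>i\<in>UNIV. v $ i * ((mderiv (hol (axis i 1)) G ?x ** M ?x) ** mderiv (ant v) G ?x) $ p $ q)"
        unfolding matrix_mul_assoc[symmetric] by (rule matrix_mult_expand_left[OF h])
      also have "\<dots> = (\<Sum>i\<in>UNIV. v $ i * (\<Sum>j\<in>UNIV. cnj (v $ j) *
          ((mderiv (hol (axis i 1)) G ?x ** M ?x) ** mderiv (ant (axis j 1)) G ?x) $ p $ q))"
        unfolding matrix_mult_expand_right[OF a] ..
      finally show ?thesis
        unfolding C_def vector_minus_component ha Rm_def
        by (simp add: matrix_mul_assoc sum_distrib_left sum_subtractf algebra_simps)
    qed
    have "hform (G ?x) w v = 0"
      using w by (simp add: hform_mult_vec)
    then have "0 \<le> Re (\<Sum>p\<in>UNIV. \<Sum>q\<in>UNIV. \<Sum>i\<in>UNIV. \<Sum>j\<in>UNIV.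
        Rm i j (z, t) $ p $ q * w $ p * cnj (w $ q) * v $ i * cnj (v $ j))"
      by (rule curv)
    also have "(\<Sum>p\<in>UNIV. \<Sum>q\<in>UNIV. \<Sum>i\<in>UNIV. \<Sum>j\<in>UNIV.
        Rm i j (z, t) $ p $ q * w $ p * cnj (w $ q) * v $ i * cnj (v $ j)) = hform C w w"
      unfolding hform_def C sum_distrib_right by (intro sum.cong refl) (simp only: mult_ac)
    finally show "Re (hform C w w) \<ge> 0" .
  qed
  ultimately show ?thesis by (simp add: eq)
qed

end

section \<open>Kaehler metrics in a chart\<close>

lemma open_chart_image: "complex_manifold X A \<Longrightarrow> c \<in> A \<Longrightarrow> open (chart_image c)"
  by (auto simp: complex_manifold_def)

lemma smooth_on_entry:
  fixes f :: "'a::real_normed_vector \<Rightarrow> complex^'n::finite^'n"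
  shows "smooth_on S f \<Longrightarrow> smooth_on S (\<lambda>x. f x $ i $ j)"
  by (rule smooth_on_compose_linear[OF bounded_linear_compose[OF bounded_linear_vec_nth bounded_linear_vec_nth]])

lemma kaehler_metricD:
  assumes "kaehler_metric A h" "c \<in> A"
  shows "smooth_on (chart_image c) (h c)"
    and "z \<in> chart_image c \<Longrightarrow> hermitian (h c z)"
    and "z \<in> chart_image c \<Longrightarrow> u \<noteq> 0 \<Longrightarrow> Re (hform (h c z) u u) > 0"
  using assms unfolding kaehler_metric_def hermitian_metric_def hermitian_def by blast+

text \<open>The equations \<open>\<partial>\<^sub>k g\<^sub>i\<^sub>j = \<partial>\<^sub>i g\<^sub>k\<^sub>j\<close> are combinations of the closedness equations for the real vectors
  \<open>(u, v, w)\<close>, \<open>(i u, i v, w)\<close>, \<open>(i u, v, w)\<close>, \<open>(u, i v, w)\<close>, where \<open>u, v, w\<close> are coordinate vectors.\<close>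

lemma kaehler_closed:
  fixes h :: "('m, 'n::finite) tensor11"
  assumes h: "kaehler_metric A h" and c: "c \<in> A" and U: "open (chart_image c)" and z: "z \<in> chart_image c"
  shows "dz k (\<lambda>y. h c y $ i $ j) z = dz i (\<lambda>y. h c y $ k $ j) z"
proof -
  let ?U = "chart_image c"
  define D where "D u v w = frechet_derivative (\<lambda>y. hform (h c y) v w) (at z) u" for u v w
  have s: "smooth_on ?U (\<lambda>y. hform (h c y) v w)" for v w
    unfolding hform_def
    by (intro smooth_on_sum smooth_on_mult smooth_on_const smooth_on_entry kaehler_metricD[OF h c])
  note d = smooth_on_differentiable[OF U s z]
  have scale_left: "D u (\<i> *s v) w = \<i> * D u v w" for u v w
    unfolding D_def hform_scale
    by (rule frechet_derivative_bounded_linear[OF bounded_linear_mult_right d])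
  have scale_right: "D u v (\<i> *s w) = - \<i> * D u v w" for u v w
    unfolding D_def hform_scale complex_cnj_i
    by (rule frechet_derivative_bounded_linear[OF bounded_linear_mult_right d])
  have cnj: "D u w v = cnj (D u v w)" for u v w
  proof -
    have "D u w v = frechet_derivative (\<lambda>y. cnj (hform (h c y) v w)) (at z) u"
      unfolding D_def
      by (subst frechet_derivative_cong_open[OF U z hform_commute[OF kaehler_metricD(2)[OF h c]]]) auto
    then show ?thesis
      unfolding D_def by (simp add: frechet_derivative_bounded_linear[OF bounded_linear_cnj d])
  qed
  have assoc: "frechet_derivative (\<lambda>y. assoc_form h c y v w) (at z) u = -2 * Im (D u v w)" for u v w
  proof -
    have "assoc_form h c y v w = -2 * Im (hform (h c y) v w)" if y: "y \<in> ?U" for y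
    proof -
      have "assoc_form h c y v w = Re (\<i> * (hform (h c y) v w - hform (h c y) w v))"
        by (simp add: assoc_form_def hform_def sum_subtractf algebra_simps)
      also have "hform (h c y) w v = cnj (hform (h c y) v w)"
        by (rule hform_commute[OF kaehler_metricD(2)[OF h c y]])
      finally show ?thesis by simp
    qed
    then have "frechet_derivative (\<lambda>y. assoc_form h c y v w) (at z) =
        frechet_derivative (\<lambda>y. -2 * Im (hform (h c y) v w)) (at z)"
      by (rule frechet_derivative_cong_open[OF U z])
    then show ?thesis
      unfolding D_def
      using frechet_derivative_bounded_linear[OF bounded_linear_compose[OF bounded_linear_mult_right bounded_linear_Im] d, of "-2" v w u]
      by simp
  qed
  have E: "Im (D u v w) - Im (D v u w) + Im (D w u v) = 0" for u v w
  proof -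
    have "-2 * Im (D u v w) + -2 * Im (D v w u) + -2 * Im (D w u v) = 0"
      using h c z unfolding kaehler_metric_def closed_form2_def assoc[symmetric] by blast
    then show ?thesis using cnj[of v w u] by simp
  qed
  have T: "D u v w - \<i> * D (\<i> *s u) v w = D v u w - \<i> * D (\<i> *s v) u w" for u v w
    using E[of u v w] E[of "\<i> *s u" "\<i> *s v" w] E[of "\<i> *s u" v w] E[of u "\<i> *s v" w]
    by (simp add: scale_left scale_right complex_eq_iff)
  have entry: "(\<lambda>y. h c y $ i $ j) = (\<lambda>y. hform (h c y) (axis i 1) (axis j 1))" for i j
    by (simp add: hform_axis_axis)
  show ?thesis
    unfolding dz_def entry axis_ii D_def[symmetric] T[of "axis k 1"] ..
qed

lemma bounded_linear_hform: "bounded_linear (\<lambda>H :: complex^'n::finite^'n. hform H u v)"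
  unfolding hform_def
  by (intro bounded_linear_sum bounded_linear_mult_const
      bounded_linear_compose[OF bounded_linear_vec_nth bounded_linear_vec_nth])

lemma has_vector_derivative_hform:
  "(H has_vector_derivative H') F \<Longrightarrow> ((\<lambda>s. hform (H s) u v) has_vector_derivative hform H' u v) F"
  by (rule bounded_linear.has_vector_derivative[OF bounded_linear_hform])

lemma hform_zero: "hform H u 0 = 0" "hform H 0 u = 0"
  by (simp_all add: hform_def)


section \<open>The Kaehler Ricci flow in a chart\<close>

locale krf =
  fixes X :: "'m topology" and A :: "('m, 'n::finite) chart set" and g :: "real \<Rightarrow> ('m, 'n) tensor11"
  assumes manifold: "complex_manifold X A" and krf: "kaehler_ricci_flow A g"
begin

lemma kaehler: "t \<ge> 0 \<Longrightarrow> kaehler_metric A (g t)"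
  using krf by (simp add: kaehler_ricci_flow_def)

lemma smooth_g: "c \<in> A \<Longrightarrow> smooth_on (chart_image c \<times> {0..}) (\<lambda>x. g (snd x) c (fst x))"
  using krf by (simp add: kaehler_ricci_flow_def case_prod_unfold)

lemma flow_eq:
  "c \<in> A \<Longrightarrow> z \<in> chart_image c \<Longrightarrow> t \<ge> 0 \<Longrightarrow>
    ((\<lambda>s. g s c z) has_vector_derivative (g t c z - ric (g t) c z)) (at t within {0..})"
  using krf by (simp add: kaehler_ricci_flow_def)

lemma within_nontrivial:
  fixes t :: real
  assumes "t \<ge> 0"
  shows "at t within {0..} \<noteq> bot"
proof
  assume "at t within {0..} = bot"
  moreover have "at_right t \<le> at t within {0..}"
    using assms by (intro at_le) auto
  ultimately show False
    using trivial_limit_at_right_real[of t] by (simp add: bot_unique)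
qed

text \<open>At \<open>t = 0\<close> the time derivative is one-sided but still unique, so the flow
  equation determines the Ricci tensor up to the initial time.\<close>

lemma g_derivative_unique:
  assumes "c \<in> A" "z \<in> chart_image c" "t \<ge> 0"
    and "((\<lambda>s. g s c z) has_vector_derivative h) (at t within {0..})"
  shows "ric (g t) c z = g t c z - h"
  using vector_derivative_unique_within[OF within_nontrivial[OF assms(3)] flow_eq[OF assms(1-3)] assms(4)]
  by (simp add: algebra_simps)

text \<open>The flow expresses \<open>ric\<close> by \<open>g\<close> and its time derivative, and
  the derivative in direction \<open>(0, 1)\<close> supplied by \<open>Ck_on\<close> is continuous
  up to \<open>t = 0\<close>. The curvature formula need not be examined at the boundary of
  space-time.\<close>

lemma ric_continuous:
  assumes c: "c \<in> A"
  shows "continuous_on (chart_image c \<times> {0..}) (\<lambda>x. ric (g (snd x)) c (fst x))"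
proof -
  let ?S = "chart_image c \<times> {0::real..}"
  have "Ck_on (Suc 0) ?S (\<lambda>x. g (snd x) c (fst x))"
    using smooth_g[OF c] unfolding smooth_on_def by blast
  then obtain f' where f': "\<And>x. x \<in> ?S \<Longrightarrow> ((\<lambda>x. g (snd x) c (fst x)) has_derivative f' x) (at x within ?S)"
    and cont: "continuous_on ?S (\<lambda>x. f' x (0, 1))"
    unfolding Ck_on.simps by blast
  have "ric (g (snd x)) c (fst x) = g (snd x) c (fst x) - f' x (0, 1)" if x: "x \<in> ?S" for x
  proof (rule g_derivative_unique[OF c])
    obtain z t where zt: "x = (z, t)" "z \<in> chart_image c" "t \<ge> 0" using x by auto
    have "((\<lambda>s. (z, s)) has_derivative (\<lambda>u. (0, u))) (at t within {0..})"
      by (auto intro!: derivative_eq_intros)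
    moreover have "((\<lambda>x. g (snd x) c (fst x)) has_derivative f' x) (at (z, t) within (\<lambda>s. (z, s)) ` {0..})"
      using f'[OF x] zt by (auto intro: has_derivative_subset)
    ultimately have "((\<lambda>s. g (snd (z, s)) c (fst (z, s))) has_derivative (\<lambda>u. f' x (0, u))) (at t within {0..})"
      by (rule has_derivative_in_compose)
    moreover have "(\<lambda>u. f' x (0, u)) = (\<lambda>u. u *\<^sub>R f' x (0, 1))"
    proof
      show "f' x (0, u) = u *\<^sub>R f' x (0, 1)" for u
        using linear_cmul[OF has_derivative_linear[OF f'[OF x]], of u "(0, 1)"] by simp
    qed
    ultimately have "((\<lambda>s. g s c z) has_vector_derivative f' x (0, 1)) (at t within {0..})"
      by (simp only: has_vector_derivative_def fst_conv snd_conv)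
    then show "((\<lambda>s. g s c (fst x)) has_vector_derivative f' x (0, 1)) (at (snd x) within {0..})"
      using zt by simp
  qed (use x in auto)
  then show ?thesis
    using cont smooth_on_imp_continuous_on[OF smooth_g[OF c]]
    by (simp add: continuous_on_diff cong: continuous_on_cong)
qed

text \<open>The Ricci tensor is a tensor because the flow equation expresses it by the metrics.\<close>

lemma ric_transition:
  assumes "c \<in> A" "d \<in> A" "z \<in> overlap c d" "t \<ge> 0"
  defines "y \<equiv> transition c d z"
  assumes y: "y \<in> chart_image d"
  shows "hform (ric (g t) c z) u v = hform (ric (g t) d y) (transition_deriv c d z u) (transition_deriv c d z v)"
    and "hform (g t c z) u v = hform (g t d y) (transition_deriv c d z u) (transition_deriv c d z v)"
proof -
  let ?u = "transition_deriv c d z u" and ?v = "transition_deriv c d z v"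
  have z: "z \<in> chart_image c"
    using assms(3) by (auto simp: overlap_def chart_image_def)
  have g: "hform (g s c z) u v = hform (g s d y) ?u ?v" if "s \<ge> 0" for s
    using kaehler[OF that] assms(1-3) unfolding kaehler_metric_def hermitian_metric_def y_def by blast
  show "hform (g t c z) u v = hform (g t d y) ?u ?v"
    by (rule g[OF assms(4)])
  have "((\<lambda>s. hform (g s d y) ?u ?v) has_vector_derivative hform (g t d y - ric (g t) d y) ?u ?v) (at t within {0..})"
    by (rule has_vector_derivative_hform[OF flow_eq[OF assms(2) y assms(4)]])
  then have "((\<lambda>s. hform (g s c z) u v) has_vector_derivative hform (g t d y - ric (g t) d y) ?u ?v) (at t within {0..})"
    by (rule has_vector_derivative_transform[rotated 2]) (use assms(4) g in auto)
  from vector_derivative_unique_within[OF within_nontrivial[OF assms(4)] this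
      has_vector_derivative_hform[OF flow_eq[OF assms(1) z assms(4)]]]
  show "hform (ric (g t) c z) u v = hform (ric (g t) d y) ?u ?v"
    using g[OF assms(4)] by (simp add: hform_diff_matrix)
qed

context
  fixes c assumes c: "c \<in> A"
begin

lemma smooth_g_interior: "smooth_on (chart_image c \<times> {0<..}) (\<lambda>x. g (snd x) c (fst x))"
  by (rule smooth_on_subset[OF smooth_g[OF c]]) auto

text \<open>Restricted to positive times, where the domain is open and Frechet derivatives in
  space-time are available.\<close>

lemma metric_chart: "metric_chart (chart_image c \<times> {0<..}) (\<lambda>x. g (snd x) c (fst x))"
proof
  show S: "open (chart_image c \<times> {0::real<..})"
    by (intro open_Times open_chart_image[OF manifold c]) auto
  show "Re (hform (g (snd x) c (fst x)) u u) > 0" if "x \<in> chart_image c \<times> {0<..}" "u \<noteq> 0" for x u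
    using that kaehler_metricD(3)[OF kaehler c, of "snd x" "fst x" u] by auto
  show "closed_tensor (chart_image c \<times> {0<..}) (\<lambda>x. g (snd x) c (fst x))"
    unfolding closed_tensor_def
  proof (intro conjI ballI allI)
    show sm: "msmooth_on (chart_image c \<times> {0<..}) (\<lambda>x. g (snd x) c (fst x))"
      unfolding msmooth_on_def by (intro allI smooth_on_entry smooth_g_interior)
    fix x assume x: "x \<in> chart_image c \<times> {0::real<..}"
    show "hermitian (g (snd x) c (fst x))"
      using x kaehler_metricD(2)[OF kaehler c, of "snd x" "fst x"] by auto
    fix k i j
    note d = msmooth_on_differentiable[OF S sm]
    obtain z t where zt: "x = (z, t)" "z \<in> chart_image c" "t > 0" using x by auto
    have "cderiv (hol (axis k 1)) (\<lambda>x. g (snd x) c (fst x) $ i $ j) (z, t) =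
        cderiv (hol (axis i 1)) (\<lambda>x. g (snd x) c (fst x) $ k $ j) (z, t)"
      using dz_slice(1)[OF d, of z t k i j] dz_slice(1)[OF d, of z t i k j] zt
        kaehler_closed[OF kaehler c open_chart_image[OF manifold c] zt(2), of t k i j]
      by simp
    then show "mderiv (hol (axis k 1)) (\<lambda>x. g (snd x) c (fst x)) x $ i $ j =
        mderiv (hol (axis i 1)) (\<lambda>x. g (snd x) c (fst x)) x $ k $ j"
      by (simp add: mderiv_def zt(1))
  qed
qed

interpretation metric_chart "chart_image c \<times> {0<..}" "\<lambda>x. g (snd x) c (fst x)"
  by (rule metric_chart)

text \<open>The derivative indices \<open>k\<close>, \<open>l\<close> are the parameters of
  \<open>Rm\<close>, and \<open>i\<close>, \<open>j\<close> are the matrix entries.\<close>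

lemma curv_eq_Rm:
  assumes "z \<in> chart_image c" "t > 0"
  shows "curv (g t) c z i j k l = Rm k l (z, t) $ i $ j"
proof -
  note sm = smooth_on_nth[OF S smooth_G]
  note d = msmooth_on_differentiable[OF S smooth_G]
  have x: "(z, t) \<in> chart_image c \<times> {0<..}" using assms by simp
  have dz: "dz k (\<lambda>y. g t c y $ i $ q) z = mderiv (hol (axis k 1)) (\<lambda>x. g (snd x) c (fst x)) (z, t) $ i $ q" for i q k
    using dz_slice(1)[OF d[OF x], of k i q] by (simp add: mderiv_def)
  have dzbar: "dzbar l (\<lambda>y. g t c y $ p $ j) y = cderiv (ant (axis l 1)) (\<lambda>x. g (snd x) c (fst x) $ p $ j) (y, t)"
    if "y \<in> chart_image c" for l p j y
    using dz_slice(2)[OF d, of y t l p j] that assms(2) by simp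
  have "dz k (dzbar l (\<lambda>y. g t c y $ i $ j)) z =
      dz k (\<lambda>y. cderiv (ant (axis l 1)) (\<lambda>x. g (snd x) c (fst x) $ i $ j) (y, t)) z"
    using frechet_derivative_cong_open[OF open_chart_image[OF manifold c] assms(1) dzbar]
    by (simp add: dz_def)
  also have "\<dots> = cderiv (hol (axis k 1)) (cderiv (ant (axis l 1)) (\<lambda>x. g (snd x) c (fst x) $ i $ j)) (z, t)"
    by (rule dz_slice(1)) (rule smooth_on_differentiable[OF S smooth_on_cderiv[OF S sm] x])
  finally have 2: "dz k (dzbar l (\<lambda>y. g t c y $ i $ j)) z =
      mderiv (hol (axis k 1)) (mderiv (ant (axis l 1)) (\<lambda>x. g (snd x) c (fst x))) (z, t) $ i $ j"
    by (simp add: mderiv_def)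
  have "(\<Sum>p\<in>UNIV. \<Sum>q\<in>UNIV. ginv (g t) c z p q * dz k (\<lambda>y. g t c y $ i $ q) z * dzbar l (\<lambda>y. g t c y $ p $ j) z) =
    (mderiv (hol (axis k 1)) (\<lambda>x. g (snd x) c (fst x)) (z, t) ** M (z, t) **
      mderiv (ant (axis l 1)) (\<lambda>x. g (snd x) c (fst x)) (z, t)) $ i $ j"
    unfolding dz dzbar[OF assms(1)]
    by (simp add: matrix_matrix_mult_def ginv_def M_def mderiv_def sum_distrib_left sum_distrib_right mult_ac)
  then show ?thesis
    unfolding curv_def 2 Rm_def by simp
qed

lemma ric_eq_Ric:
  assumes "z \<in> chart_image c" "t > 0"
  shows "ric (g t) c z = Ric (z, t)"
  unfolding ric_def Ric_def curv_eq_Rm[OF assms] by (simp add: ginv_def M_def)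

lemma flow_chart: "flow_chart (chart_image c \<times> {0<..}) (\<lambda>x. g (snd x) c (fst x))"
proof
  fix x assume "x \<in> chart_image c \<times> {0::real<..}"
  then obtain z t where x: "x = (z, t)" and z: "z \<in> chart_image c" and t: "t > 0" by auto
  have "((\<lambda>s. g s c z) has_vector_derivative (g t c z - ric (g t) c z)) (at t within {0..})"
    using flow_eq[OF c z] t by simp
  then have D: "((\<lambda>s. g s c z) has_vector_derivative (g t c z - ric (g t) c z)) (at t)"
    using at_within_interior[of t "{0..}"] t by simp
  have "cderiv tim (\<lambda>x. g (snd x) c (fst x) $ i $ j) (z, t) = (g t c z - ric (g t) c z) $ i $ j" for i j
  proof (rule vector_derivative_unique_at)
    show "((\<lambda>s. g s c z $ i $ j) has_vector_derivative (g t c z - ric (g t) c z) $ i $ j) (at t)"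
      by (rule bounded_linear.has_vector_derivative[OF bounded_linear_compose[OF bounded_linear_vec_nth bounded_linear_vec_nth] D])
    show "((\<lambda>s. g s c z $ i $ j) has_vector_derivative cderiv tim (\<lambda>x. g (snd x) c (fst x) $ i $ j) (z, t)) (at t)"
      using has_vector_derivative_tim[OF msmooth_on_differentiable[OF S smooth_G], of z t i j] z t by simp
  qed
  then show "mderiv tim (\<lambda>x. g (snd x) c (fst x)) x = g (snd x) c (fst x) - Ric x"
    by (simp add: mderiv_def vec_eq_iff x ric_eq_Ric[OF z t])
qed

text \<open>The form of \<open>tim_Ric_nonneg\<close> used at the first contact: \<open>a\<close> is
  the value of the moving bound at the time \<open>t\<close>, and \<open>v\<close> is a fixed
  coordinate vector.\<close>

lemma ric_derivative_nonneg:
  fixes a :: real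
  assumes pob: "positive_orthogonal_bisectional A (g t)" and z: "z \<in> chart_image c" and t: "t > 0"
    and "v \<noteq> 0"
    and nonneg: "\<And>y u. y \<in> chart_image c \<Longrightarrow> Re (hform (ric (g t) c y) u u) \<ge> a * Re (hform (g t c y) u u)"
    and null: "Re (hform (ric (g t) c z) v v) = a * Re (hform (g t c z) v v)"
  obtains D where "((\<lambda>s. Re (hform (ric (g s) c z) v v)) has_real_derivative D) (at t)" "D \<ge> 0"
proof -
  interpret flow_chart "chart_image c \<times> {0<..}" "\<lambda>x. g (snd x) c (fst x)"
    by (rule flow_chart)
  have x: "(z, t) \<in> chart_image c \<times> {0<..}" using z t by simp
  obtain r where r: "r > 0" "ball z r \<subseteq> chart_image c"
    using open_chart_image[OF manifold c] z open_contains_ball by blast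
  have hf: "Re (hform (Ric (y, t) - a *\<^sub>R g (snd (y, t)) c (fst (y, t))) u u) =
      Re (hform (ric (g t) c y) u u) - a * Re (hform (g t c y) u u)" if "y \<in> chart_image c" for y u
    by (simp add: hform_diff_matrix hform_smult_matrix ric_eq_Ric[OF that t])
  have "Re (hform (mderiv tim Ric (z, t)) v v) \<ge> 0"
  proof (rule tim_Ric_nonneg[OF x r(1)])
    show "Re (hform (Ric (y, t) - a *\<^sub>R g (snd (y, t)) c (fst (y, t))) u u) \<ge> 0" if "dist y z < r" for y u
    proof -
      have "y \<in> chart_image c" using r(2) that by (auto simp: dist_commute subset_eq)
      then show ?thesis using nonneg hf by simp
    qed
    show "Re (hform (Ric (z, t) - a *\<^sub>R g (snd (z, t)) c (fst (z, t))) v v) = 0"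
      using hf[OF z] null by simp
    fix w assume w: "hform (g (snd (z, t)) c (fst (z, t))) w v = 0"
    \<comment> \<open>The hypothesis concerns nonzero vectors only; \<open>w = 0\<close> contributes
      zero.\<close>
    have "Re (bisectional (g t) c z w v) \<ge> 0"
    proof (cases "w = 0")
      case True
      then show ?thesis by (simp add: bisectional_def)
    next
      case False
      then show ?thesis
        using pob c z \<open>v \<noteq> 0\<close> w unfolding positive_orthogonal_bisectional_def by (auto intro: less_imp_le)
    qed
    then show "0 \<le> Re (\<Sum>p\<in>UNIV. \<Sum>q\<in>UNIV. \<Sum>i\<in>UNIV. \<Sum>j\<in>UNIV.
        Rm i j (z, t) $ p $ q * w $ p * cnj (w $ q) * v $ i * cnj (v $ j))"
      unfolding bisectional_def curv_eq_Rm[OF z t] .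
  qed
  moreover have "((\<lambda>s. Re (hform (ric (g s) c z) v v)) has_real_derivative Re (hform (mderiv tim Ric (z, t)) v v)) (at t)"
  proof -
    have "((\<lambda>s. Ric (z, s) $ i $ j) has_vector_derivative mderiv tim Ric (z, t) $ i $ j) (at t)" for i j
      using has_vector_derivative_tim[OF msmooth_on_differentiable[OF S smooth_Ric x], of i j]
      by (simp add: mderiv_def)
    then have "((\<lambda>s. hform (Ric (z, s)) v v) has_vector_derivative hform (mderiv tim Ric (z, t)) v v) (at t)"
      unfolding hform_def
      by (intro has_vector_derivative_sum bounded_linear.has_vector_derivative[OF bounded_linear_mult_left])
    then have "((\<lambda>s. Re (hform (Ric (z, s)) v v)) has_vector_derivative Re (hform (mderiv tim Ric (z, t)) v v)) (at t)"
      by (rule bounded_linear.has_vector_derivative[OF bounded_linear_Re])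
    then have "((\<lambda>s. Re (hform (ric (g s) c z) v v)) has_vector_derivative Re (hform (mderiv tim Ric (z, t)) v v)) (at t)"
      by (rule has_vector_derivative_transform_within_open[where S = "{0<..}"]) (use t ric_eq_Ric[OF z] in auto)
    then show ?thesis by (simp add: has_real_derivative_iff_has_vector_derivative)
  qed
  ultimately show ?thesis using that by blast
qed

end

end

section \<open>The maximum principle on the compact manifold\<close>

text \<open>Chart images are merely open, so minima need not exist there. Preimages of open
  coordinate balls cover the manifold, finitely many suffice, and the closed balls are the compact
  pieces.\<close>

lemma compact_chart_cover:
  fixes X :: "'m topology" and A :: "('m, 'n::finite) chart set"
  assumes X: "complex_manifold X A" "compact_space X"
  obtains F where "finite F" "\<And>c K. (c, K) \<in> F \<Longrightarrow> c \<in> A \<and> compact K \<and> K \<subseteq> chart_image c"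
    "\<And>x. x \<in> topspace X \<Longrightarrow> \<exists>(c, K)\<in>F. x \<in> fst c \<and> snd c x \<in> K"
proof -
  have "\<exists>c K W. c \<in> A \<and> compact K \<and> K \<subseteq> chart_image c \<and> openin X W \<and> x \<in> W \<and>
      (\<forall>y\<in>W. y \<in> fst c \<and> snd c y \<in> K)" if x: "x \<in> topspace X" for x
  proof -
    have "topspace X = (\<Union>c\<in>A. fst c)" using X(1) by (simp add: complex_manifold_def)
    then obtain c where c: "c \<in> A" "x \<in> fst c" using x by auto
    have o: "openin X (fst c)" "open (chart_image c)"
      and hom: "homeomorphic_map (subtopology X (fst c)) (top_of_set (chart_image c)) (snd c)"
      using X(1) c(1) unfolding complex_manifold_def by auto
    have "snd c x \<in> chart_image c" using c(2) by (simp add: chart_image_def)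
    then obtain r where r: "r > 0" "cball (snd c x) r \<subseteq> chart_image c"
      using o(2) open_contains_cball by blast
    define W where "W = {y \<in> topspace (subtopology X (fst c)). snd c y \<in> chart_image c \<inter> ball (snd c x) r}"
    have "openin (subtopology X (fst c)) W"
      unfolding W_def using homeomorphic_imp_continuous_map[OF hom]
      by (rule openin_continuous_map_preimage) (simp add: openin_open_Int)
    then have "openin X W" using openin_trans_full[OF _ o(1)] by blast
    moreover have "x \<in> W"
      using x c(2) \<open>snd c x \<in> chart_image c\<close> r(1) by (simp add: W_def)
    moreover have "\<forall>y\<in>W. y \<in> fst c \<and> snd c y \<in> cball (snd c x) r"
      by (auto simp: W_def)
    ultimately show ?thesis
      using c(1) r(2) by (intro exI[of _ c] exI[of _ "cball (snd c x) r"] exI[of _ W]) auto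
  qed
  then obtain c K W where cKW: "\<And>x. x \<in> topspace X \<Longrightarrow> c x \<in> A \<and> compact (K x) \<and> K x \<subseteq> chart_image (c x) \<and>
      openin X (W x) \<and> x \<in> W x \<and> (\<forall>y\<in>W x. y \<in> fst (c x) \<and> snd (c x) y \<in> K x)"
    by metis
  have "\<exists>\<F>. finite \<F> \<and> \<F> \<subseteq> W ` topspace X \<and> topspace X \<subseteq> \<Union>\<F>"
    by (rule compactinD[OF X(2)[unfolded compact_space_def]]) (use cKW in auto)
  then obtain \<F> where \<F>: "finite \<F>" "\<F> \<subseteq> W ` topspace X" "topspace X \<subseteq> \<Union>\<F>" by blast
  obtain P where P: "finite P" "P \<subseteq> topspace X" "\<F> = W ` P"
    using finite_subset_image[OF \<F>(1,2)] by blast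
  show ?thesis
  proof (rule that[of "(\<lambda>x. (c x, K x)) ` P"])
    show "finite ((\<lambda>x. (c x, K x)) ` P)" using P(1) by simp
    show "c' \<in> A \<and> compact K' \<and> K' \<subseteq> chart_image c'" if "(c', K') \<in> (\<lambda>x. (c x, K x)) ` P" for c' K'
      using that cKW P(2) by auto
    show "\<exists>(c', K')\<in>(\<lambda>x. (c x, K x)) ` P. x \<in> fst c' \<and> snd c' x \<in> K'" if x: "x \<in> topspace X" for x
    proof -
      obtain y where "y \<in> P" "x \<in> W y" using \<F>(3) P(3) x by auto
      then show ?thesis using cKW P(2) by (intro bexI[of _ "(c y, K y)"]) auto
    qed
  qed
qed

lemma hform_continuous_on:
  fixes H :: "'a::topological_space \<Rightarrow> complex^'n::finite^'n"
  assumes "continuous_on S H" "continuous_on S u" "continuous_on S v"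
  shows "continuous_on S (\<lambda>x. hform (H x) (u x) (v x))"
  unfolding hform_def using assms by (intro continuous_intros)

locale compact_krf = krf X A g
  for X :: "'m topology" and A :: "('m, 'n::finite) chart set" and g :: "real \<Rightarrow> ('m, 'n) tensor11" +
  assumes compact: "compact_space X"
begin

text \<open>One choice of pieces, independent of time, for both compactness arguments below.\<close>

definition cover :: "(('m, 'n) chart \<times> (complex^'n) set) set" where
  "cover = (SOME F. finite F \<and> (\<forall>(c, K)\<in>F. c \<in> A \<and> compact K \<and> K \<subseteq> chart_image c) \<and>
    (\<forall>x\<in>topspace X. \<exists>(c, K)\<in>F. x \<in> fst c \<and> snd c x \<in> K))"

lemma cover:
  shows "finite cover" "(c, K) \<in> cover \<Longrightarrow> c \<in> A" "(c, K) \<in> cover \<Longrightarrow> compact K"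
    "(c, K) \<in> cover \<Longrightarrow> K \<subseteq> chart_image c"
    "x \<in> topspace X \<Longrightarrow> \<exists>(c, K)\<in>cover. x \<in> fst c \<and> snd c x \<in> K"
proof -
  have "\<exists>F. finite F \<and> (\<forall>(c, K)\<in>F. c \<in> A \<and> compact K \<and> K \<subseteq> chart_image c) \<and>
    (\<forall>x\<in>topspace X. \<exists>(c, K)\<in>F. x \<in> fst c \<and> snd c x \<in> K)"
  proof -
    obtain F where F: "finite F" "\<And>c K. (c, K) \<in> F \<Longrightarrow> c \<in> A \<and> compact K \<and> K \<subseteq> chart_image c"
      "\<And>x. x \<in> topspace X \<Longrightarrow> \<exists>(c, K)\<in>F. x \<in> fst c \<and> snd c x \<in> K"
      by (rule compact_chart_cover[OF manifold compact]) (rule that)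
    show ?thesis
      by (intro exI[of _ F] conjI ballI F(1)) (use F(2) in \<open>clarify, blast\<close>, rule F(3))
  qed
  then have *: "finite cover \<and> (\<forall>(c, K)\<in>cover. c \<in> A \<and> compact K \<and> K \<subseteq> chart_image c) \<and>
    (\<forall>x\<in>topspace X. \<exists>(c, K)\<in>cover. x \<in> fst c \<and> snd c x \<in> K)"
    unfolding cover_def by (rule someI_ex)
  show "finite cover" using * by (rule conjunct1)
  have **: "\<forall>(c, K)\<in>cover. c \<in> A \<and> compact K \<and> K \<subseteq> chart_image c" using * by (elim conjE)
  show "c \<in> A" if "(c, K) \<in> cover" using bspec[OF ** that] by simp
  show "compact K" if "(c, K) \<in> cover" using bspec[OF ** that] by simp
  show "K \<subseteq> chart_image c" if "(c, K) \<in> cover" using bspec[OF ** that] by simp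
  have ***: "\<forall>x\<in>topspace X. \<exists>(c, K)\<in>cover. x \<in> fst c \<and> snd c x \<in> K" using * by (elim conjE)
  show "\<exists>(c, K)\<in>cover. x \<in> fst c \<and> snd c x \<in> K" if "x \<in> topspace X" using bspec[OF *** that] .
qed

section \<open>The quadratic forms of the metric and the Ricci tensor\<close>

definition gform :: "real \<Rightarrow> ('m, 'n) chart \<Rightarrow> complex^'n \<Rightarrow> complex^'n \<Rightarrow> real" where
  "gform t c z u = Re (hform (g t c z) u u)"

definition ricform :: "real \<Rightarrow> ('m, 'n) chart \<Rightarrow> complex^'n \<Rightarrow> complex^'n \<Rightarrow> real" where
  "ricform t c z u = Re (hform (ric (g t) c z) u u)"

lemma gform_pos: "t \<ge> 0 \<Longrightarrow> c \<in> A \<Longrightarrow> z \<in> chart_image c \<Longrightarrow> u \<noteq> 0 \<Longrightarrow> gform t c z u > 0"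
  unfolding gform_def by (rule kaehler_metricD(3)[OF kaehler])

text \<open>Change to a chart of the cover and normalize the coordinate vector. The factor
  \<open>l\<close> is the same for both forms and for all times, so ratios of the forms and signs of
  their combinations survive along the whole flow.\<close>

lemma to_cover:
  assumes c: "c \<in> A" "z \<in> chart_image c" and "u \<noteq> 0"
  obtains d K y w l where "(d, K) \<in> cover" "y \<in> K" "norm w = 1" "l > 0"
    "\<And>t. t \<ge> 0 \<Longrightarrow> gform t c z u = l * gform t d y w" "\<And>t. t \<ge> 0 \<Longrightarrow> ricform t c z u = l * ricform t d y w"
proof -
  obtain x where x: "x \<in> fst c" "snd c x = z" using c(2) by (auto simp: chart_image_def)
  have "topspace X = (\<Union>c\<in>A. fst c)" using manifold by (simp add: complex_manifold_def)
  then have "x \<in> topspace X" using c(1) x(1) by auto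
  from cover(5)[OF this] obtain d K where dK: "(d, K) \<in> cover" "x \<in> fst d" "snd d x \<in> K" by blast
  have d: "d \<in> A" "snd d x \<in> chart_image d"
    using cover(2,4)[OF dK(1)] dK(3) by auto
  have "inj_on (snd c) (fst c)"
  proof -
    have "homeomorphic_map (subtopology X (fst c)) (top_of_set (chart_image c)) (snd c)"
      and "openin X (fst c)"
      using manifold c(1) unfolding complex_manifold_def by auto
    then show ?thesis
      using homeomorphic_imp_injective_map[of "subtopology X (fst c)"] openin_subset[of X "fst c"]
      by (simp add: Int_absorb1)
  qed
  then have tr: "transition c d z = snd d x"
    unfolding transition_def x(2)[symmetric] by (simp add: inv_into_f_f x(1))
  have ov: "z \<in> overlap c d" using x dK(2) by (auto simp: overlap_def)
  define v where "v = transition_deriv c d z u"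
  note trans = ric_transition[OF c(1) d(1) ov, unfolded tr, OF _ d(2), of _ u u, folded v_def]
  \<comment> \<open>Positivity of the metric, preserved by the transition, replaces a proof that the
    transition derivative is invertible.\<close>
  have "v \<noteq> 0"
  proof
    assume "v = 0"
    then have "gform 0 c z u = 0" unfolding gform_def trans(2)[OF order_refl] by (simp add: hform_zero)
    then show False using gform_pos[OF order_refl c \<open>u \<noteq> 0\<close>] by simp
  qed
  define w where "w = (1 / norm v) *\<^sub>R v"
  have v: "v = of_real (norm v) *s w"
    unfolding vec_eq_iff vector_smult_component w_def vector_scaleR_component
    using \<open>v \<noteq> 0\<close> by (simp add: scaleR_conv_of_real)
  have scale: "Re (hform H v v) = (norm v)\<^sup>2 * Re (hform H w w)" for H
    by (subst v, subst (2) v) (simp add: hform_scale power2_eq_square)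
  show ?thesis
  proof (rule that[OF dK(1,3)])
    show "norm w = 1" using \<open>v \<noteq> 0\<close> by (simp add: w_def)
    show "(norm v)\<^sup>2 > 0" using \<open>v \<noteq> 0\<close> by simp
    show "gform t c z u = (norm v)\<^sup>2 * gform t d (snd d x) w" "ricform t c z u = (norm v)\<^sup>2 * ricform t d (snd d x) w" if "t \<ge> 0" for t
      unfolding gform_def ricform_def trans[OF that] scale by simp_all
  qed
qed

lemma continuous_gform_ricform:
  assumes "c \<in> A"
  defines "S \<equiv> {(z, u, t). z \<in> chart_image c \<and> t \<ge> 0}"
  shows "continuous_on S (\<lambda>(z, u, t). gform t c z u)" "continuous_on S (\<lambda>(z, u, t). ricform t c z u)"
proof -
  have m: "continuous_on S (\<lambda>x. (fst x, snd (snd x)))" "(\<lambda>x. (fst x, snd (snd x))) ` S \<subseteq> chart_image c \<times> {0..}"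
    by (auto intro!: continuous_intros simp: S_def)
  have "continuous_on S (\<lambda>x. g (snd (snd x)) c (fst x))" "continuous_on S (\<lambda>x. ric (g (snd (snd x))) c (fst x))"
    using continuous_on_compose2[OF smooth_on_imp_continuous_on[OF smooth_g[OF assms(1)]] m]
      continuous_on_compose2[OF ric_continuous[OF assms(1)] m] by simp_all
  note cont = this
  show "continuous_on S (\<lambda>(z, u, t). gform t c z u)"
    unfolding gform_def case_prod_unfold by (intro continuous_intros hform_continuous_on cont)
  show "continuous_on S (\<lambda>(z, u, t). ricform t c z u)"
    unfolding ricform_def case_prod_unfold by (intro continuous_intros hform_continuous_on cont)
qed

text \<open>By \<open>to_cover\<close> every value of the ratio occurs at a unit vector over a
  compact piece, so the values form a compact set. The given point makes it nonempty.\<close>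

lemma ratio_attains_min:
  assumes "c0 \<in> A" "z0 \<in> chart_image c0"
  obtains c z u where "c \<in> A" "z \<in> chart_image c" "u \<noteq> 0"
    "\<And>d y w. d \<in> A \<Longrightarrow> y \<in> chart_image d \<Longrightarrow> w \<noteq> 0 \<Longrightarrow> ricform 0 c z u / gform 0 c z u \<le> ricform 0 d y w / gform 0 d y w"
proof -
  define R where "R = (\<Union>(c, K)\<in>cover. (\<lambda>(z, u). ricform 0 c z u / gform 0 c z u) ` (K \<times> sphere 0 1))"
  have R: "ricform 0 d y w / gform 0 d y w \<in> R" if dyw: "d \<in> A" "y \<in> chart_image d" "w \<noteq> 0" for d y w
  proof -
    obtain c K z u l where *: "(c, K) \<in> cover" "z \<in> K" "norm u = 1" "l > 0"
      "\<And>t. t \<ge> 0 \<Longrightarrow> gform t d y w = l * gform t c z u" "\<And>t. t \<ge> 0 \<Longrightarrow> ricform t d y w = l * ricform t c z u"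
      by (rule to_cover[OF dyw]) (rule that)
    have "ricform 0 d y w / gform 0 d y w = ricform 0 c z u / gform 0 c z u" using *(4-6) by simp
    also have "\<dots> \<in> R"
      unfolding R_def
    proof (rule UN_I[OF *(1)], unfold prod.case, rule image_eqI)
      show "(z, u) \<in> K \<times> sphere 0 1" using *(2,3) by simp
    qed simp
    finally show ?thesis .
  qed
  have R_part: "compact ((\<lambda>(z, u). ricform 0 c z u / gform 0 c z u) ` (K \<times> sphere 0 1))" if cK: "(c, K) \<in> cover" for c K
  proof -
    note c = cover(2)[OF cK] and K = cover(3)[OF cK] and KU = cover(4)[OF cK]
    have m1: "continuous_on (K \<times> sphere (0 :: complex^'n) 1) (\<lambda>x. (fst x, snd x, 0::real))"
      by (intro continuous_intros)
    have m2: "(\<lambda>x. (fst x, snd x, 0::real)) ` (K \<times> sphere (0 :: complex^'n) 1) \<subseteq> {(z, u, t). z \<in> chart_image c \<and> t \<ge> 0}"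
      by (rule image_subsetI) (use KU in auto)
    have "gform 0 c z u \<noteq> 0" if "z \<in> K" "u \<in> sphere 0 1" for z u
    proof -
      have "z \<in> chart_image c" "u \<noteq> 0" using that KU by auto
      from gform_pos[OF order_refl c this] show ?thesis by simp
    qed
    then have "continuous_on (K \<times> sphere 0 1) (\<lambda>(z, u). ricform 0 c z u / gform 0 c z u)"
      using continuous_on_compose2[OF continuous_gform_ricform(1)[OF c] m1 m2] continuous_on_compose2[OF continuous_gform_ricform(2)[OF c] m1 m2]
      by (auto simp: case_prod_unfold intro!: continuous_on_divide)
    then show "compact ((\<lambda>(z, u). ricform 0 c z u / gform 0 c z u) ` (K \<times> sphere 0 1))"
      by (rule compact_continuous_image) (intro compact_Times K compact_sphere)
  qed
  have "compact R"
    unfolding R_def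
  proof (rule compact_UN[OF cover(1)])
    fix x assume "x \<in> cover"
    then show "compact (case x of (c, K) \<Rightarrow> (\<lambda>(z, u). ricform 0 c z u / gform 0 c z u) ` (K \<times> sphere 0 1))"
      using R_part by (cases x) (simp only: prod.case)
  qed
  moreover have "R \<noteq> {}"
    using R[OF assms, of "axis undefined 1"] by (auto simp: axis_eq_0_iff)
  ultimately obtain m where m: "m \<in> R" "\<forall>r\<in>R. m \<le> r"
    using compact_attains_inf by blast
  then obtain c K z u where *: "(c, K) \<in> cover" "z \<in> K" "norm u = 1" "m = ricform 0 c z u / gform 0 c z u"
    unfolding R_def by auto
  show ?thesis
  proof (rule that[of c z u])
    show "c \<in> A" "z \<in> chart_image c" "u \<noteq> 0"
      using cover(2,4)[OF *(1)] *(2,3) by auto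
    show "ricform 0 c z u / gform 0 c z u \<le> ricform 0 d y w / gform 0 d y w"
      if "d \<in> A" "y \<in> chart_image d" "w \<noteq> 0" for d y w
      using m(2) R[OF that] *(4) by simp
  qed
qed

text \<open>At the first time and point where a lower bound that decays like \<open>a(t) = b e\<^sup>-\<^sup>t - \<epsilon>\<close> is attained,
  the null direction makes the bound move away strictly, because \<open>a' + a - a\<^sup>2 = -\<epsilon> - a\<^sup>2 < 0\<close>.\<close>

lemma ricci_lower_bound_strict:
  assumes pob: "\<And>t. t \<ge> 0 \<Longrightarrow> positive_orthogonal_bisectional A (g t)"
    and b: "\<And>c z u. c \<in> A \<Longrightarrow> z \<in> chart_image c \<Longrightarrow> ricform 0 c z u \<ge> b * gform 0 c z u"
    and "\<epsilon> > 0" "t \<ge> 0" "c \<in> A" "z \<in> chart_image c" "u \<noteq> 0"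
  shows "ricform t c z u > (b * exp (- t) - \<epsilon>) * gform t c z u"
proof -
  define a where "a s = b * exp (- s) - \<epsilon>" for s :: real
  define Q where "Q s c z u = ricform s c z u - a s * gform s c z u" for s c z u
  \<comment> \<open>The times up to \<open>t\<close> at which the bound is touched or violated. Each
    part is the projection of a compact set to the time axis, so a nonempty \<open>B\<close> has a
    first element.\<close>
  define B where "B = (\<Union>(d, K)\<in>cover. {s. 0 \<le> s \<and> s \<le> t \<and> (\<exists>y\<in>K. \<exists>w\<in>sphere 0 1. Q s d y w \<le> 0)})"
  have contQ: "continuous_on {(z, u, t). z \<in> chart_image d \<and> t \<ge> 0} (\<lambda>(z, u, t). Q t d z u)" if "d \<in> A" for d
    using continuous_gform_ricform[OF that] unfolding Q_def a_def case_prod_unfold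
    by (intro continuous_intros)
  have B_part: "compact {s. 0 \<le> s \<and> s \<le> t \<and> (\<exists>y\<in>K. \<exists>w\<in>sphere 0 1. Q s d y w \<le> 0)}"
    if dK: "(d, K) \<in> cover" for d K
  proof -
    note d = cover(2)[OF dK] and K = cover(3)[OF dK] and KU = cover(4)[OF dK]
    let ?D = "K \<times> sphere (0 :: complex^'n) 1 \<times> {0..t}"
    let ?E = "?D \<inter> (\<lambda>(y, w, s). Q s d y w) -` {..0}"
    have cD: "compact ?D" by (intro compact_Times K compact_sphere compact_Icc)
    have "continuous_on ?D (\<lambda>(y, w, s). Q s d y w)"
      by (rule continuous_on_subset[OF contQ[OF d]]) (use KU in auto)
    then have "closed ?E"
      by (rule continuous_closed_preimage) (use cD compact_imp_closed in auto)
    then have "compact ?E"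
      using cD by (metis compact_Int_closed inf_left_idem)
    then have "compact ((\<lambda>x. snd (snd x)) ` ?E)"
      by (rule compact_continuous_image[rotated]) (intro continuous_intros)
    moreover have "(\<lambda>x. snd (snd x)) ` ?E = {s. 0 \<le> s \<and> s \<le> t \<and> (\<exists>y\<in>K. \<exists>w\<in>sphere 0 1. Q s d y w \<le> 0)}"
      by force
    ultimately show "compact {s. 0 \<le> s \<and> s \<le> t \<and> (\<exists>y\<in>K. \<exists>w\<in>sphere 0 1. Q s d y w \<le> 0)}" by simp
  qed
  have "compact B"
    unfolding B_def
  proof (rule compact_UN[OF cover(1)])
    fix x assume "x \<in> cover"
    then show "compact (case x of (d, K) \<Rightarrow> {s. 0 \<le> s \<and> s \<le> t \<and> (\<exists>y\<in>K. \<exists>w\<in>sphere 0 1. Q s d y w \<le> 0)})"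
      using B_part by (cases x) (simp only: prod.case)
  qed
  have to_B: "s \<in> B" if s: "0 \<le> s" "s \<le> t" and dyw: "d \<in> A" "y \<in> chart_image d" "w \<noteq> 0"
    and le: "Q s d y w \<le> 0" for s d y w
  proof -
    obtain c K z u l where *: "(c, K) \<in> cover" "z \<in> K" "norm u = 1" "l > 0"
      "\<And>t. t \<ge> 0 \<Longrightarrow> gform t d y w = l * gform t c z u" "\<And>t. t \<ge> 0 \<Longrightarrow> ricform t d y w = l * ricform t c z u"
      by (rule to_cover[OF dyw]) (rule that)
    have "Q s d y w = l * Q s c z u"
      using *(5,6)[OF s(1)] by (simp add: Q_def algebra_simps)
    then have "Q s c z u \<le> 0" using le *(4) by (simp add: mult_le_0_iff)
    then have "s \<in> {s. 0 \<le> s \<and> s \<le> t \<and> (\<exists>y\<in>K. \<exists>w\<in>sphere 0 1. Q s c y w \<le> 0)}"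
      using *(2,3) s by (intro CollectI conjI bexI[of _ z] bexI[of _ u]) simp_all
    then show ?thesis
      unfolding B_def by (intro UN_I[OF *(1)]) simp
  qed
  have "B = {}"
  proof (rule ccontr)
    assume "B \<noteq> {}"
    then obtain t0 where t0: "t0 \<in> B" "\<forall>s\<in>B. t0 \<le> s"
      using compact_attains_inf[OF \<open>compact B\<close>] by blast
    then obtain d K y v where *: "(d, K) \<in> cover" "y \<in> K" "norm v = 1" "0 \<le> t0" "t0 \<le> t" "Q t0 d y v \<le> 0"
      unfolding B_def by auto
    have d: "d \<in> A" "y \<in> chart_image d" and "v \<noteq> 0"
      using cover(2,4)[OF *(1)] *(2,3) by auto
    have before: "Q s c z u > 0" if "0 \<le> s" "s < t0" "c \<in> A" "z \<in> chart_image c" "u \<noteq> 0" for s c z u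
      using to_B[of s c z u] t0(2) that *(5) by force
    \<comment> \<open>Initially the bound holds with margin \<epsilon> times the metric.\<close>
    have "t0 \<noteq> 0"
    proof
      assume "t0 = 0"
      have "0 < \<epsilon> * gform 0 d y v"
        using \<open>\<epsilon> > 0\<close> gform_pos[OF order_refl d \<open>v \<noteq> 0\<close>] by simp
      also have "\<dots> \<le> Q 0 d y v"
        using b[OF d, of v] by (simp add: Q_def a_def algebra_simps)
      finally show False using *(6) \<open>t0 = 0\<close> by simp
    qed
    then have "t0 > 0" using *(4) by simp
    \<comment> \<open>The limit from the left of positive values.\<close>
    have at_t0: "Q t0 c z u \<ge> 0" if c: "c \<in> A" "z \<in> chart_image c" for c z u
    proof (cases "u = 0")
      case True
      then show ?thesis by (simp add: Q_def ricform_def gform_def hform_zero)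
    next
      case False
      have m: "continuous_on {0..} (\<lambda>s::real. (z, u, s))"
        by (intro continuous_intros)
      have "continuous_on {0..} (\<lambda>s. case (z, u, s) of (z, u, s) \<Rightarrow> Q s c z u)"
        by (rule continuous_on_compose2[OF contQ[OF c(1)] m], rule image_subsetI) (use c(2) in simp)
      then have "continuous_on {0..} (\<lambda>s. Q s c z u)" by simp
      then have "isCont (\<lambda>s. Q s c z u) t0"
        using \<open>t0 > 0\<close> by (intro continuous_on_interior) auto
      then have "((\<lambda>s. Q s c z u) \<longlongrightarrow> Q t0 c z u) (at_left t0)"
        unfolding isCont_def by (rule tendsto_mono[rotated]) (simp add: at_le)
      moreover have "\<forall>\<^sub>F s in at_left t0. 0 \<le> Q s c z u"
        unfolding eventually_at_left[OF \<open>t0 > 0\<close>]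
        using before[OF _ _ c False] \<open>t0 > 0\<close> by (intro exI[of _ 0]) (auto intro: less_imp_le)
      ultimately show ?thesis
        by (rule tendsto_lowerbound) simp
    qed
    then have Q0: "Q t0 d y v = 0" using *(6) d by (simp add: order_antisym)
    obtain D where D: "((\<lambda>s. ricform s d y v) has_real_derivative D) (at t0)" "D \<ge> 0"
    proof (rule ric_derivative_nonneg[OF d(1) pob[OF *(4)] d(2) \<open>t0 > 0\<close> \<open>v \<noteq> 0\<close>, where a = "a t0"])
      show "Re (hform (ric (g t0) d y) u u) \<ge> a t0 * Re (hform (g t0 d y) u u)" if "y \<in> chart_image d" for y u
        using at_t0[OF d(1) that, of u] by (simp add: Q_def ricform_def gform_def)
      show "Re (hform (ric (g t0) d y) v v) = a t0 * Re (hform (g t0 d y) v v)"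
        using Q0 by (simp add: Q_def ricform_def gform_def)
    qed (auto simp: ricform_def)
    define \<gamma> where "\<gamma> = gform t0 d y v"
    have "\<gamma> > 0" unfolding \<gamma>_def by (rule gform_pos[OF *(4) d \<open>v \<noteq> 0\<close>])
    have rr0: "ricform t0 d y v = a t0 * \<gamma>" using Q0 by (simp add: Q_def \<gamma>_def)
    \<comment> \<open>The flow gives \<open>g(v, v) - Ric(v, v)\<close>, which at the contact equals
      \<open>(1 - a t0) * \<gamma>\<close>.\<close>
    have "((\<lambda>s. gform s d y v) has_vector_derivative Re (hform (g t0 d y - ric (g t0) d y) v v)) (at t0 within {0..})"
      unfolding gform_def
      by (rule bounded_linear.has_vector_derivative[OF bounded_linear_Re has_vector_derivative_hform[OF flow_eq[OF d *(4)]]])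
    then have Dg: "((\<lambda>s. gform s d y v) has_real_derivative (1 - a t0) * \<gamma>) (at t0)"
      using at_within_interior[of t0 "{0..}"] \<open>t0 > 0\<close> rr0
      by (simp add: has_real_derivative_iff_has_vector_derivative hform_diff_matrix \<gamma>_def ricform_def gform_def algebra_simps)
    have Da: "(a has_real_derivative (- b * exp (- t0))) (at t0)"
      unfolding a_def[abs_def] by (auto intro!: derivative_eq_intros)
    have "((\<lambda>s. Q s d y v) has_real_derivative D - ((- b * exp (- t0)) * \<gamma> + (1 - a t0) * \<gamma> * a t0)) (at t0)"
      unfolding Q_def using DERIV_diff[OF D(1) DERIV_mult[OF Da Dg]] by (simp add: \<gamma>_def)
    moreover have "D - ((- b * exp (- t0)) * \<gamma> + (1 - a t0) * \<gamma> * a t0) > 0"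
    proof -
      have "(- b * exp (- t0)) * \<gamma> + (1 - a t0) * \<gamma> * a t0 = - ((\<epsilon> + (a t0)\<^sup>2) * \<gamma>)"
        by (simp add: a_def power2_eq_square algebra_simps)
      moreover have "(\<epsilon> + (a t0)\<^sup>2) * \<gamma> > 0"
        using \<open>\<epsilon> > 0\<close> \<open>\<gamma> > 0\<close> by (simp add: add_pos_nonneg)
      ultimately show ?thesis using D(2) by linarith
    qed
    \<comment> \<open>A positive derivative at a zero makes \<open>Q\<close> negative just before
      \<open>t0\<close>, against \<open>before\<close>.\<close>
    ultimately obtain \<delta> where \<delta>: "\<delta> > 0" "\<And>h. 0 < h \<Longrightarrow> h < \<delta> \<Longrightarrow> Q (t0 - h) d y v < Q t0 d y v"
      using DERIV_pos_inc_left by blast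
    define h where "h = min \<delta> t0 / 2"
    have "0 < h" "h < \<delta>" "h < t0" using \<delta>(1) \<open>t0 > 0\<close> by (auto simp: h_def)
    then show False
      using \<delta>(2)[of h] Q0 before[OF _ _ d \<open>v \<noteq> 0\<close>, of "t0 - h"] by simp
  qed
  then have "\<not> Q t c z u \<le> 0" using to_B[OF \<open>t \<ge> 0\<close> order_refl assms(5-7)] by blast
  then show ?thesis by (simp add: Q_def a_def)
qed

text \<open>Let \<epsilon> tend to 0 in the strict bound. For a given \<open>u\<close>, the choice
  \<epsilon> = \<open>e / gform t c z u\<close> makes the error exactly \<open>e\<close>.\<close>

lemma ricci_lower_bound:
  assumes pob: "\<And>t. t \<ge> 0 \<Longrightarrow> positive_orthogonal_bisectional A (g t)"
    and b: "ricci_ge A (g 0) b" and t: "t \<ge> 0"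
  shows "ricci_ge A (g t) (b * exp (- t))"
  unfolding ricci_ge_def
proof (intro ballI allI)
  fix c z u assume c: "c \<in> A" "z \<in> chart_image c"
  show "Re (hform (ric (g t) c z) u u) \<ge> b * exp (- t) * Re (hform (g t c z) u u)"
  proof (cases "u = 0")
    case True
    then show ?thesis by (simp add: hform_zero)
  next
    case False
    have b': "\<And>c z u. c \<in> A \<Longrightarrow> z \<in> chart_image c \<Longrightarrow> ricform 0 c z u \<ge> b * gform 0 c z u"
      using b by (simp add: ricci_ge_def ricform_def gform_def)
    have pos: "gform t c z u > 0" by (rule gform_pos[OF t c False])
    have "b * exp (- t) * gform t c z u \<le> ricform t c z u"
    proof (rule field_le_epsilon)
      fix e :: real assume "e > 0"
      then have "e / gform t c z u > 0" using pos by simp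
      from ricci_lower_bound_strict[OF pob b' this t c False]
      have "(b * exp (- t) - e / gform t c z u) * gform t c z u < ricform t c z u" .
      then show "b * exp (- t) * gform t c z u \<le> ricform t c z u + e"
        using pos by (simp add: left_diff_distrib)
    qed
    then show ?thesis by (simp add: ricform_def gform_def)
  qed
qed

text \<open>The minimum of the ratio is the optimal bound. That a vector attains it turns pointwise
  positivity of the Ricci curvature into a positive constant.\<close>

lemma optimal_bound_attained:
  assumes "c0 \<in> A" "z0 \<in> chart_image c0"
  obtains b c z u where "optimal_ricci_bound A (g 0) b" "c \<in> A" "z \<in> chart_image c" "u \<noteq> 0"
    "ricform 0 c z u = b * gform 0 c z u"
proof -
  obtain c z u where *: "c \<in> A" "z \<in> chart_image c" "u \<noteq> 0"
    "\<And>d y w. d \<in> A \<Longrightarrow> y \<in> chart_image d \<Longrightarrow> w \<noteq> 0 \<Longrightarrow> ricform 0 c z u / gform 0 c z u \<le> ricform 0 d y w / gform 0 d y w"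
    by (rule ratio_attains_min[OF assms]) (rule that)
  define b where "b = ricform 0 c z u / gform 0 c z u"
  have eq: "ricform 0 c z u = b * gform 0 c z u"
    using gform_pos[OF order_refl *(1-3)] by (simp add: b_def)
  have "ricci_ge A (g 0) b"
    unfolding ricci_ge_def
  proof (intro ballI allI)
    fix d y w assume d: "d \<in> A" "y \<in> chart_image d"
    show "b * Re (hform (g 0 d y) w w) \<le> Re (hform (ric (g 0) d y) w w)"
    proof (cases "w = 0")
      case True
      then show ?thesis by (simp add: hform_zero)
    next
      case False
      have "b \<le> ricform 0 d y w / gform 0 d y w" unfolding b_def by (rule *(4)[OF d False])
      then show ?thesis using gform_pos[OF order_refl d False] by (simp add: pos_le_divide_eq ricform_def gform_def)
    qed
  qed
  moreover have "b' \<le> b" if "ricci_ge A (g 0) b'" for b'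
  proof -
    have "b' * gform 0 c z u \<le> b * gform 0 c z u"
      using that *(1,2) unfolding eq[symmetric] by (simp add: ricci_ge_def ricform_def gform_def)
    then show ?thesis using gform_pos[OF order_refl *(1-3)] by simp
  qed
  ultimately show ?thesis
    using that[OF _ *(1-3) eq] by (auto simp: optimal_ricci_bound_def)
qed

end

theorem theorem1p2:
  fixes X :: "'m topology" and A :: "('m, 'n::finite) chart set"
    and g :: "real \<Rightarrow> ('m, 'n) tensor11"
  assumes "compact_kaehler_manifold X A"
    and "positive_c1 A"
    and "kaehler_ricci_flow A g"
    and "canonical_class A (g 0)"
    and "\<forall>t\<ge>0. positive_orthogonal_bisectional A (g t)"
  shows "(positive_ricci A (g 0) \<longrightarrow> (\<forall>t\<ge>0. positive_ricci A (g t))) \<and>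
    (\<not> positive_ricci A (g 0) \<longrightarrow>
      (\<exists>\<mu>\<^sub>0\<ge>0. optimal_ricci_bound A (g 0) (- \<mu>\<^sub>0) \<and>
        (\<exists>\<mu> :: real \<Rightarrow> real.
          (\<forall>t\<ge>0. \<mu> t \<ge> 0) \<and>
          antimono_on {0..} \<mu> \<and>
          strict_antimono_on {t. 0 \<le> t \<and> \<mu> t > 0} \<mu> \<and>
          \<mu> 0 = \<mu>\<^sub>0 \<and>
          (\<mu> \<longlongrightarrow> 0) at_top \<and>
          (\<forall>t\<ge>0. ricci_ge A (g t) (- \<mu> t)))))"
proof -
  interpret compact_krf X A g
    using assms(1,3) by unfold_locales (auto simp: compact_kaehler_manifold_def)
  have pob: "positive_orthogonal_bisectional A (g t)" if "t \<ge> 0" for t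
    using assms(5) that by blast
  show ?thesis
  proof (intro conjI impI allI)
    fix t :: real
    assume P: "positive_ricci A (g 0)" and t: "t \<ge> 0"
    show "positive_ricci A (g t)"
      unfolding positive_ricci_def
    proof (intro ballI allI impI)
      fix c z and u :: "complex^'n"
      assume c: "c \<in> A" "z \<in> chart_image c" and "u \<noteq> 0"
      \<comment> \<open>The point at which positivity is to be shown also witnesses that the
        manifold is nonempty.\<close>
      obtain b d y w where *: "optimal_ricci_bound A (g 0) b" "d \<in> A" "y \<in> chart_image d" "w \<noteq> 0"
        "ricform 0 d y w = b * gform 0 d y w"
        by (rule optimal_bound_attained[OF c]) (rule that)
      have "ricform 0 d y w > 0" using P *(2-4) by (simp add: positive_ricci_def ricform_def)
      then have "b > 0"
        using gform_pos[OF order_refl *(2-4)] *(5) by (simp add: zero_less_mult_iff)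
      have "ricci_ge A (g t) (b * exp (- t))"
        using *(1) by (intro ricci_lower_bound[OF pob _ t]) (simp_all add: optimal_ricci_bound_def)
      then have "b * exp (- t) * gform t c z u \<le> Re (hform (ric (g t) c z) u u)"
        using c by (simp add: ricci_ge_def gform_def)
      moreover have "b * exp (- t) * gform t c z u > 0"
        using \<open>b > 0\<close> gform_pos[OF t c \<open>u \<noteq> 0\<close>] by simp
      ultimately show "Re (hform (ric (g t) c z) u u) > 0" by linarith
    qed
  next
    assume "\<not> positive_ricci A (g 0)"
    then obtain c z u where c: "c \<in> A" "z \<in> chart_image c" "u \<noteq> 0" "ricform 0 c z u \<le> 0"
      unfolding positive_ricci_def ricform_def by (auto simp: not_less)
    obtain b where b: "optimal_ricci_bound A (g 0) b"
      by (rule optimal_bound_attained[OF c(1,2)]) (rule that)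
    then have ge: "ricci_ge A (g 0) b" by (simp add: optimal_ricci_bound_def)
    then have "b * gform 0 c z u \<le> 0"
      using c(1,2,4) unfolding ricci_ge_def ricform_def gform_def by (meson order_trans)
    then have "b \<le> 0"
      using gform_pos[OF order_refl c(1-3)] by (simp add: mult_le_0_iff)
    \<comment> \<open>Since \<open>- b\<close> is the required initial value, this is the decay
      supplied by \<open>ricci_lower_bound\<close>.\<close>
    define \<mu> where "\<mu> t = - b * exp (- t)" for t
    have "\<forall>t\<ge>0. \<mu> t \<ge> 0"
      using \<open>b \<le> 0\<close> by (simp add: \<mu>_def mult_nonpos_nonneg)
    moreover have "antimono_on {0..} \<mu>"
      using \<open>b \<le> 0\<close> by (intro monotone_onI) (auto simp: \<mu>_def intro: mult_left_mono_neg)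
    \<comment> \<open>For \<open>b = 0\<close> the set is empty; a member forces
      \<open>b < 0\<close>, and then the exponential decreases strictly.\<close>
    moreover have "strict_antimono_on {t. 0 \<le> t \<and> \<mu> t > 0} \<mu>"
      by (intro monotone_onI) (auto simp: \<mu>_def zero_less_mult_iff mult_less_0_iff)
    moreover have "(\<mu> \<longlongrightarrow> 0) at_top"
    proof -
      have "((\<lambda>t::real. exp (- t)) \<longlongrightarrow> 0) at_top"
        by (rule filterlim_compose[OF exp_at_bot filterlim_uminus_at_bot_at_top])
      from tendsto_mult_right_zero[OF this, of "- b"] show ?thesis by (simp add: \<mu>_def[abs_def])
    qed
    moreover have "\<forall>t\<ge>0. ricci_ge A (g t) (- \<mu> t)"
      using ricci_lower_bound[OF pob ge] by (simp add: \<mu>_def)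
    ultimately show "\<exists>\<mu>\<^sub>0\<ge>0. optimal_ricci_bound A (g 0) (- \<mu>\<^sub>0) \<and>
        (\<exists>\<mu> :: real \<Rightarrow> real.
          (\<forall>t\<ge>0. \<mu> t \<ge> 0) \<and>
          antimono_on {0..} \<mu> \<and>
          strict_antimono_on {t. 0 \<le> t \<and> \<mu> t > 0} \<mu> \<and>
          \<mu> 0 = \<mu>\<^sub>0 \<and>
          (\<mu> \<longlongrightarrow> 0) at_top \<and>
          (\<forall>t\<ge>0. ricci_ge A (g t) (- \<mu> t)))"
      using \<open>b \<le> 0\<close> b by (intro exI[of _ "- b"] conjI exI[of _ \<mu>]) (simp_all add: \<mu>_def)
  qed
qed

end
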